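(* Let $p=p(n)$ satisfy $1/2>p=\Omega\left(\frac{\ln n}{n}\right)$ (that is, there is a constant $c>0$ with $p\ge\frac{c\ln n}{n}$ for all sufficiently large $n$). For each $n$ let $Q$ be a random symmetric $n\times n$ complex matrix whose entries $\xi_{ij}$, $1\le i\le j\le n$, on and above the diagonal are independent random variables (not necessarily identically distributed or Bernoulli), such that $\mathbf{P}(\xi_{ij}=0)=1-p$ for all $i<j$, and each diagonal entry is $0$ with probability at least $1-p$. Then almost surely (with probability tending to $1$ as $n\to\infty$) $$\operatorname{rank}(Q)=\min_{S\subset V(G(Q))}\bigl(n-|S|+|N(S)|\bigr).$$
   Context: The graph $G(Q)$ of a symmetric $n\times n$ matrix $Q$ has the rows $1,\dots,n$ of $Q$ as vertices, with $i$ adjacent to $j$ if and only if $q_{ij}\ne 0$ (self-loops occur at $i$ when $q_{ii}\neq 0$). For a set $S$ of vertices, $N(S)$ is the set of vertices adjacent to at least one vertex of $S$ ($N(S)$ may contain elements of $S$). The minimum is over all subsets $S$ of the vertex set. *)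

theory Defs
  imports
    "HOL-Probability.Probability"
    "Jordan_Normal_Form.DL_Rank"
    "Graph_Theory.Digraph"
    "Graph_Theory.Pair_Digraph"
begin

text \<open>
  Matrix rows, and hence the vertices, are numbered from 0. An undirected graph with self-loops
  is encoded by its arcs: for a symmetric matrix the arc relation is symmetric, and an arc
  \<open>(i, i)\<close> is a self-loop.
\<close>

definition mat_graph :: "'a::zero mat \<Rightarrow> nat pair_pre_digraph" where
  "mat_graph A = \<lparr> pverts = {..<dim_row A},
                   parcs = {(i, j). i < dim_row A \<and> j < dim_row A \<and> A $$ (i, j) \<noteq> 0} \<rparr>"

text \<open>The neighbourhood of \<open>S\<close> is not required to be disjoint from \<open>S\<close>.\<close>

definition neighbourhood :: "'v pair_pre_digraph \<Rightarrow> 'v set \<Rightarrow> 'v set" where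
  "neighbourhood G S = {v \<in> pverts G. \<exists>u\<in>S. (u, v) \<in> parcs G}"

text \<open>
  The rank over the field of entries. The library defines it as the dimension of the column
  space inside vectors of a fixed length, which has to be the number of rows.
\<close>

definition mat_rank :: "'a::field mat \<Rightarrow> nat" where
  "mat_rank A = vec_space.rank (dim_row A) A"

text \<open>
  The entries on and above the diagonal are independent random variables, and the matrix is
  symmetric at every sample point.
\<close>

definition random_symmetric_mat ::
  "'a measure \<Rightarrow> nat \<Rightarrow> ('a \<Rightarrow> complex mat) \<Rightarrow> bool" where
  "random_symmetric_mat M n Q \<longleftrightarrow>
     (\<forall>\<omega>\<in>space M. Q \<omega> \<in> carrier_mat n n \<and> transpose_mat (Q \<omega>) = Q \<omega>) \<and>
     prob_space.indep_vars M (\<lambda>_. borel) (\<lambda>(i, j) \<omega>. Q \<omega> $$ (i, j)) {(i, j). i \<le> j \<and> j < n}"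

end

theory Submission
  imports Defs "HOL-Real_Asymp.Real_Asymp"
begin

text \<open>
  Only \<open>n p \<longrightarrow> \<infinity>\<close> matters. Conditioning on the values that the entries take when they are allowed to be
  nonzero, the matrix becomes a fixed weight matrix restricted to a random edge set. If the support
  \<open>T\<close> of the kernel is small, then so are all circuits of columns, and a first moment computation
  shows that every small circuit \<open>S\<close> satisfies \<open>|N(S)| = |S| - 1\<close>. The columns of such an \<open>S\<close> span all
  vectors supported on \<open>N(S)\<close>, which gives \<open>rank = n - |T| + |N(T)|\<close>.

  That \<open>T\<close> has \<open>o(n)\<close> elements in expectation is shown one vertex \<open>i\<close> at a time. Delete row and column
  \<open>i\<close>, leaving \<open>A\<close>, and let \<open>x\<close> be the deleted column. If \<open>i \<in> T\<close> then \<open>A u = x\<close> and \<open>x \<bullet> u = a\<close> for some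
  \<open>u\<close>, with \<open>a\<close> the deleted diagonal entry. If \<open>A\<close> has a null vector with large support, then
  \<open>x\<close> being orthogonal to it is unlikely by anti-concentration. Otherwise most unit vectors are of the
  form \<open>A w\<close>, where the support of \<open>w\<close> is large by another first moment computation, and decoupling
  reduces the quadratic condition on \<open>x\<close> to the linear case.
\<close>

text \<open>Every bound is uniform in the weights \<open>W\<close>: the constants depend on
  \<open>\<epsilon>\<close> only. This is why the laws of the nonzero values, which are arbitrary,
  can be kept out of the argument until the very end, and why finite sums over edge sets suffice
  before that. The obstacle is symmetry, which makes the rows dependent. For a set \<open>S\<close>
  of columns, the edges joining distinct vertices outside \<open>S\<close> to \<open>S\<close> form
  disjoint stars, so the rows outside \<open>S\<close>, restricted to \<open>S\<close>, are
  independent. The first moment computations draw their exponential factors from those rows alone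
  and need \<open>S\<close> to be a small fraction of the vertices; large supports are left to
  anti-concentration. The fraction 1/100 is such that the number of pairs of small sets is beaten by
  the probability that half of all rows are orthogonal to a prescribed vector. A second obstacle is
  the diagonal, whose entries may vanish with probability larger than \<open>1 - p\<close>. Diagonal
  weights are therefore allowed to be zero, and only the other weights are assumed nonzero.\<close>

section \<open>Expectations over random subsets with independent coordinates\<close>

definition bern :: "real \<Rightarrow> 'e set \<Rightarrow> ('e set \<Rightarrow> real) \<Rightarrow> real" where
  "bern p I f = (\<Sum>E\<in>Pow I. p ^ card E * (1 - p) ^ card (I - E) * f E)"

abbreviation pr :: "real \<Rightarrow> 'e set \<Rightarrow> ('e set \<Rightarrow> bool) \<Rightarrow> real" where
  "pr p I P \<equiv> bern p I (\<lambda>E. of_bool (P E))"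

lemma bern_empty [simp]: "bern p {} f = f {}"
  by (simp add: bern_def)

lemma bern_insert:
  assumes "finite I" "e \<notin> I"
  shows "bern p (insert e I) f = p * bern p I (\<lambda>E. f (insert e E)) + (1 - p) * bern p I f"
proof -
  let ?t = "\<lambda>E. p ^ card E * (1 - p) ^ card (insert e I - E) * f E"
  have inj: "inj_on (insert e) (Pow I)"
    using assms by (auto simp: inj_on_def)
  have disj: "Pow I \<inter> insert e ` Pow I = {}"
    using assms by auto
  have 1: "?t (insert e E) =
      p * (p ^ card E * (1 - p) ^ card (I - E) * f (insert e E))" if "E \<in> Pow I" for E
  proof -
    have "finite E" "e \<notin> E" using that assms finite_subset by auto
    moreover have "insert e I - insert e E = I - E" using assms that by auto
    ultimately show ?thesis by simp
  qed
  have 2: "?t E =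
      (1 - p) * (p ^ card E * (1 - p) ^ card (I - E) * f E)" if "E \<in> Pow I" for E
  proof -
    have "insert e I - E = insert e (I - E)" using assms that by auto
    moreover have "card (insert e (I - E)) = Suc (card (I - E))" using assms by simp
    ultimately show ?thesis by simp
  qed
  have "bern p (insert e I) f =
     (\<Sum>E\<in>Pow I. ?t E) +
     (\<Sum>E\<in>insert e ` Pow I. ?t E)"
    unfolding bern_def Pow_insert using assms disj
    by (subst sum.union_disjoint) auto
  also have "(\<Sum>E\<in>insert e ` Pow I. ?t E) =
     p * bern p I (\<lambda>E. f (insert e E))"
    unfolding sum.reindex[OF inj] bern_def sum_distrib_left o_def using 1 by (intro sum.cong) auto
  also have "(\<Sum>E\<in>Pow I. ?t E) =
     (1 - p) * bern p I f"
    unfolding bern_def sum_distrib_left using 2 by (intro sum.cong) auto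
  finally show ?thesis by simp
qed

lemma bern_cong: "(\<And>E. E \<subseteq> I \<Longrightarrow> f E = g E) \<Longrightarrow> bern p I f = bern p I g"
  unfolding bern_def by (intro sum.cong) auto

lemma bern_mono:
  assumes "0 \<le> p" "p \<le> 1" "\<And>E. E \<subseteq> I \<Longrightarrow> f E \<le> g E"
  shows "bern p I f \<le> bern p I g"
  unfolding bern_def using assms by (intro sum_mono mult_left_mono) auto

lemma bern_add: "bern p I (\<lambda>E. f E + g E) = bern p I f + bern p I g"
  unfolding bern_def by (simp add: sum.distrib algebra_simps)

lemma bern_cmult: "bern p I (\<lambda>E. c * f E) = c * bern p I f"
  unfolding bern_def by (simp add: sum_distrib_left mult_ac)

lemma bern_sum: "bern p I (\<lambda>E. \<Sum>x\<in>X. f x E) = (\<Sum>x\<in>X. bern p I (f x))"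
  unfolding bern_def sum_distrib_left by (rule sum.swap)

lemma bern_swap: "bern p I (\<lambda>E. bern q J (\<lambda>F. f E F)) = bern q J (\<lambda>F. bern p I (\<lambda>E. f E F))"
  unfolding bern_def sum_distrib_left by (subst sum.swap) (simp add: mult_ac)

lemma bern_const [simp]: "finite I \<Longrightarrow> bern p I (\<lambda>_. c) = c"
  by (induction I rule: finite_induct) (auto simp: bern_insert algebra_simps)

lemma bern_nonneg:
  assumes "0 \<le> p" "p \<le> 1" "\<And>E. E \<subseteq> I \<Longrightarrow> 0 \<le> f E"
  shows "0 \<le> bern p I f"
  unfolding bern_def using assms by (intro sum_nonneg mult_nonneg_nonneg) auto

lemma bern_le_const:
  assumes "finite I" "0 \<le> p" "p \<le> 1" "\<And>E. E \<subseteq> I \<Longrightarrow> f E \<le> c"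
  shows "bern p I f \<le> c"
  using bern_mono[OF assms(2,3), of I f "\<lambda>_. c"] assms by simp

lemma pr_le_1: "finite I \<Longrightarrow> 0 \<le> p \<Longrightarrow> p \<le> 1 \<Longrightarrow> pr p I P \<le> 1"
  by (rule bern_le_const) auto

lemma pr_mono:
  assumes "0 \<le> p" "p \<le> 1" "\<And>E. E \<subseteq> I \<Longrightarrow> P E \<Longrightarrow> Q E"
  shows "pr p I P \<le> pr p I Q"
  using assms by (intro bern_mono) auto

lemma pr_disj_le:
  assumes "0 \<le> p" "p \<le> 1"
  shows "pr p I (\<lambda>E. P E \<or> Q E) \<le> pr p I P + pr p I Q"
  unfolding bern_add[symmetric] using assms by (intro bern_mono) auto

lemma pr_Bex_le:
  assumes "0 \<le> p" "p \<le> 1" "finite X"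
  shows "pr p I (\<lambda>E. \<exists>x\<in>X. P x E) \<le> (\<Sum>x\<in>X. pr p I (P x))"
  unfolding bern_sum[symmetric]
proof (intro bern_mono assms)
  fix E
  show "of_bool (\<exists>x\<in>X. P x E) \<le> (\<Sum>x\<in>X. of_bool (P x E) :: real)"
  proof (cases "\<exists>x\<in>X. P x E")
    case True
    then obtain x where "x \<in> X" "P x E" by blast
    then show ?thesis
      using member_le_sum[of x X "\<lambda>x. of_bool (P x E) :: real"] assms by auto
  qed (auto intro: sum_nonneg)
qed

lemma bern_Un:
  assumes "finite C" "finite D" "C \<inter> D = {}"
  shows "bern p (C \<union> D) f = bern p C (\<lambda>X. bern p D (\<lambda>Y. f (X \<union> Y)))"
  using assms
proof (induction C arbitrary: f rule: finite_induct)
  case (insert e C)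
  then show ?case by (simp add: bern_insert)
qed simp

lemma bern_image:
  assumes "finite I" "inj_on g I"
  shows "bern p (g ` I) f = bern p I (\<lambda>E. f (g ` E))"
  using assms
proof (induction I arbitrary: f rule: finite_induct)
  case (insert e I)
  then have "g e \<notin> g ` I" by auto
  with insert show ?case by (simp add: bern_insert)
qed simp

lemma bern_marginal:
  assumes "finite I" "C \<subseteq> I"
  shows "bern p I (\<lambda>E. f (E \<inter> C)) = bern p C f"
proof -
  have fin: "finite C" "finite (I - C)" using assms finite_subset by auto
  have "bern p I (\<lambda>E. f (E \<inter> C)) = bern p (C \<union> (I - C)) (\<lambda>E. f (E \<inter> C))"
    using assms by (simp add: Un_absorb1)
  also have "... = bern p C (\<lambda>X. bern p (I - C) (\<lambda>Y. f ((X \<union> Y) \<inter> C)))"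
    using fin by (intro bern_Un) auto
  also have "... = bern p C (\<lambda>X. bern p (I - C) (\<lambda>Y. f X))"
    by (intro bern_cong arg_cong[of _ _ f]) auto
  finally show ?thesis using fin by simp
qed

lemma bern_indep:
  assumes "finite I" "C \<subseteq> I" "D \<subseteq> I" "C \<inter> D = {}"
  shows "bern p I (\<lambda>E. f (E \<inter> C) * g (E \<inter> D)) = bern p C f * bern p D g"
proof -
  have fin: "finite C" "finite D" using assms by (auto intro: finite_subset)
  let ?fg = "\<lambda>F. f (F \<inter> C) * g (F \<inter> D)"
  have "bern p I (\<lambda>E. f (E \<inter> C) * g (E \<inter> D)) =
      bern p I (\<lambda>E. ?fg (E \<inter> (C \<union> D)))"
    by (simp add: Int_assoc Int_absorb1)
  also have "... = bern p (C \<union> D) ?fg"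
    using assms by (intro bern_marginal) auto
  also have "... = bern p C (\<lambda>X. bern p D (\<lambda>Y. f ((X \<union> Y) \<inter> C) * g ((X \<union> Y) \<inter> D)))"
    using fin assms by (intro bern_Un) auto
  also have "... = bern p C (\<lambda>X. bern p D (\<lambda>Y. f X * g Y))"
  proof (intro bern_cong)
    fix X Y assume "X \<subseteq> C" "Y \<subseteq> D"
    then have "(X \<union> Y) \<inter> C = X" "(X \<union> Y) \<inter> D = Y" using assms by auto
    then show "f ((X \<union> Y) \<inter> C) * g ((X \<union> Y) \<inter> D) = f X * g Y" by simp
  qed
  also have "... = bern p C f * bern p D g"
    by (simp add: bern_cmult) (simp add: mult.commute[of _ "bern p D g"] bern_cmult)
  finally show ?thesis .
qed

text \<open>Independence of functions of disjoint blocks of coordinates. The blocks used later are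
  the stars of distinct vertices.\<close>

lemma bern_blocks:
  assumes "finite K" "finite I" "(\<Union>k\<in>K. D k) \<subseteq> I" "\<And>k l. k \<in> K \<Longrightarrow> l \<in> K \<Longrightarrow> k \<noteq> l \<Longrightarrow> D k \<inter> D l = {}"
  shows "bern p I (\<lambda>E. \<Prod>k\<in>K. g k (E \<inter> D k)) = (\<Prod>k\<in>K. bern p (D k) (g k))"
  using assms
proof (induction K arbitrary: I rule: finite_induct)
  case (insert k K)
  let ?U = "\<Union>l\<in>K. D l"
  have *: "E \<inter> ?U \<inter> D l = E \<inter> D l" if "l \<in> K" for E l using that by auto
  have fU: "finite ?U" by (rule finite_subset[OF _ insert.prems(1)]) (use insert.prems in auto)
  have disj: "D k \<inter> ?U = {}"
    using insert.prems(3)[of k] insert.hyps by fastforce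
  have "bern p I (\<lambda>E. \<Prod>k\<in>insert k K. g k (E \<inter> D k)) =
     bern p I (\<lambda>E. g k (E \<inter> D k) * (\<lambda>F. \<Prod>k\<in>K. g k (F \<inter> D k)) (E \<inter> ?U))"
    using insert.hyps * by simp
  also have "... = bern p (D k) (g k) * bern p ?U (\<lambda>F. \<Prod>k\<in>K. g k (F \<inter> D k))"
    using insert.prems disj by (intro bern_indep) auto
  also have "bern p ?U (\<lambda>F. \<Prod>k\<in>K. g k (F \<inter> D k)) = (\<Prod>k\<in>K. bern p (D k) (g k))"
    using insert.prems fU by (intro insert.IH) auto
  finally show ?case using insert.hyps by simp
qed simp

text \<open>The variance is nonnegative. For decoupling: the square of a conditional probability
  describes two independent copies.\<close>

lemma bern_square:
  assumes "finite I" "0 \<le> p" "p \<le> 1"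
  shows "(bern p I f)\<^sup>2 \<le> bern p I (\<lambda>E. (f E)\<^sup>2)"
proof -
  let ?m = "bern p I f"
  have "0 \<le> bern p I (\<lambda>E. (f E - ?m)\<^sup>2)"
    using assms by (intro bern_nonneg) auto
  also have "... = bern p I (\<lambda>E. (f E)\<^sup>2 + ((-2 * ?m) * f E + ?m\<^sup>2))"
    by (intro bern_cong) (simp add: power2_eq_square algebra_simps)
  also have "... = bern p I (\<lambda>E. (f E)\<^sup>2) - ?m\<^sup>2"
    using assms by (simp only: bern_add bern_cmult bern_const) (simp add: power2_eq_square)
  finally show ?thesis by simp
qed

lemma pr_markov:
  assumes "0 \<le> p" "p \<le> 1" "0 < t" "\<And>E. E \<subseteq> I \<Longrightarrow> 0 \<le> f E"
  shows "pr p I (\<lambda>E. t \<le> f E) \<le> bern p I f / t"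
proof -
  have "pr p I (\<lambda>E. t \<le> f E) \<le> bern p I (\<lambda>E. (1 / t) * f E)"
    using assms by (intro bern_mono) (auto simp: field_simps)
  then show ?thesis unfolding bern_cmult by simp
qed

lemma pr_superset:
  assumes "finite I" "F \<subseteq> I"
  shows "pr p I (\<lambda>E. F \<subseteq> E) = p ^ card F"
proof -
  have "pr p I (\<lambda>E. F \<subseteq> E) = bern p I (\<lambda>E. of_bool (F \<subseteq> E \<inter> F))" by (intro bern_cong) auto
  also have "... = pr p F (\<lambda>E. F \<subseteq> E)" using bern_marginal[OF assms] .
  also have "... = (\<Sum>E\<in>Pow F. if E = F then p ^ card F else 0)"
    unfolding bern_def by (intro sum.cong) auto
  also have "... = p ^ card F" using assms finite_subset[of F I] by simp
  finally show ?thesis .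
qed

lemma pr_card_ge:
  assumes "finite I" "0 \<le> p" "p \<le> 1"
  shows "pr p I (\<lambda>E. t \<le> card E) \<le> real (card I choose t) * p ^ t"
proof -
  have "pr p I (\<lambda>E. t \<le> card E) \<le> pr p I (\<lambda>E. \<exists>F\<in>{F. F \<subseteq> I \<and> card F = t}. F \<subseteq> E)"
  proof (intro pr_mono assms)
    fix E assume "E \<subseteq> I" "t \<le> card E"
    then obtain F where "F \<subseteq> E" "card F = t" by (meson obtain_subset_with_card_n)
    with \<open>E \<subseteq> I\<close> show "\<exists>F\<in>{F. F \<subseteq> I \<and> card F = t}. F \<subseteq> E" by blast
  qed
  also have "... \<le> (\<Sum>F\<in>{F. F \<subseteq> I \<and> card F = t}. pr p I (\<lambda>E. F \<subseteq> E))"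
    using assms by (intro pr_Bex_le) auto
  also have "... = (\<Sum>F\<in>{F. F \<subseteq> I \<and> card F = t}. p ^ t)"
    using assms by (intro sum.cong) (auto simp: pr_superset)
  also have "... = real (card I choose t) * p ^ t"
    using assms by (simp add: n_subsets)
  finally show ?thesis .
qed

text \<open>A row with exactly one nonzero entry in \<open>S\<close> cannot be orthogonal to a
  vector that is nonzero on all of \<open>S\<close>; this is the probability of escaping that
  obstruction.\<close>

lemma pr_card_neq_1:
  assumes "finite I"
  shows "pr p I (\<lambda>E. card E \<noteq> 1) = 1 - real (card I) * p * (1 - p) ^ (card I - 1)"
proof -
  have "pr p I (\<lambda>E. card E = 1) = (\<Sum>E\<in>Pow I. if card E = 1 then p * (1 - p) ^ (card I - 1) else 0)"
    unfolding bern_def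
  proof (intro sum.cong refl)
    fix E assume "E \<in> Pow I"
    then have "finite E" "card (I - E) = card I - card E"
      using assms by (auto intro: finite_subset card_Diff_subset)
    then show "p ^ card E * (1 - p) ^ card (I - E) * of_bool (card E = 1) =
        (if card E = 1 then p * (1 - p) ^ (card I - 1) else 0)" by simp
  qed
  also have "... = (\<Sum>E\<in>{E. E \<subseteq> I \<and> card E = 1}. p * (1 - p) ^ (card I - 1))"
    using assms by (subst sum.inter_filter[symmetric]) (auto intro!: sum.cong)
  also have "... = real (card I) * p * (1 - p) ^ (card I - 1)"
    using assms by (simp add: n_subsets)
  finally have "pr p I (\<lambda>E. card E = 1) = real (card I) * p * (1 - p) ^ (card I - 1)" .
  moreover have "pr p I (\<lambda>E. card E \<noteq> 1) + pr p I (\<lambda>E. card E = 1) = 1"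
    unfolding bern_add[symmetric] using assms by (subst bern_cong[of I _ "\<lambda>_. 1"]) auto
  ultimately show ?thesis by simp
qed

subsection \<open>Anti-concentration\<close>

text \<open>
  The sum of the \<open>r\<close> largest atoms of \<open>\<Sum>e\<in>E. v e\<close> is dominated by a lazy random walk started at
  \<open>r\<close> and killed at \<open>0\<close>: for a set \<open>A\<close> of values, \<open>P(A) + P(A - v) = P(A \<union> (A - v)) + P(A \<inter> (A - v))\<close>,
  and the union is strictly larger than \<open>A\<close>. The function \<open>lo_bound\<close> is an explicit supersolution
  for that walk, built from the truncated parabola \<open>r (2 R - r)\<close>.
\<close>

definition lo_profile :: "nat \<Rightarrow> nat \<Rightarrow> real" where
  "lo_profile R r = (if r \<le> R then real r * (2 * real R - real r) else (real R)\<^sup>2)"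

text \<open>The second difference of the parabola with step \<open>s\<close> is exactly
  \<open>- 2 * s^2\<close>. If the upper point passes the vertex \<open>R = r + t\<close>, the
  second difference becomes \<open>t^2 - 2 * t * s - s^2\<close>, which is at most -2 because
  \<open>s \<ge> t \<ge> 1\<close>.\<close>

lemma lo_profile_concave:
  assumes "0 < r" "r < R" "0 < s" "s \<le> r"
  shows "lo_profile R (r + s) + lo_profile R (r - s) \<le> 2 * lo_profile R r - 2"
proof (cases "r + s \<le> R")
  case True
  have "real s * real s \<ge> 1" using assms mult_mono[of 1 "real s" 1 "real s"] by simp
  moreover have "r - s \<le> R" using assms by simp
  ultimately show ?thesis
    using True assms by (simp add: lo_profile_def algebra_simps)
next
  case False
  define t where "t = real R - real r"
  have t: "t \<ge> 1" "real s \<ge> t" using assms False by (auto simp: t_def)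
  have R: "real R = real r + t" by (simp add: t_def)
  have "t * t \<ge> 1" using t mult_mono[of 1 t 1 t] by simp
  moreover have "real s * t \<ge> t * t" "real s * real s \<ge> t * t" using t by (auto intro!: mult_mono)
  ultimately have "real s * (2 * t + real s) \<ge> t * t + 2" by (simp add: algebra_simps)
  moreover have "r - s \<le> R" using assms by simp
  ultimately show ?thesis using False assms
    by (simp add: lo_profile_def R power2_eq_square algebra_simps)
qed

text \<open>The term \<open>real r / real R\<close> is preserved by a symmetric step and is at least
  1 once \<open>r\<close> reaches \<open>R\<close>. The second term decays: below \<open>R\<close> a
  lazy step lowers the profile on average by at least \<open>2 * p\<close>, hence by at least the
  fraction \<open>2 * p / (real R)\<^sup>2\<close> of it, since the profile is at most
  \<open>(real R)\<^sup>2\<close>. The divisor \<open>2 * real R - 1\<close> is the profile at 1,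
  which makes the bound at least 1 for \<open>k = 0\<close> and every positive
  \<open>r\<close>.\<close>

definition lo_bound :: "real \<Rightarrow> nat \<Rightarrow> nat \<Rightarrow> nat \<Rightarrow> real" where
  "lo_bound p R k r = real r / real R + (1 - 2 * p / (real R)\<^sup>2) ^ k * lo_profile R r / (2 * real R - 1)"

lemma lo_profile_bounds:
  shows "0 \<le> lo_profile R r" "lo_profile R r \<le> (real R)\<^sup>2"
proof -
  have "real r * (2 * real R - real r) = (real R)\<^sup>2 - (real R - real r)\<^sup>2"
    by (simp add: power2_eq_square algebra_simps)
  then show "lo_profile R r \<le> (real R)\<^sup>2" by (auto simp: lo_profile_def)
  show "0 \<le> lo_profile R r" by (auto simp: lo_profile_def)
qed

lemma pr_sum_in_le:
  fixes v :: "'e \<Rightarrow> complex"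
  assumes p: "0 < p" "p \<le> 1 / 2" and R: "1 \<le> R"
    and J: "finite J" "\<And>e. e \<in> J \<Longrightarrow> v e \<noteq> 0" and A: "finite A"
  shows "pr p J (\<lambda>E. sum v E \<in> A) \<le> lo_bound p R (card J) (card A)"
  using J A
proof (induction J arbitrary: A rule: finite_induct)
  case empty
  consider "card A = 0" | "1 \<le> card A" "card A \<le> R" | "R < card A" by linarith
  then show ?case
  proof cases
    case 1
    with empty have "A = {}" by simp
    then show ?thesis by (simp add: lo_bound_def lo_profile_def)
  next
    case 2
    have "real (card A) * (2 * real R - real (card A)) - (2 * real R - 1)
        = (real (card A) - 1) * (2 * real R - real (card A) - 1)" by (simp add: algebra_simps)
    moreover have "(real (card A) - 1) * (2 * real R - real (card A) - 1) \<ge> 0"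
      using 2 R by (intro mult_nonneg_nonneg) auto
    ultimately have "lo_profile R (card A) / (2 * real R - 1) \<ge> 1"
      using 2 R by (simp add: lo_profile_def field_simps)
    then have "1 \<le> lo_bound p R 0 (card A)" by (simp add: lo_bound_def add_increasing)
    then show ?thesis by auto
  next
    case 3
    then have "real (card A) / real R \<ge> 1" using R by (simp add: field_simps)
    moreover have "lo_profile R (card A) / (2 * real R - 1) \<ge> 0"
      using R lo_profile_bounds by simp
    ultimately have "1 \<le> lo_bound p R 0 (card A)" by (simp add: lo_bound_def)
    then show ?thesis by auto
  qed
next
  case (insert e J)
  let ?l = "1 - 2 * p / (real R)\<^sup>2"
  have RR: "1 \<le> (real R)\<^sup>2" using R by simp
  have "2 * p \<le> (real R)\<^sup>2" using p RR by linarith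
  then have l0: "0 \<le> ?l" using R by (simp add: field_simps)
  have c0: "0 < 2 * real R - 1" using R by simp
  consider "card A = 0" | "card A \<ge> R" | "0 < card A" "card A < R" by linarith
  then show ?case
  proof cases
    case 1
    with insert.prems have "A = {}" by simp
    then have "pr p (insert e J) (\<lambda>E. sum v E \<in> A) = 0" by (simp add: insert.hyps)
    then show ?thesis using 1 by (simp add: lo_bound_def lo_profile_def)
  next
    case 2
    then have "real (card A) / real R \<ge> 1" using R by (simp add: field_simps)
    moreover have "?l ^ card (insert e J) * lo_profile R (card A) / (2 * real R - 1) \<ge> 0"
      using R lo_profile_bounds l0 c0 by (intro divide_nonneg_nonneg mult_nonneg_nonneg zero_le_power) auto
    ultimately have "1 \<le> lo_bound p R (card (insert e J)) (card A)" unfolding lo_bound_def by linarith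
    moreover have "pr p (insert e J) (\<lambda>E. sum v E \<in> A) \<le> 1" using insert.hyps p by (intro pr_le_1) auto
    ultimately show ?thesis by linarith
  next
    case 3
    define B where "B = (\<lambda>z. z - v e) ` A"
    define k where "k = card J"
    define r where "r = card A"
    have fB: "finite B" "card B = r"
      unfolding B_def r_def using insert.prems by (auto intro: card_image inj_onI)
    have "B \<noteq> A"
    proof
      assume "B = A"
      \<comment> \<open>A nonempty finite set is not invariant under a nonzero translation: the sum
        of its elements would change by \<open>card A\<close> times the shift, which is nonzero in
        characteristic zero.\<close>
      have "\<Sum>B = \<Sum>A - of_nat r * v e"
        unfolding B_def r_def by (subst sum.reindex) (auto simp: inj_on_def sum_subtractf)
      with \<open>B = A\<close> have "of_nat r * v e = 0" by simp
      then show False using 3 insert.prems(1)[of e] by (auto simp: r_def)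
    qed
    define s where "s = card (A \<union> B) - r"
    have "card (A \<union> B) > r" 
    proof -
      have "A \<union> B \<noteq> A"
      proof
        assume "A \<union> B = A"
        then have "B \<subseteq> A" by auto
        then have "B = A" using fB insert.prems card_subset_eq r_def by metis
        with \<open>B \<noteq> A\<close> show False by simp
      qed
      then show ?thesis unfolding r_def using insert.prems fB by (intro psubset_card_mono) auto
    qed
    moreover have "card (A \<union> B) + card (A \<inter> B) = r + r"
      using card_Un_Int[of A B] insert.prems fB r_def by simp
    ultimately have s: "0 < s" "card (A \<union> B) = r + s" "card (A \<inter> B) = r - s" "s \<le> r"
      by (auto simp: s_def)
    have shift: "sum v (insert e E) \<in> A \<longleftrightarrow> sum v E \<in> B" if "E \<subseteq> J" for E
    proof -
      have "finite E" "e \<notin> E" using that insert.hyps finite_subset by auto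
      then have "sum v (insert e E) = v e + sum v E" by simp
      then show ?thesis by (auto simp: B_def image_iff algebra_simps intro: bexI[of _ "v e + sum v E"])
    qed
    have IH: "pr p J (\<lambda>E. sum v E \<in> X) \<le> lo_bound p R k (card X)" if "finite X" for X
      unfolding k_def using insert.IH insert.prems that by auto
    let ?P = "\<lambda>X. pr p J (\<lambda>E. sum v E \<in> X)"
    have "pr p (insert e J) (\<lambda>E. sum v E \<in> A) = p * ?P B + (1 - p) * ?P A"
      unfolding bern_insert[OF insert.hyps] using shift
      by (intro arg_cong2[of _ _ _ _ "(+)"] arg_cong2[of _ _ _ _ "(*)"] bern_cong refl) auto
    also have "... = p * (?P A + ?P B) + (1 - 2 * p) * ?P A" by (simp add: algebra_simps)
    also have "?P A + ?P B = ?P (A \<union> B) + ?P (A \<inter> B)"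
      unfolding bern_add[symmetric] by (intro bern_cong) auto
    also have "p * (?P (A \<union> B) + ?P (A \<inter> B)) + (1 - 2 * p) * ?P A \<le>
       p * (lo_bound p R k (r + s) + lo_bound p R k (r - s)) + (1 - 2 * p) * lo_bound p R k r"
      using IH[of "A \<union> B"] IH[of "A \<inter> B"] IH[of A] insert.prems fB p s r_def
      by (intro add_mono mult_left_mono) auto
    also have "... = real r / real R + ?l ^ k / (2 * real R - 1) *
        (p * (lo_profile R (r + s) + lo_profile R (r - s)) + (1 - 2 * p) * lo_profile R r)"
      using s by (simp add: lo_bound_def field_simps add_divide_distrib diff_divide_distrib)
    also have "... \<le> real r / real R + ?l ^ k / (2 * real R - 1) * (?l * lo_profile R r)"
    proof (intro add_left_mono mult_left_mono)
      have "p * (lo_profile R (r + s) + lo_profile R (r - s)) \<le> p * (2 * lo_profile R r - 2)"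
        using lo_profile_concave[of r R s] 3 s p r_def by (intro mult_left_mono) auto
      moreover have "2 * p / (real R)\<^sup>2 * lo_profile R r \<le> 2 * p / (real R)\<^sup>2 * (real R)\<^sup>2"
        using p lo_profile_bounds by (intro mult_left_mono) auto
      ultimately show "p * (lo_profile R (r + s) + lo_profile R (r - s)) + (1 - 2 * p) * lo_profile R r
          \<le> ?l * lo_profile R r"
        using R by (simp add: algebra_simps)
    qed (use l0 c0 in auto)
    also have "... = lo_bound p R (card (insert e J)) (card A)"
      using insert.hyps by (simp add: lo_bound_def r_def k_def)
    finally show ?thesis .
  qed
qed

text \<open>Conditioning on the coordinates outside \<open>J\<close> merely moves the target value,
  so the bound for a one-element set applies to what remains. The free parameter \<open>R\<close>
  trades the two terms against each other.\<close>

lemma pr_sum_eq_le: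
  fixes v :: "'e \<Rightarrow> complex"
  assumes p: "0 < p" "p \<le> 1 / 2" and R: "1 \<le> R"
    and I: "finite I" "J \<subseteq> I" and J: "\<And>e. e \<in> J \<Longrightarrow> v e \<noteq> 0"
  shows "pr p I (\<lambda>E. sum v E = a) \<le> 1 / real R + exp (- (2 * p * real (card J) / (real R)\<^sup>2))" (is "_ \<le> ?b")
proof -
  have fin: "finite J" "finite (I - J)" using I finite_subset by auto
  have bound: "pr p J (\<lambda>E. sum v E = b) \<le> ?b" for b
  proof -
    have "pr p J (\<lambda>E. sum v E = b) \<le> lo_bound p R (card J) 1"
      using pr_sum_in_le[OF p R fin(1), of v "{b}"] J by simp
    also have "... = 1 / real R + (1 - 2 * p / (real R)\<^sup>2) ^ card J"
      using R by (simp add: lo_bound_def lo_profile_def)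
    also have "(1 - 2 * p / (real R)\<^sup>2) ^ card J \<le> exp (- (2 * p / (real R)\<^sup>2)) ^ card J"
    proof (intro power_mono)
      have "1 \<le> (real R)\<^sup>2" using R by simp
      then have "2 * p \<le> (real R)\<^sup>2" using p by linarith
      then show "0 \<le> 1 - 2 * p / (real R)\<^sup>2" using R by (simp add: field_simps)
      show "1 - 2 * p / (real R)\<^sup>2 \<le> exp (- (2 * p / (real R)\<^sup>2))"
        using exp_ge_add_one_self[of "- (2 * p / (real R)\<^sup>2)"] by simp
    qed
    also have "... = exp (- (2 * p * real (card J) / (real R)\<^sup>2))"
      by (simp add: exp_of_nat_mult[symmetric] mult_ac)
    finally show ?thesis by simp
  qed
  have "pr p I (\<lambda>E. sum v E = a) = pr p ((I - J) \<union> J) (\<lambda>E. sum v E = a)"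
    using I by (simp add: Un_absorb2)
  also have "... = bern p (I - J) (\<lambda>X. pr p J (\<lambda>Y. sum v (X \<union> Y) = a))"
    using fin by (intro bern_Un) auto
  also have "... = bern p (I - J) (\<lambda>X. pr p J (\<lambda>Y. sum v Y = a - sum v X))"
  proof (intro bern_cong)
    fix X Y assume "X \<subseteq> I - J" "Y \<subseteq> J"
    then have "sum v (X \<union> Y) = sum v X + sum v Y"
      using fin finite_subset by (intro sum.union_disjoint) auto
    then show "of_bool (sum v (X \<union> Y) = a) = (of_bool (sum v Y = a - sum v X) :: real)"
      by (auto simp: algebra_simps)
  qed
  also have "... \<le> ?b"
    using fin p by (intro bern_le_const bound) auto
  finally show ?thesis .
qed

lemma pr_sum_eq_small:
  assumes "0 < \<epsilon>"
  obtains K where "K > 0"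
    "\<And>p I J (v :: 'e \<Rightarrow> complex) a. \<lbrakk>0 < p; p \<le> 1 / 2; finite I; J \<subseteq> I;
      \<And>e. e \<in> J \<Longrightarrow> v e \<noteq> 0; K \<le> p * real (card J)\<rbrakk>
      \<Longrightarrow> pr p I (\<lambda>E. sum v E = a) \<le> \<epsilon>"
proof -
  obtain R :: nat where R: "R > 2 / \<epsilon>" using reals_Archimedean2 by blast
  have R0: "real R > 0" using assms R by (meson divide_pos_pos less_trans zero_less_numeral)
  then have R1: "R \<ge> 1" by simp
  \<comment> \<open>Chosen after \<open>R\<close>: it makes the exponential at most
    \<open>\<epsilon> / 2\<close>, just as \<open>R\<close> does for the other term. The maximum
    with 1 ensures positivity.\<close>
  define K where "K = max 1 ((real R)\<^sup>2 * ln (2 / \<epsilon>) / 2)"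
  have "pr p I (\<lambda>E. sum v E = a) \<le> \<epsilon>"
    if "0 < p" "p \<le> 1 / 2" "finite I" "J \<subseteq> I" "\<And>e. e \<in> J \<Longrightarrow> v e \<noteq> 0" "K \<le> p * real (card J)"
    for p I J and v :: "'e \<Rightarrow> complex" and a
  proof -
    have "(real R)\<^sup>2 * ln (2 / \<epsilon>) / 2 \<le> p * real (card J)" using that(6) by (simp add: K_def)
    then have "ln (2 / \<epsilon>) \<le> 2 * p * real (card J) / (real R)\<^sup>2" using R0 by (simp add: field_simps)
    then have "exp (- (2 * p * real (card J) / (real R)\<^sup>2)) \<le> exp (- ln (2 / \<epsilon>))" by simp
    also have "... = \<epsilon> / 2" using assms by (simp add: exp_minus)
    finally have "exp (- (2 * p * real (card J) / (real R)\<^sup>2)) \<le> \<epsilon> / 2" .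
    moreover have "1 / real R \<le> \<epsilon> / 2" using R R0 assms by (simp add: field_simps)
    ultimately show ?thesis using pr_sum_eq_le[OF that(1,2) R1 that(3,4), of v a] that(5) by fastforce
  qed
  moreover have "K > 0" by (simp add: K_def)
  ultimately show ?thesis using that by blast
qed

subsection \<open>Homogeneous linear systems\<close>

definition nullvec :: "('r \<Rightarrow> 's \<Rightarrow> 'c::field) \<Rightarrow> 'r set \<Rightarrow> 's set \<Rightarrow> ('s \<Rightarrow> 'c) \<Rightarrow> bool" where
  "nullvec A R S w \<longleftrightarrow> (\<forall>i\<in>R. (\<Sum>s\<in>S. A i s * w s) = 0)"

lemma nullvec_mono: "nullvec A R S w \<Longrightarrow> R' \<subseteq> R \<Longrightarrow> nullvec A R' S w"
  by (auto simp: nullvec_def)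

lemma nullvec_combine:
  assumes "nullvec A R S v" "nullvec A R S w"
  shows "nullvec A R S (\<lambda>s. a * v s + b * w s)"
proof -
  have "(\<Sum>s\<in>S. A i s * (a * v s + b * w s)) = a * (\<Sum>s\<in>S. A i s * v s) + b * (\<Sum>s\<in>S. A i s * w s)" for i
    by (simp add: sum_distrib_left sum.distrib algebra_simps)
  with assms show ?thesis by (simp add: nullvec_def)
qed

lemma nullvec_extend:
  assumes "finite S'" "S \<subseteq> S'" "\<And>s. s \<in> S' - S \<Longrightarrow> w s = 0"
  shows "nullvec A R S' w \<longleftrightarrow> nullvec A R S w"
proof -
  have "(\<Sum>s\<in>S'. A i s * w s) = (\<Sum>s\<in>S. A i s * w s)" for i
    using assms by (intro sum.mono_neutral_right) auto
  then show ?thesis by (simp add: nullvec_def)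
qed

lemma nullvec_cong: "(\<And>s. s \<in> S \<Longrightarrow> v s = w s) \<Longrightarrow> nullvec A R S v \<longleftrightarrow> nullvec A R S w"
  by (simp add: nullvec_def)

lemma nullvec_extend_zero:
  assumes "finite S'" "S \<subseteq> S'" "nullvec A R S w"
  shows "nullvec A R S' (\<lambda>s. if s \<in> S then w s else 0)"
  using assms by (subst nullvec_extend[of S' S]) (auto cong: nullvec_cong)

lemma row_elimination:
  fixes A :: "'r \<Rightarrow> 's \<Rightarrow> 'c::field"
  assumes "finite S" "s \<notin> S" "A k s \<noteq> 0" "(\<Sum>t\<in>insert s S. A k t * w t) = 0"
  shows "(\<Sum>t\<in>S. (A i t - A i s / A k s * A k t) * w t) = (\<Sum>t\<in>insert s S. A i t * w t)"
proof -
  have k: "(\<Sum>t\<in>S. A k t * w t) = - (A k s * w s)"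
    using assms by (simp add: add_eq_0_iff)
  have "(\<Sum>t\<in>S. (A i t - A i s / A k s * A k t) * w t) =
      (\<Sum>t\<in>S. A i t * w t) - A i s / A k s * (\<Sum>t\<in>S. A k t * w t)"
    by (simp add: sum_subtractf sum_distrib_left algebra_simps)
  also have "... = (\<Sum>t\<in>S. A i t * w t) + A i s * w s"
    unfolding k using assms by simp
  finally show ?thesis using assms by simp
qed

text \<open>Each eliminated column costs one pivot row, so \<open>card S\<close> rows already
  determine the solutions on \<open>S\<close>. Exposing these few rows will later fix a null vector
  while the other rows stay random.\<close>

lemma row_basis:
  assumes "finite S"
  shows "\<exists>R'\<subseteq>R. finite R' \<and> card R' \<le> card S \<and> (\<forall>w. nullvec A R' S w \<longrightarrow> nullvec A R S w)"
  using assms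
proof (induction S arbitrary: A rule: finite_induct)
  case empty
  then show ?case by (intro exI[of _ "{}"]) (auto simp: nullvec_def)
next
  case (insert s S)
  show ?case
  proof (cases "\<forall>i\<in>R. A i s = 0")
    case True
    obtain R' where R': "R' \<subseteq> R" "finite R'" "card R' \<le> card S"
      "\<And>w. nullvec A R' S w \<Longrightarrow> nullvec A R S w" using insert.IH[of A] by blast
    have *: "nullvec A X (insert s S) w \<longleftrightarrow> nullvec A X S w" if "X \<subseteq> R" for X w
    proof -
      have "(\<Sum>t\<in>insert s S. A i t * w t) = (\<Sum>t\<in>S. A i t * w t)" if "i \<in> X" for i
        using insert.hyps True that \<open>X \<subseteq> R\<close> by auto
      then show ?thesis by (simp only: nullvec_def cong: ball_cong)
    qed
    show ?thesis
      using R' insert.hyps * by (intro exI[of _ R']) auto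
  next
    case False
    then obtain k where k: "k \<in> R" "A k s \<noteq> 0" by blast
    define B where "B = (\<lambda>i t. A i t - A i s / A k s * A k t)"
    obtain R' where R': "R' \<subseteq> R" "finite R'" "card R' \<le> card S"
      "\<And>w. nullvec B R' S w \<Longrightarrow> nullvec B R S w" using insert.IH[of B] by blast
    have "nullvec A R (insert s S) w" if w: "nullvec A (insert k R') (insert s S) w" for w
    proof -
      have "(\<Sum>t\<in>S. B i t * w t) = (\<Sum>t\<in>insert s S. A i t * w t)" for i
        unfolding B_def using w k insert.hyps by (intro row_elimination) (auto simp: nullvec_def)
      then have *: "nullvec B X S w \<longleftrightarrow> nullvec A X (insert s S) w" for X
        by (simp add: nullvec_def)
      show ?thesis using R'(4)[of w] w by (auto simp: * intro: nullvec_mono)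
    qed
    then show ?thesis using R' k insert.hyps
      by (intro exI[of _ "insert k R'"]) (auto simp: card_insert_if)
  qed
qed

lemma underdetermined:
  assumes "finite R" "finite S" "card R < card S"
  shows "\<exists>w. nullvec A R S w \<and> (\<exists>s\<in>S. w s \<noteq> 0)"
  using assms
proof (induction R arbitrary: S A rule: finite_induct)
  case empty
  then have "S \<noteq> {}" by auto
  then show ?case by (intro exI[of _ "\<lambda>_. 1"]) (auto simp: nullvec_def)
next
  case (insert k R)
  show ?case
  proof (cases "\<forall>s\<in>S. A k s = 0")
    case True
    obtain w where "nullvec A R S w" "\<exists>s\<in>S. w s \<noteq> 0"
      using insert.IH[of S A] insert.prems insert.hyps by auto
    with True show ?thesis by (intro exI[of _ w]) (auto simp: nullvec_def)
  next
    case False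
    then obtain s where s: "s \<in> S" "A k s \<noteq> 0" by blast
    define B where "B = (\<lambda>i t. A i t - A i s / A k s * A k t)"
    have S: "S = insert s (S - {s})" "s \<notin> S - {s}" "finite (S - {s})" using s insert by auto
    have "card R < card (S - {s})" using s insert by simp
    then obtain w where w: "nullvec B R (S - {s}) w" "\<exists>t\<in>S - {s}. w t \<noteq> 0"
      using insert.IH[of "S - {s}" B] insert.prems by auto
    define w' where "w' = w(s := - (\<Sum>t\<in>S - {s}. A k t * w t) / A k s)"
    have w': "w' t = w t" if "t \<in> S - {s}" for t using that by (auto simp: w'_def)
    let ?f = "\<lambda>i. \<Sum>t\<in>insert s (S - {s}). A i t * w' t"
    have k0: "?f k = 0"
    proof -
      have "?f k = A k s * w' s + (\<Sum>t\<in>S - {s}. A k t * w t)"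
        using w' by (subst sum.insert[OF S(3,2)]) simp
      then show ?thesis using s by (simp add: w'_def)
    qed
    have "(\<Sum>t\<in>insert s (S - {s}). A i t * w' t) = (\<Sum>t\<in>S - {s}. B i t * w t)" for i
    proof -
      have "(\<Sum>t\<in>S - {s}. B i t * w t) = (\<Sum>t\<in>S - {s}. B i t * w' t)"
        using w' by (intro sum.cong) auto
      then show ?thesis
        using row_elimination[of "S - {s}" s A k w' i] S(2,3) s(2) k0 unfolding B_def by simp
    qed
    then have "nullvec A (insert k R) S w'"
      using w k0 S(1) by (simp add: nullvec_def)
    moreover have "\<exists>t\<in>S. w' t \<noteq> 0" using w(2) w' by (metis DiffD1)
    ultimately show ?thesis by blast
  qed
qed

text \<open>Induction on the columns. Suppose \<open>y\<close> separates \<open>b\<close> from the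
  old columns. If the new column lies in their span, \<open>y\<close> annihilates it as well.
  Otherwise some \<open>z\<close> detects the new column, and \<open>b\<close> is first shifted by a
  multiple of that column.\<close>

lemma fredholm_alternative:
  fixes A :: "'r \<Rightarrow> 's \<Rightarrow> 'c::field"
  assumes "finite S" "finite R"
  shows "(\<exists>w. \<forall>i\<in>R. (\<Sum>s\<in>S. A i s * w s) = b i) \<or>
     (\<exists>y. (\<forall>s\<in>S. (\<Sum>i\<in>R. y i * A i s) = 0) \<and> (\<Sum>i\<in>R. y i * b i) \<noteq> 0)"
  using assms(1)
proof (induction S arbitrary: b rule: finite_induct)
  case empty
  show ?case
  proof (cases "\<forall>i\<in>R. b i = 0")
    case False
    then obtain k where "k \<in> R" "b k \<noteq> 0" by blast
    then have "(\<Sum>i\<in>R. of_bool (i = k) * b i) \<noteq> 0"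
      using assms by (simp add: of_bool_def if_distrib[of "\<lambda>x. x * _"] cong: if_cong)
    then show ?thesis by auto
  qed auto
next
  case (insert t S)
  define inner where "inner = (\<lambda>y c. \<Sum>i\<in>R. y i * (c i :: 'c))"
  define orth where "orth = (\<lambda>y. \<forall>s\<in>S. (\<Sum>i\<in>R. y i * A i s) = 0)"
  have split: "(\<Sum>s\<in>insert t S. A i s * w s) = A i t * w t + (\<Sum>s\<in>S. A i s * w s)" for i w
    using insert.hyps by simp
  have in_span: thesis if w: "\<And>i. i \<in> R \<Longrightarrow> (\<Sum>s\<in>S. A i s * w s) = b i - a * A i t"
    and th: "(\<exists>w. \<forall>i\<in>R. (\<Sum>s\<in>insert t S. A i s * w s) = b i) \<Longrightarrow> thesis" for w a thesis
  proof (rule th, intro exI ballI)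
    fix i assume "i \<in> R"
    have "(\<Sum>s\<in>S. A i s * (w(t := a)) s) = (\<Sum>s\<in>S. A i s * w s)"
      using insert.hyps by (intro sum.cong) auto
    then show "(\<Sum>s\<in>insert t S. A i s * (w(t := a)) s) = b i"
      using w[OF \<open>i \<in> R\<close>] unfolding split by (simp add: mult.commute)
  qed
  consider "\<exists>w. \<forall>i\<in>R. (\<Sum>s\<in>S. A i s * w s) = b i" |
    y where "orth y" "inner y b \<noteq> 0"
    using insert.IH[of b] unfolding orth_def inner_def by blast
  then show ?case
  proof cases
    case 1
    then show ?thesis using in_span[of _ 0] by auto
  next
    case 2
    note y = 2
    consider w where "\<And>i. i \<in> R \<Longrightarrow> (\<Sum>s\<in>S. A i s * w s) = A i t" |
      z where "orth z" "inner z (\<lambda>i. A i t) \<noteq> 0"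
      using insert.IH[of "\<lambda>i. A i t"] unfolding orth_def inner_def by blast
    then show ?thesis
    proof cases
      case 1
      have "inner y (\<lambda>i. A i t) = (\<Sum>i\<in>R. y i * (\<Sum>s\<in>S. A i s * w s))"
        unfolding inner_def using 1 by (intro sum.cong) auto
      also have "... = (\<Sum>s\<in>S. (\<Sum>i\<in>R. y i * A i s) * w s)"
        unfolding sum_distrib_left sum_distrib_right by (subst sum.swap) (simp add: mult_ac)
      also have "... = 0" using y by (auto simp: orth_def)
      finally show ?thesis using y unfolding orth_def inner_def by auto
    next
      case 2
      note z = 2
      \<comment> \<open>The multiple for which \<open>z\<close> annihilates the shifted right-hand
        side \<open>b - a * A t\<close>.\<close>
      define a where "a = inner z b / inner z (\<lambda>i. A i t)"
      consider w where "\<And>i. i \<in> R \<Longrightarrow> (\<Sum>s\<in>S. A i s * w s) = b i - a * A i t" |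
        x where "orth x" "inner x (\<lambda>i. b i - a * A i t) \<noteq> 0"
        using insert.IH[of "\<lambda>i. b i - a * A i t"] unfolding orth_def inner_def by blast
      then show ?thesis
      proof cases
        case 1
        then show ?thesis using in_span[of _ a] by blast
      next
        case 2
        note x = 2
        \<comment> \<open>Subtracting \<open>c * z\<close> makes \<open>x\<close> orthogonal to
          column \<open>t\<close>; by the choice of \<open>a\<close>, the value of the result at
          \<open>b\<close> is that of \<open>x\<close> at the shifted right-hand side.\<close>
        define c where "c = inner x (\<lambda>i. A i t) / inner z (\<lambda>i. A i t)"
        define y' where "y' = (\<lambda>i. x i - c * z i)"
        have lin: "(\<Sum>i\<in>R. y' i * f i) = inner x f - c * inner z f" for f
          unfolding y'_def inner_def by (simp add: sum_subtractf sum_distrib_left algebra_simps)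
        have "(\<Sum>i\<in>R. y' i * A i s) = 0" if "s \<in> insert t S" for s
          using that x z unfolding lin orth_def by (auto simp: c_def inner_def)
        moreover have "(\<Sum>i\<in>R. y' i * b i) = inner x (\<lambda>i. b i - a * A i t)"
        proof -
          have "inner x (\<lambda>i. b i - a * A i t) = inner x b - a * inner x (\<lambda>i. A i t)"
            unfolding inner_def by (simp add: sum_subtractf sum_distrib_left algebra_simps)
          then show ?thesis unfolding lin a_def c_def by simp
        qed
        ultimately have "(\<forall>s\<in>insert t S. (\<Sum>i\<in>R. y' i * A i s) = 0) \<and> (\<Sum>i\<in>R. y' i * b i) \<noteq> 0"
          using x by simp
        then show ?thesis by blast
      qed
    qed
  qed
qed

definition indep_cols :: "('r \<Rightarrow> 's \<Rightarrow> 'c::field) \<Rightarrow> 'r set \<Rightarrow> 's set \<Rightarrow> bool" where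
  "indep_cols A R S \<longleftrightarrow> (\<forall>w. nullvec A R S w \<longrightarrow> (\<forall>s\<in>S. w s = 0))"

definition circuit :: "('r \<Rightarrow> 's \<Rightarrow> 'c::field) \<Rightarrow> 'r set \<Rightarrow> 's set \<Rightarrow> bool" where
  "circuit A R S \<longleftrightarrow> \<not> indep_cols A R S \<and> (\<forall>S'. S' \<subset> S \<longrightarrow> indep_cols A R S')"

lemma indep_cols_subset:
  assumes "finite S" "S' \<subseteq> S" "indep_cols A R S"
  shows "indep_cols A R S'"
  unfolding indep_cols_def
proof (intro allI impI ballI)
  fix w s assume w: "nullvec A R S' w" and s: "s \<in> S'"
  have "\<forall>s\<in>S. (if s \<in> S' then w s else 0) = 0"
    using assms(3) nullvec_extend_zero[OF assms(1,2) w] unfolding indep_cols_def by blast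
  then show "w s = 0" using s assms(2) by force
qed

lemma indep_cols_card_le:
  assumes "finite R" "finite S" "indep_cols A R S"
  shows "card S \<le> card R"
  using underdetermined[OF assms(1,2), of A] assms(3) by (force simp: indep_cols_def)

text \<open>A null vector can be reduced, without losing a given coordinate, until its support is minimal.\<close>

lemma circuit_containing:
  assumes "finite V" "nullvec A R V w" "j \<in> V" "w j \<noteq> 0"
  shows "\<exists>S\<subseteq>V. j \<in> S \<and> circuit A R S"
  using assms
proof (induction V arbitrary: w rule: finite_psubset_induct)
  case (psubset V)
  show ?case
  proof (cases "\<exists>S w'. S \<subset> V \<and> nullvec A R S w' \<and> j \<in> S \<and> w' j \<noteq> 0")
    case True
    then show ?thesis using psubset.IH by (meson psubset_imp_subset subset_trans)
  next
    case False
    have "indep_cols A R S" if "S \<subset> V" for S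
      unfolding indep_cols_def
    proof (intro allI impI ballI, rule ccontr)
      fix u s assume u: "nullvec A R S u" "s \<in> S" "u s \<noteq> 0"
      define v where "v = (\<lambda>t. if t \<in> S then u t else 0)"
      have v: "nullvec A R V v"
        unfolding v_def using that psubset.hyps u(1) by (intro nullvec_extend_zero) auto
      have vj: "v j = 0" using False u that by (auto simp: v_def)
      \<comment> \<open>This cancels coordinate \<open>s\<close> and keeps coordinate
        \<open>j\<close>: \<open>v j = 0\<close>, because no proper subset carries a null vector
        that is nonzero at \<open>j\<close>.\<close>
      define x where "x = (\<lambda>t. 1 * w t + - (w s / u s) * v t)"
      have "nullvec A R V x" unfolding x_def by (intro nullvec_combine v psubset.prems)
      moreover have "x s = 0" using u by (simp add: x_def v_def)
      ultimately have "nullvec A R (V - {s}) x" using psubset.hyps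
        by (subst (asm) nullvec_extend[of V "V - {s}"]) auto
      moreover have "x j \<noteq> 0" using vj psubset.prems by (simp add: x_def)
      moreover have "j \<noteq> s" using \<open>x s = 0\<close> \<open>x j \<noteq> 0\<close> by auto
      moreover have "V - {s} \<subset> V" using u that by auto
      ultimately show False using False psubset.prems by blast
    qed
    then show ?thesis
      using psubset.prems by (intro exI[of _ V]) (auto simp: circuit_def indep_cols_def)
  qed
qed

text \<open>A null vector with a zero coordinate lives on a proper subset of the circuit and
  therefore vanishes. So a nonzero one has full support, and any two are proportional, since a
  suitable combination has a zero coordinate.\<close>

lemma circuit_nullvec:
  assumes "finite S" "circuit A R S"
  shows "\<exists>w. nullvec A R S w \<and> (\<forall>s\<in>S. w s \<noteq> 0) \<and>
    (\<forall>v. nullvec A R S v \<longrightarrow> (\<exists>c. \<forall>s\<in>S. v s = c * w s))"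
proof -
  have full: "\<forall>t\<in>S. v t = 0" if "nullvec A R S v" "s \<in> S" "v s = 0" for v s
  proof -
    have "nullvec A R (S - {s}) v" using that assms
      by (subst (asm) nullvec_extend[of S "S - {s}"]) auto
    moreover have "S - {s} \<subset> S" using that by auto
    then have "indep_cols A R (S - {s})" using assms(2) by (simp add: circuit_def)
    ultimately have "\<forall>t\<in>S - {s}. v t = 0" by (simp add: indep_cols_def)
    then show ?thesis using that by auto
  qed
  have "\<not> indep_cols A R S" using assms(2) by (simp add: circuit_def)
  then obtain w s where w: "nullvec A R S w" and s: "s \<in> S" "w s \<noteq> 0"
    by (auto simp: indep_cols_def)
  have "\<exists>c. \<forall>s\<in>S. v s = c * w s" if "nullvec A R S v" for v
  proof -
    have "nullvec A R S (\<lambda>t. 1 * v t + - (v s / w s) * w t)" using that w by (rule nullvec_combine)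
    then have "\<forall>t\<in>S. 1 * v t + - (v s / w s) * w t = 0"
      by (rule full[OF _ s(1)]) (use s in simp)
    then show ?thesis by (intro exI[of _ "v s / w s"]) simp
  qed
  moreover have "w t \<noteq> 0" if "t \<in> S" for t using full[OF w that] s by blast
  ultimately show ?thesis using w by (intro exI[of _ w]) simp
qed

subsection \<open>Neighbourhoods and the rank\<close>

definition nb :: "('r \<Rightarrow> 's \<Rightarrow> 'c::zero) \<Rightarrow> 'r set \<Rightarrow> 's set \<Rightarrow> 'r set" where
  "nb A V S = {i \<in> V. \<exists>s\<in>S. A i s \<noteq> 0}"

text \<open>The union of the supports of all null vectors, equivalently of all circuits in
  \<open>V\<close>; its complement consists of the coloops of the column matroid.\<close>

definition ksupp :: "('r \<Rightarrow> 's \<Rightarrow> 'c::field) \<Rightarrow> 'r set \<Rightarrow> 's set \<Rightarrow> 's set" where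
  "ksupp A R V = {j \<in> V. \<exists>w. nullvec A R V w \<and> w j \<noteq> 0}"

lemma nullvec_nb: "nullvec A R S w \<longleftrightarrow> nullvec A (nb A R S) S w"
proof -
  have "(\<Sum>s\<in>S. A i s * w s) = 0" if "i \<in> R - nb A R S" for i
    using that by (intro sum.neutral) (auto simp: nb_def)
  moreover have "nb A R S \<subseteq> R" by (auto simp: nb_def)
  ultimately show ?thesis unfolding nullvec_def by blast
qed

lemma indep_cols_nb: "indep_cols A R S \<longleftrightarrow> indep_cols A (nb A R S) S"
  unfolding indep_cols_def by (simp only: nullvec_nb[of A R S, symmetric])

text \<open>The easy half of the rank formula. The chosen columns inside \<open>S\<close> are
  supported on the rows \<open>nb A R S\<close> and cannot outnumber them; those outside
  \<open>S\<close> number at most \<open>card V - card S\<close>.\<close>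

lemma indep_card_bound:
  assumes "finite R" "finite V" "indep_cols A R X" "X \<subseteq> V" "S \<subseteq> V"
  shows "card X \<le> card V - card S + card (nb A R S)"
proof -
  have fin: "finite X" "finite S" using assms finite_subset by auto
  have "card (X \<inter> S) \<le> card (nb A R (X \<inter> S))"
  proof (rule indep_cols_card_le[of _ _ A])
    show "indep_cols A (nb A R (X \<inter> S)) (X \<inter> S)"
      using indep_cols_nb[of A R "X \<inter> S"] indep_cols_subset[OF fin(1) Int_lower1 assms(3), of S] by simp
    show "finite (nb A R (X \<inter> S))" "finite (X \<inter> S)" using assms(1) fin by (auto simp: nb_def)
  qed
  also have "... \<le> card (nb A R S)" using assms by (intro card_mono) (auto simp: nb_def)
  finally have 1: "card (X \<inter> S) \<le> card (nb A R S)" .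
  have "card (X - S) \<le> card (V - S)" using assms by (intro card_mono) auto
  also have "... = card V - card S" using assms fin by (simp add: card_Diff_subset)
  finally have 2: "card (X - S) \<le> card V - card S" .
  have "card X = card (X - S) + card (X \<inter> S)"
    using fin by (metis add.commute card_Int_Diff)
  with 1 2 show ?thesis by linarith
qed

text \<open>If the unit vector at \<open>i\<close> is not spanned, some \<open>y\<close> with
  \<open>y i \<noteq> 0\<close> annihilates all columns of \<open>S\<close>. Dropping row
  \<open>i\<close> and one column leaves fewer rows than columns, so some nonzero \<open>w\<close>
  on the remaining columns has its image concentrated on row \<open>i\<close>. Pairing with
  \<open>y\<close> makes that image zero, against the independence of a proper subset of a
  circuit.\<close>

lemma circuit_spans_unit:
  assumes "finite R" "finite S" "circuit A R S" "card (nb A R S) < card S" "i \<in> nb A R S"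
  shows "\<exists>z. \<forall>r\<in>R. (\<Sum>s\<in>S. A r s * z s) = of_bool (r = i)"
proof (rule ccontr)
  assume "\<not> ?thesis"
  then obtain y where y: "\<And>s. s \<in> S \<Longrightarrow> (\<Sum>r\<in>R. y r * A r s) = 0"
    "(\<Sum>r\<in>R. y r * of_bool (r = i)) \<noteq> 0"
    using fredholm_alternative[OF assms(2,1), of A "\<lambda>r. of_bool (r = i)"] by blast
  have iR: "i \<in> R" using assms by (auto simp: nb_def)
  have "(\<Sum>r\<in>R. y r * of_bool (r = i)) = y i"
    using iR assms by (simp add: of_bool_def if_distrib cong: if_cong)
  with y have yi: "y i \<noteq> 0" by simp
  obtain s where s: "s \<in> S" using assms by force
  have ind: "indep_cols A R (S - {s})" using assms s by (auto simp: circuit_def)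
  have fN: "finite (nb A R S)" using assms by (simp add: nb_def)
  have "card (nb A R S) > 0" using fN assms(5) card_gt_0_iff by blast
  then have "card (nb A R S - {i}) < card (S - {s})" using assms s fN by simp
  then obtain w where w: "nullvec A (nb A R S - {i}) (S - {s}) w" "\<exists>t\<in>S - {s}. w t \<noteq> 0"
    using underdetermined[of "nb A R S - {i}" "S - {s}" A] assms fN by auto
  let ?f = "\<lambda>r. \<Sum>t\<in>S - {s}. A r t * w t"
  have other: "?f r = 0" if "r \<in> R" "r \<noteq> i" for r
  proof (cases "r \<in> nb A R S")
    case True
    then show ?thesis using w that by (auto simp: nullvec_def)
  next
    case False
    then show ?thesis using that by (auto simp: nb_def intro!: sum.neutral)
  qed
  have "0 = (\<Sum>t\<in>S - {s}. (\<Sum>r\<in>R. y r * A r t) * w t)" using y by simp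
  also have "... = (\<Sum>r\<in>R. y r * ?f r)"
    unfolding sum_distrib_left sum_distrib_right by (subst sum.swap) (simp add: mult_ac)
  also have "... = (\<Sum>r\<in>R. if r = i then y i * ?f i else 0)"
    using other by (intro sum.cong) auto
  also have "... = y i * ?f i" using iR assms by simp
  finally have "?f i = 0" using yi by simp
  with other have "nullvec A R (S - {s}) w" unfolding nullvec_def by metis
  then show False using ind w by (auto simp: indep_cols_def)
qed

text \<open>Every row in the neighbourhood of the kernel support \<open>T\<close> meets a circuit
  inside \<open>T\<close>, so its unit vector is spanned by the columns of \<open>T\<close>; these
  columns have rank at least \<open>card (nb A R T)\<close>. Columns outside \<open>T\<close> occur
  in no null vector and can be added without destroying independence.\<close>

lemma rank_if_small_circuits:
  assumes "finite R" "finite V"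
    and circ: "\<And>S. S \<subseteq> ksupp A R V \<Longrightarrow> circuit A R S \<Longrightarrow> card (nb A R S) < card S"
  shows "\<exists>X\<subseteq>V. indep_cols A R X \<and>
    card V - card (ksupp A R V) + card (nb A R (ksupp A R V)) \<le> card X"
proof -
  define T where "T = ksupp A R V"
  have TV: "T \<subseteq> V" by (auto simp: T_def ksupp_def)
  have fT: "finite T" using TV assms finite_subset by auto
  have unit: "\<exists>z. \<forall>r\<in>R. (\<Sum>s\<in>T. A r s * z s) = of_bool (r = i)" if i: "i \<in> nb A R T" for i
  proof -
    obtain s where s: "s \<in> T" "A i s \<noteq> 0" "i \<in> R" using i by (auto simp: nb_def)
    then obtain w where "nullvec A R V w" "w s \<noteq> 0" "s \<in> V" by (auto simp: T_def ksupp_def)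
    then obtain S where S: "S \<subseteq> V" "s \<in> S" "circuit A R S"
      using circuit_containing[of V A R w s] assms by blast
    have fS: "finite S" using S assms finite_subset by auto
    have "S \<subseteq> T"
    proof
      fix t assume t: "t \<in> S"
      obtain u where u: "nullvec A R S u" "\<And>s. s \<in> S \<Longrightarrow> u s \<noteq> 0"
        using circuit_nullvec[OF fS S(3)] by (elim exE conjE) simp
      define v where "v = (\<lambda>s. if s \<in> S then u s else 0)"
      have "nullvec A R V v" unfolding v_def using assms(2) S(1) u(1) by (rule nullvec_extend_zero)
      then show "t \<in> T" using t S u by (auto simp: T_def ksupp_def v_def)
    qed
    moreover have "i \<in> nb A R S" using s S by (auto simp: nb_def)
    ultimately obtain z where z: "\<And>r. r \<in> R \<Longrightarrow> (\<Sum>s\<in>S. A r s * z s) = of_bool (r = i)"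
      using circuit_spans_unit[OF assms(1) fS S(3) circ[OF _ S(3)], of i] unfolding T_def by blast
    have "(\<Sum>s\<in>T. A r s * (if s \<in> S then z s else 0)) = (\<Sum>s\<in>S. A r s * z s)" for r
      using \<open>S \<subseteq> T\<close> fT by (intro sum.mono_neutral_cong_right) auto
    with z show ?thesis by (intro exI[of _ "\<lambda>s. if s \<in> S then z s else 0"]) auto
  qed
  let ?P = "\<lambda>X. X \<subseteq> T \<and> indep_cols A R X"
  have "?P {}" by (auto simp: indep_cols_def)
  moreover have "\<forall>X. ?P X \<longrightarrow> card X < Suc (card T)"
    using fT by (auto simp: less_Suc_eq_le intro: card_mono)
  ultimately have "\<exists>B. ?P B \<and> (\<forall>X. ?P X \<longrightarrow> card X \<le> card B)"
    by (rule ex_has_greatest_nat[of ?P "{}" card "Suc (card T)"])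
  then obtain B where B: "?P B" "\<forall>X. ?P X \<longrightarrow> card X \<le> card B" by (elim exE conjE) simp
  have fB: "finite B" using B fT finite_subset by auto
  have "card (nb A R T) \<le> card B"
  proof (rule ccontr)
    assume "\<not> ?thesis"
    \<comment> \<open>A combination of rows that vanishes on \<open>B\<close>. By maximality of
      \<open>B\<close> it vanishes on every column of \<open>T\<close>, hence on every unit vector
      spanned by them, which makes all of its coefficients zero.\<close>
    then obtain y where y: "nullvec (\<lambda>s r. A r s) B (nb A R T) y" and y0: "\<exists>i\<in>nb A R T. y i \<noteq> 0"
      using underdetermined[of B "nb A R T" "\<lambda>s r. A r s"] fB assms by (auto simp: nb_def)
    let ?c = "\<lambda>t. \<Sum>r\<in>nb A R T. A r t * y r"
    have B0: "?c t = 0" if "t \<in> B" for t using y that by (simp add: nullvec_def)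
    have col: "?c t = 0" if t: "t \<in> T" for t
    proof (cases "t \<in> B")
      case False
      have "\<not> indep_cols A R (insert t B)"
      proof
        assume "indep_cols A R (insert t B)"
        then have "card (insert t B) \<le> card B" using B t by auto
        then show False using False fB by simp
      qed
      then obtain w s where w: "nullvec A R (insert t B) w" "s \<in> insert t B" "w s \<noteq> 0"
        unfolding indep_cols_def by blast
      have "w t \<noteq> 0"
      proof
        assume "w t = 0"
        then have "nullvec A R B w" using w fB
          by (subst (asm) nullvec_extend[of "insert t B" B]) auto
        with w B \<open>w t = 0\<close> show False by (auto simp: indep_cols_def)
      qed
      have "0 = (\<Sum>r\<in>nb A R T. (\<Sum>s\<in>insert t B. A r s * w s) * y r)"
        using w by (auto simp: nullvec_def nb_def intro!: sum.neutral)
      also have "... = (\<Sum>s\<in>insert t B. ?c s * w s)"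
        unfolding sum_distrib_left sum_distrib_right by (subst sum.swap) (simp add: mult_ac)
      also have "... = ?c t * w t" using fB False B0 by simp
      finally show ?thesis using \<open>w t \<noteq> 0\<close> by simp
    qed (use B0 in auto)
    obtain i where i: "i \<in> nb A R T" "y i \<noteq> 0" using y0 by blast
    obtain z where z: "\<And>r. r \<in> R \<Longrightarrow> (\<Sum>s\<in>T. A r s * z s) = of_bool (r = i)"
      using unit[OF i(1)] by blast
    have "0 = (\<Sum>t\<in>T. ?c t * z t)" using col by simp
    also have "... = (\<Sum>r\<in>nb A R T. (\<Sum>t\<in>T. A r t * z t) * y r)"
      unfolding sum_distrib_left sum_distrib_right by (subst sum.swap) (simp add: mult_ac)
    also have "... = (\<Sum>r\<in>nb A R T. if r = i then y i else 0)"
      using z by (intro sum.cong) (auto simp: nb_def)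
    also have "... = y i" using i assms by (simp add: nb_def)
    finally show False using i by simp
  qed
  moreover have "indep_cols A R ((V - T) \<union> B)"
    unfolding indep_cols_def
  proof (intro allI impI)
    fix w assume w: "nullvec A R (V - T \<union> B) w"
    define v where "v = (\<lambda>s. if s \<in> V - T \<union> B then w s else 0)"
    have v: "nullvec A R V v"
      unfolding v_def using assms(2) _ w by (rule nullvec_extend_zero) (use B TV in auto)
    then have v0: "v s = 0" if "s \<in> V - T" for s using that by (auto simp: T_def ksupp_def)
    have "nullvec A R B v"
    proof (subst nullvec_extend[of V B, symmetric])
      show "v s = 0" if "s \<in> V - B" for s using that v0 by (cases "s \<in> T") (auto simp: v_def)
    qed (use v assms B TV in auto)
    then have "v s = 0" if "s \<in> B" for s using B that by (auto simp: indep_cols_def)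
    with v0 have "\<forall>s\<in>V - T \<union> B. v s = 0" by auto
    then show "\<forall>s\<in>V - T \<union> B. w s = 0" by (auto simp: v_def)
  qed
  moreover have "card (V - T \<union> B) = card V - card T + card B"
    using fB fT TV B assms by (subst card_Un_disjoint) (auto simp: card_Diff_subset)
  ultimately show ?thesis using B TV unfolding T_def[symmetric]
    by (intro exI[of _ "V - T \<union> B"]) auto
qed

subsection \<open>Symmetric matrices supported on a random graph\<close>

type_synonym 'a cmatrix = "'a \<Rightarrow> 'a \<Rightarrow> complex"

text \<open>Loops are singletons. Unordered pairs give one independent coordinate for each entry on
  or above the diagonal.\<close>

definition sedges :: "'a set \<Rightarrow> 'a set set" where
  "sedges V = (\<lambda>(i, j). {i, j}) ` (V \<times> V)"

definition star :: "'a \<Rightarrow> 'a set \<Rightarrow> 'a set set" where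
  "star i S = (\<lambda>s. {i, s}) ` S"

text \<open>\<open>W\<close> holds the values that the entries take when they are present. A zero
  weight on the diagonal models an entry that is absent in any case.\<close>

definition wmat :: "'a cmatrix \<Rightarrow> 'a set set \<Rightarrow> 'a cmatrix" where
  "wmat W E i j = (if {i, j} \<in> E then W i j else 0)"

lemma mem_sedges: "{i, j} \<in> sedges V \<longleftrightarrow> i \<in> V \<and> j \<in> V"
  by (auto simp: sedges_def doubleton_eq_iff)

lemma mem_star: "{i, s} \<in> star i S \<longleftrightarrow> s \<in> S"
  by (auto simp: star_def doubleton_eq_iff)

lemma finite_sedges [simp]: "finite V \<Longrightarrow> finite (sedges V)"
  by (simp add: sedges_def)

lemma finite_star [simp]: "finite S \<Longrightarrow> finite (star i S)"
  by (simp add: star_def)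

lemma inj_star: "inj_on (\<lambda>s. {i, s}) S"
  by (auto simp: inj_on_def doubleton_eq_iff)

lemma card_star [simp]: "card (star i S) = card S"
  unfolding star_def by (rule card_image[OF inj_star])

lemma star_disjoint: "i \<notin> S \<Longrightarrow> i \<noteq> j \<Longrightarrow> star i S \<inter> star j S = {}"
  by (auto simp: star_def doubleton_eq_iff)

lemma star_sedges_disjoint: "i \<notin> S \<Longrightarrow> sedges S \<inter> star i S' = {}"
  by (auto simp: star_def mem_sedges)

lemma card_sedges_le: "finite S \<Longrightarrow> card (sedges S) \<le> card S ^ 2"
  unfolding sedges_def using card_image_le[of "S \<times> S" "\<lambda>(i, j). {i, j}"]
  by (simp add: card_cartesian_product power2_eq_square)

lemma wmat_sym: "(\<And>i j. W i j = W j i) \<Longrightarrow> wmat W E i j = wmat W E j i"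
  by (simp add: wmat_def insert_commute)

text \<open>
  The two events bound the probability that a small set \<open>S\<close> of columns is dependent outside the
  exceptional rows \<open>Z\<close>. The first is used if \<open>p * card S\<close> is bounded: every row meeting \<open>S\<close> meets
  it at least twice, and there are at least \<open>card S\<close> such rows. The second is used otherwise: the
  entries in \<open>card S\<close> rows \<open>R\<close> determine the null vector, to which all other rows have to be orthogonal.
\<close>

definition sparse_event :: "'a set \<Rightarrow> 'a set \<Rightarrow> 'a set \<Rightarrow> nat \<Rightarrow> 'a set set \<Rightarrow> bool" where
  "sparse_event V S Z \<tau> E \<longleftrightarrow>
     (\<forall>i\<in>V - S - Z. card (E \<inter> star i S) \<noteq> 1) \<and> (\<forall>i\<in>Z. 1 \<le> card (E \<inter> star i S)) \<and>
     \<tau> \<le> card (E \<inter> sedges S) + card {i \<in> V - S - Z. 2 \<le> card (E \<inter> star i S)}"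

definition rigid_event :: "'a cmatrix \<Rightarrow> 'a set \<Rightarrow> 'a set \<Rightarrow> 'a set \<Rightarrow> 'a set \<Rightarrow> 'a set set \<Rightarrow> bool" where
  "rigid_event W V S R Z E \<longleftrightarrow> (\<exists>w. (\<forall>s\<in>S. w s \<noteq> 0) \<and> nullvec (wmat W E) (V - Z) S w \<and>
     (\<forall>v. nullvec (wmat W E) R S v \<longrightarrow> (\<exists>c. \<forall>s\<in>S. v s = c * w s)))"

text \<open>Each edge inside \<open>S\<close> contributes to at most two of the degrees.\<close>

lemma card_le_inner_edges:
  assumes fin: "finite S" and X: "X \<subseteq> S" and Z: "finite Z" "card Z \<le> 1"
    and deg: "\<And>i. i \<in> X - Z \<Longrightarrow> 2 \<le> card {s \<in> S. {i, s} \<in> E}"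
    and deg1: "\<And>i. i \<in> X \<inter> Z \<Longrightarrow> 1 \<le> card {s \<in> S. {i, s} \<in> E}"
  shows "card X \<le> card (E \<inter> sedges S)"
proof -
  have fX: "finite X" using X fin finite_subset by auto
  let ?P = "SIGMA i:X. {s \<in> S. {i, s} \<in> E}"
  let ?g = "\<lambda>(i, j). {i, j}"
  have "2 * card (X - Z) + card (X \<inter> Z) =
      (\<Sum>i\<in>X - Z. 2) + (\<Sum>i\<in>X \<inter> Z. 1)" by simp
  also have "... \<le> (\<Sum>i\<in>X - Z. card {s \<in> S. {i, s} \<in> E}) + (\<Sum>i\<in>X \<inter> Z. card {s \<in> S. {i, s} \<in> E})"
    using deg deg1 by (intro add_mono sum_mono) auto
  also have "... = (\<Sum>i\<in>X. card {s \<in> S. {i, s} \<in> E})"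
    using sum.Int_Diff[OF fX, of "\<lambda>i. card {s \<in> S. {i, s} \<in> E}" Z] by simp
  also have "... = card ?P" using fX fin by (subst card_SigmaI) auto
  also have "... \<le> card (\<Union>e\<in>E \<inter> sedges S. {q \<in> S \<times> S. ?g q = e})"
    using X fin by (intro card_mono finite_UN_I finite_Int) (auto simp: mem_sedges intro: finite_subset[of _ "S \<times> S"])
  also have "... \<le> (\<Sum>e\<in>E \<inter> sedges S. card {q \<in> S \<times> S. ?g q = e})"
    using fin by (intro card_UN_le) auto
  also have "... \<le> (\<Sum>e\<in>E \<inter> sedges S. 2)"
  proof (intro sum_mono)
    fix e assume "e \<in> E \<inter> sedges S"
    then obtain i j where e: "e = {i, j}" by (auto simp: sedges_def)
    have "{q \<in> S \<times> S. ?g q = e} \<subseteq> set [(i, j), (j, i)]"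
    proof
      fix q assume q: "q \<in> {q \<in> S \<times> S. ?g q = e}"
      obtain a b where ab: "q = (a, b)" by (cases q)
      with q have "{a, b} = {i, j}" by (simp add: e)
      then show "q \<in> set [(i, j), (j, i)]" by (simp add: ab doubleton_eq_iff)
    qed
    then have "card {q \<in> S \<times> S. ?g q = e} \<le> card (set [(i, j), (j, i)])" by (intro card_mono) auto
    also have "... \<le> 2" using card_length[of "[(i, j), (j, i)]"] by simp
    finally show "card {q \<in> S \<times> S. ?g q = e} \<le> 2" .
  qed
  finally have "2 * card (X - Z) + card (X \<inter> Z) \<le> 2 * card (E \<inter> sedges S)" by simp
  moreover have "card X = card (X - Z) + card (X \<inter> Z)"
    using fX by (metis add.commute card_Int_Diff)
  moreover have "card (X \<inter> Z) \<le> 1" using Z card_mono[of Z "X \<inter> Z"] by simp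
  ultimately show ?thesis by linarith
qed

lemma sum_one_nonzero:
  assumes "finite S" "(\<Sum>s\<in>S. f s) = (0 :: complex)" "s \<in> S" "f s \<noteq> 0"
  shows "\<exists>t\<in>S - {s}. f t \<noteq> 0"
proof (rule ccontr)
  assume "\<not> ?thesis"
  then have "(\<Sum>t\<in>S - {s}. f t) = 0" by (intro sum.neutral) auto
  then show False using assms by (simp add: sum.remove)
qed

text \<open>A row outside \<open>Z\<close> is orthogonal to \<open>w\<close>, which has no zero
  coordinate, so it cannot have exactly one nonzero entry in \<open>S\<close>; a row in
  \<open>Z\<close> has at least one. Rows that belong to \<open>S\<close> share edges with each
  other and may meet zero diagonal weights, so they enter only through the number of edges inside
  \<open>S\<close>.\<close>

lemma sparse_eventI:
  assumes W: "\<And>i j. i \<noteq> j \<Longrightarrow> W i j \<noteq> 0"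
    and V: "finite V" "S \<subseteq> V" "Z \<subseteq> V" "card Z \<le> 1"
    and w: "\<And>s. s \<in> S \<Longrightarrow> w s \<noteq> 0" "nullvec (wmat W E) (V - Z) S w"
    and Z: "\<And>i. i \<in> Z \<Longrightarrow> (\<Sum>s\<in>S. wmat W E i s * w s) \<noteq> 0"
    and nb: "card S \<le> card (nb (wmat W E) V S)"
  shows "sparse_event V S (Z - S) (card S - card (Z - S)) E"
proof -
  let ?A = "wmat W E" and ?N = "nb (wmat W E) V S"
  have fin: "finite S" "finite Z" using V finite_subset by auto
  \<comment> \<open>Only for \<open>i \<notin> S\<close> is an edge from \<open>i\<close> to
    \<open>S\<close> sure to give a nonzero entry, since the diagonal is then avoided.\<close>
  have star_nz: "{s \<in> S. {i, s} \<in> E} = {s \<in> S. {i, s} \<in> E \<and> ?A i s \<noteq> 0}" if "i \<notin> S" for i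
    using that W by (force simp: wmat_def)
  have card_star: "card (E \<inter> star i S) = card {s \<in> S. {i, s} \<in> E}" for i
  proof -
    have "E \<inter> star i S = star i {s \<in> S. {i, s} \<in> E}" by (auto simp: star_def)
    then show ?thesis by simp
  qed
  have entry: "\<exists>s\<in>S. {i, s} \<in> E \<and> ?A i s \<noteq> 0" if "i \<in> ?N" for i
    using that by (auto simp: nb_def wmat_def split: if_splits)
  have ge1: "1 \<le> card {s \<in> S. {i, s} \<in> E}" if "i \<in> ?N" for i
    using entry[OF that] fin by (auto simp: Suc_le_eq card_gt_0_iff)
  have ge2: "2 \<le> card {s \<in> S. {i, s} \<in> E}" if i: "i \<in> ?N - Z" for i
  proof -
    obtain s where s: "s \<in> S" "{i, s} \<in> E" "?A i s \<noteq> 0" using entry i by blast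
    have "(\<Sum>s\<in>S. ?A i s * w s) = 0" using w(2) i by (auto simp: nullvec_def nb_def)
    then obtain t where t: "t \<in> S - {s}" "?A i t * w t \<noteq> 0"
      using sum_one_nonzero[of S "\<lambda>s. ?A i s * w s" s] fin s w by auto
    then have "{s, t} \<subseteq> {s \<in> S. {i, s} \<in> E}" using s by (auto simp: wmat_def split: if_splits)
    from card_mono[OF _ this] show ?thesis using t fin by auto
  qed
  have "Z \<subseteq> ?N"
  proof
    fix i assume i: "i \<in> Z"
    then have "\<exists>s\<in>S. ?A i s * w s \<noteq> 0" using Z[OF i] by (meson sum.neutral)
    then show "i \<in> ?N" using i V by (auto simp: nb_def)
  qed
  have in_nb: "i \<in> ?N" if "i \<in> V - S" "1 \<le> card {s \<in> S. {i, s} \<in> E}" for i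
  proof -
    have "{s \<in> S. {i, s} \<in> E \<and> ?A i s \<noteq> 0} \<noteq> {}"
      using that star_nz[of i] by (metis DiffD2 card.empty not_one_le_zero)
    then show ?thesis using that by (auto simp: nb_def)
  qed
  have "card (E \<inter> star i S) \<noteq> 1" if "i \<in> V - S - (Z - S)" for i
    using in_nb[of i] ge2[of i] that unfolding card_star by fastforce
  moreover have "1 \<le> card (E \<inter> star i S)" if "i \<in> Z - S" for i
    using ge1[of i] that \<open>Z \<subseteq> ?N\<close> unfolding card_star by auto
  moreover have "card S - card (Z - S) \<le>
      card (E \<inter> sedges S) + card {i \<in> V - S - (Z - S). 2 \<le> card (E \<inter> star i S)}"
  proof -
    let ?Y = "{i \<in> V - S - (Z - S). 2 \<le> card (E \<inter> star i S)}"
    have "?N \<subseteq> (?N \<inter> S) \<union> ?Y \<union> (Z - S)"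
      using ge2 card_star by (auto simp: nb_def)
    then have "card ?N \<le> card ((?N \<inter> S) \<union> ?Y \<union> (Z - S))"
      using fin V by (intro card_mono) (auto simp: nb_def)
    also have "... \<le> card (?N \<inter> S) + card ?Y + card (Z - S)"
      by (meson add_mono_thms_linordered_semiring(3) card_Un_le order_trans)
    also have "card (?N \<inter> S) \<le> card (E \<inter> sedges S)"
      using fin V ge1 ge2 by (intro card_le_inner_edges[of S _ Z]) auto
    finally show ?thesis using nb by linarith
  qed
  ultimately show ?thesis unfolding sparse_event_def by blast
qed

section \<open>Probabilities of the sparse and the rigid event\<close>

lemma choose_le_pow_fact: "real (n choose s) \<le> real n ^ s / fact s"
proof -
  have "real ((n choose s) * fact s) \<le> real (n ^ s)"
    using binomial_fact_pow[of n s] by (simp only: of_nat_le_iff)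
  then show ?thesis by (simp add: pos_le_divide_eq)
qed

text \<open>Union bound over the ways to split \<open>\<tau>\<close> into \<open>t\<close> rows of
  degree at least 2 and \<open>\<tau> - t\<close> edges inside \<open>S\<close>, and over the set
  \<open>Y\<close> of these rows. For fixed \<open>Y\<close> the edges inside \<open>S\<close> and
  the stars of the outer rows are disjoint blocks, so the probability factorises. At least
  \<open>m\<close> rows outside \<open>Y\<close> remain, each contributing
  \<open>\<rho>\<close>.\<close>

lemma pr_sparse_event_le:
  assumes p: "0 \<le> p" "p \<le> 1" and V: "finite V" "S \<subseteq> V" "Z \<subseteq> V - S" and k: "card S = k"
    and \<rho>: "\<rho> = 1 - real k * p * (1 - p) ^ (k - 1)"
    and m: "m + k + card Z + \<tau> \<le> card V"
  shows "pr p (sedges V) (sparse_event V S Z \<tau>) \<le>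
    (real k * p) ^ card Z * ((real k ^ 2 * p + real (card V) * (real k ^ 2 * p ^ 2 / 2)) ^ \<tau> / fact \<tau>) * \<rho> ^ m"
proof -
  have fin: "finite S" "finite Z" using V by (auto intro: finite_subset)
  define U where "U = V - S - Z"
  define N where "N = card V"
  have fU: "finite U" "card U \<le> N" using V by (auto simp: U_def N_def intro: card_mono)
  have cU: "card U = N - k - card Z"
    using V fin k by (simp add: U_def N_def card_Diff_subset)
  define \<beta> where "\<beta> = real k ^ 2 * p ^ 2 / 2"
  have \<rho>_pr: "pr p (star i S) (\<lambda>X. card X \<noteq> 1) = \<rho>" for i
    using pr_card_neq_1[of "star i S" p] fin k by (simp add: \<rho>)
  have \<rho>0: "0 \<le> \<rho>" "\<rho> \<le> 1"
    using pr_le_1[of "star undefined S" p] bern_nonneg[OF p, of "star undefined S" "\<lambda>X. of_bool (card X \<noteq> 1)"] fin p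
    unfolding \<rho>_pr[symmetric, of undefined] by auto
  have ge2: "pr p (star i S) (\<lambda>X. 2 \<le> card X) \<le> \<beta>" for i
  proof -
    have "real (k choose 2) \<le> real k ^ 2 / 2"
      by (cases k) (auto simp: choose_two power2_eq_square real_of_nat_div algebra_simps)
    then have "real (k choose 2) * p ^ 2 \<le> real k ^ 2 / 2 * p ^ 2" by (intro mult_right_mono) auto
    then show ?thesis using pr_card_ge[of "star i S" p 2] fin p k by (simp add: \<beta>_def)
  qed
  have ge1: "pr p (star i S) (\<lambda>X. 1 \<le> card X) \<le> real k * p" for i
    using pr_card_ge[of "star i S" p 1] fin p k by simp
  define D where "D = (\<Union>i\<in>U \<union> Z. star i S)"
  have D: "finite D" "D \<subseteq> sedges V" "sedges S \<inter> D = {}" "sedges S \<subseteq> sedges V"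
    using fU fin V by (auto simp: D_def U_def star_def mem_sedges) (auto simp: sedges_def)
  \<comment> \<open>The condition on a single row. Fixing \<open>Y\<close> in advance makes the
    conditions on different rows independent.\<close>
  define Q where "Q = (\<lambda>Y i (X :: 'a set set). if i \<in> Z then 1 \<le> card X else if i \<in> Y then 2 \<le> card X else card X \<noteq> (1::nat))"
  define ev where "ev = (\<lambda>a Y E. a \<le> card (E \<inter> sedges S) \<and> (\<forall>i\<in>U \<union> Z. Q Y i (E \<inter> star i S)))"
  have block: "pr p (sedges V) (ev a Y)
      \<le> (real (k ^ 2) ^ a / fact a * p ^ a) * ((real k * p) ^ card Z * \<beta> ^ card Y * \<rho> ^ m)"
    if Y: "Y \<subseteq> U" "card Y \<le> \<tau>" for a Y
  proof -
    have UZ: "U \<inter> Z = {}" "finite Y" using Y fU finite_subset by (auto simp: U_def)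
    have "pr p (sedges V) (ev a Y) =
      bern p (sedges V) (\<lambda>E. (\<lambda>F. of_bool (a \<le> card F)) (E \<inter> sedges S) *
        (\<lambda>F. \<Prod>i\<in>U \<union> Z. of_bool (Q Y i (F \<inter> star i S))) (E \<inter> D))"
    proof (intro bern_cong)
      fix E
      have "E \<inter> D \<inter> star i S = E \<inter> star i S" if "i \<in> U \<union> Z" for i
        using that by (auto simp: D_def)
      then have "(\<Prod>i\<in>U \<union> Z. of_bool (Q Y i (E \<inter> D \<inter> star i S))) =
          (of_bool (\<forall>i\<in>U \<union> Z. Q Y i (E \<inter> star i S)) :: real)"
        using fU fin by (simp add: of_bool_def prod_zero_iff)
      then show "of_bool (ev a Y E) =
        of_bool (a \<le> card (E \<inter> sedges S)) * (\<Prod>i\<in>U \<union> Z. of_bool (Q Y i (E \<inter> D \<inter> star i S)) :: real)"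
        by (simp add: ev_def)
    qed
    also have "... = pr p (sedges S) (\<lambda>F. a \<le> card F) *
        bern p D (\<lambda>F. \<Prod>i\<in>U \<union> Z. of_bool (Q Y i (F \<inter> star i S)))"
      using V D by (intro bern_indep) auto
    also have "bern p D (\<lambda>F. \<Prod>i\<in>U \<union> Z. of_bool (Q Y i (F \<inter> star i S))) =
        (\<Prod>i\<in>U \<union> Z. pr p (star i S) (Q Y i))"
    proof (rule bern_blocks)
      show "star i S \<inter> star j S = {}" if "i \<in> U \<union> Z" "j \<in> U \<union> Z" "i \<noteq> j" for i j
        using that V by (intro star_disjoint) (auto simp: U_def)
    qed (use fU fin D in \<open>auto simp: D_def\<close>)
    also have "... = (\<Prod>i\<in>U. pr p (star i S) (Q Y i)) * (\<Prod>i\<in>Z. pr p (star i S) (Q Y i))"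
      using fU fin UZ by (intro prod.union_disjoint) auto
    finally have split: "pr p (sedges V) (ev a Y) =
      pr p (sedges S) (\<lambda>F. a \<le> card F) *
        ((\<Prod>i\<in>U. pr p (star i S) (Q Y i)) * (\<Prod>i\<in>Z. pr p (star i S) (Q Y i)))" .
    have inner: "pr p (sedges S) (\<lambda>F. a \<le> card F) \<le> real (k ^ 2) ^ a / fact a * p ^ a"
    proof -
      have "pr p (sedges S) (\<lambda>F. a \<le> card F) \<le> real (card (sedges S) choose a) * p ^ a"
        using fin p by (intro pr_card_ge) auto
      also have "... \<le> real (k ^ 2) ^ a / fact a * p ^ a"
      proof (intro mult_right_mono)
        have "real (card (sedges S) choose a) \<le> real (card (sedges S)) ^ a / fact a"
          by (rule choose_le_pow_fact)
        also have "... \<le> real (k ^ 2) ^ a / fact a"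
          using card_sedges_le[OF fin(1)] k by (intro divide_right_mono power_mono) auto
        finally show "real (card (sedges S) choose a) \<le> real (k ^ 2) ^ a / fact a" .
      qed (use p in simp)
      finally show ?thesis .
    qed
    have Zp: "(\<Prod>i\<in>Z. pr p (star i S) (Q Y i)) \<le> (real k * p) ^ card Z"
    proof -
      have "Q Y i = (\<lambda>X. 1 \<le> card X)" if "i \<in> Z" for i
        using that by (auto simp: Q_def)
      then have "(\<Prod>i\<in>Z. pr p (star i S) (Q Y i)) \<le> (\<Prod>i\<in>Z. real k * p)"
        using p ge1 by (intro prod_mono conjI bern_nonneg) auto
      then show ?thesis by simp
    qed
    have "(\<Prod>i\<in>U. pr p (star i S) (Q Y i)) =
        (\<Prod>i\<in>U - Y. pr p (star i S) (Q Y i)) * (\<Prod>i\<in>Y. pr p (star i S) (Q Y i))"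
      using fU Y by (intro prod.subset_diff) auto
    also have "... \<le> \<rho> ^ m * \<beta> ^ card Y"
    proof (intro mult_mono)
      have "Q Y i = (\<lambda>X. card X \<noteq> 1)" if "i \<in> U - Y" for i
        using that UZ by (auto simp: Q_def)
      then have "(\<Prod>i\<in>U - Y. pr p (star i S) (Q Y i)) \<le> (\<Prod>i\<in>U - Y. \<rho>)"
        using p \<rho>_pr by (intro prod_mono conjI bern_nonneg) auto
      also have "... \<le> \<rho> ^ m"
        using m Y cU UZ \<rho>0 by (auto simp: card_Diff_subset N_def intro!: power_decreasing)
      finally show "(\<Prod>i\<in>U - Y. pr p (star i S) (Q Y i)) \<le> \<rho> ^ m" .
      have "Q Y i = (\<lambda>X. 2 \<le> card X)" if "i \<in> Y" for i
        using that UZ Y by (auto simp: Q_def)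
      then have "(\<Prod>i\<in>Y. pr p (star i S) (Q Y i)) \<le> (\<Prod>i\<in>Y. \<beta>)"
        using p ge2 by (intro prod_mono conjI bern_nonneg) auto
      then show "(\<Prod>i\<in>Y. pr p (star i S) (Q Y i)) \<le> \<beta> ^ card Y" by simp
    qed (use p \<rho>0 in \<open>auto intro!: prod_nonneg bern_nonneg\<close>)
    finally have Up: "(\<Prod>i\<in>U. pr p (star i S) (Q Y i)) \<le> \<rho> ^ m * \<beta> ^ card Y" .
    have "pr p (sedges V) (ev a Y) \<le>
      (real (k ^ 2) ^ a / fact a * p ^ a) * ((\<rho> ^ m * \<beta> ^ card Y) * (real k * p) ^ card Z)"
      unfolding split
    proof (rule mult_mono[OF inner mult_mono[OF Up Zp]])
      show "0 \<le> \<rho> ^ m * \<beta> ^ card Y" using \<rho>0 by (simp add: \<beta>_def)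
      show "0 \<le> (\<Prod>i\<in>Z. pr p (star i S) (Q Y i))"
        using p by (intro prod_nonneg ballI bern_nonneg) auto
      show "0 \<le> (\<Prod>i\<in>U. pr p (star i S) (Q Y i)) * (\<Prod>i\<in>Z. pr p (star i S) (Q Y i))"
        using p by (intro mult_nonneg_nonneg prod_nonneg ballI bern_nonneg) auto
    qed (use p in simp)
    then show ?thesis by (simp only: mult_ac)
  qed
  let ?h = "\<lambda>t. (real (k ^ 2) ^ (\<tau> - t) / fact (\<tau> - t) * p ^ (\<tau> - t)) * ((real k * p) ^ card Z * \<beta> ^ t * \<rho> ^ m)"
  let ?C = "SIGMA t:{..\<tau>}. {Y. Y \<subseteq> U \<and> card Y = t}"
  have fC: "finite ?C" using fU by auto
  have "pr p (sedges V) (sparse_event V S Z \<tau>) \<le> pr p (sedges V) (\<lambda>E. \<exists>q\<in>?C. (case q of (t, Y) \<Rightarrow> ev (\<tau> - t) Y) E)"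
  proof (intro pr_mono p)
    fix E assume E: "sparse_event V S Z \<tau> E"
    define Y where "Y = {i \<in> U. 2 \<le> card (E \<inter> star i S)}"
    define t where "t = min \<tau> (card Y)"
    obtain Y' where Y': "Y' \<subseteq> Y" "card Y' = t"
      by (metis min.cobounded2 obtain_subset_with_card_n t_def)
    have "\<tau> - t \<le> card (E \<inter> sedges S)"
      using E by (auto simp: sparse_event_def t_def Y_def U_def)
    moreover have "\<forall>i\<in>U \<union> Z. Q Y' i (E \<inter> star i S)"
      using E Y' by (auto simp: sparse_event_def U_def Q_def Y_def)
    moreover have "(t, Y') \<in> ?C" using Y' by (auto simp: Y_def t_def)
    ultimately show "\<exists>q\<in>?C. (case q of (t, Y) \<Rightarrow> ev (\<tau> - t) Y) E"
      by (intro bexI[of _ "(t, Y')"]) (auto simp: ev_def)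
  qed
  also have "... \<le> (\<Sum>q\<in>?C. pr p (sedges V) (case q of (t, Y) \<Rightarrow> ev (\<tau> - t) Y))"
    by (intro pr_Bex_le p fC)
  also have "... = (\<Sum>t\<le>\<tau>. \<Sum>Y | Y \<subseteq> U \<and> card Y = t. pr p (sedges V) (ev (\<tau> - t) Y))"
    using fU by (subst sum.Sigma) (auto simp: case_prod_unfold)
  also have "... \<le> (\<Sum>t\<le>\<tau>. \<Sum>Y | Y \<subseteq> U \<and> card Y = t.
     ?h t)"
    using block by (intro sum_mono) auto
  also have "... = (\<Sum>t\<le>\<tau>. real (card U choose t) *
     ?h t)"
    using fU by (simp add: n_subsets)
  also have "... \<le> (\<Sum>t\<le>\<tau>. (real N ^ t / fact t) *
     ?h t)"
  proof (intro sum_mono mult_right_mono)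
    fix t
    have "real (card U choose t) \<le> real (card U) ^ t / fact t" by (rule choose_le_pow_fact)
    also have "... \<le> real N ^ t / fact t"
      using fU by (intro divide_right_mono power_mono) auto
    finally show "real (card U choose t) \<le> real N ^ t / fact t" .
  qed (use p \<rho>0 in \<open>auto simp: \<beta>_def\<close>)
  also have "... = (real k * p) ^ card Z * (\<Sum>t\<le>\<tau>. (real N * \<beta>) ^ t / fact t *
      ((real k ^ 2 * p) ^ (\<tau> - t) / fact (\<tau> - t))) * \<rho> ^ m"
    unfolding sum_distrib_left sum_distrib_right
    by (intro sum.cong refl) (simp add: power_mult_distrib mult_ac)
  \<comment> \<open>The binomial theorem divided by \<open>fact \<tau>\<close> merges the two
    contributions into one power.\<close>
  also have "(\<Sum>t\<le>\<tau>. (real N * \<beta>) ^ t / fact t * ((real k ^ 2 * p) ^ (\<tau> - t) / fact (\<tau> - t))) =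
      (real N * \<beta> + real k ^ 2 * p) ^ \<tau> / fact \<tau>"
    unfolding binomial_ring sum_divide_distrib
    by (intro sum.cong refl) (simp add: binomial_fact)
  finally show ?thesis by (simp add: N_def \<beta>_def add.commute)
qed

text \<open>Condition on all edges outside \<open>D\<close>, the edges between \<open>U\<close> and
  \<open>S\<close>. The rows \<open>R\<close> on \<open>S\<close> are then fixed and determine
  \<open>w\<close> up to a scalar; every row of \<open>U\<close> must be orthogonal to this one
  vector. These rows are independent and each succeeds with probability at most
  \<open>q\<close>.\<close>

lemma pr_rigid_event_le:
  fixes W :: "'a cmatrix"
  assumes p: "0 \<le> p" "p \<le> 1" and W: "\<And>i j. i \<noteq> j \<Longrightarrow> W i j \<noteq> 0"
    and V: "finite V" "S \<subseteq> V" "R \<subseteq> V - Z" and q: "q \<le> 1"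
    and lo: "\<And>v :: 'a \<Rightarrow> complex. (\<And>s. s \<in> S \<Longrightarrow> v s \<noteq> 0) \<Longrightarrow> pr p S (\<lambda>X. sum v X = 0) \<le> q"
    and m: "m + card S + card R + card Z \<le> card V" and Z: "finite Z"
  shows "pr p (sedges V) (rigid_event W V S R Z) \<le> q ^ m"
proof -
  have fin: "finite S" "finite R" using V by (auto intro: finite_subset)
  have "0 \<le> pr p S (\<lambda>X. sum (\<lambda>_. 1 :: complex) X = 0)" using p by (intro bern_nonneg) auto
  also have "... \<le> q" by (rule lo) auto
  finally have q0: "0 \<le> q" .
  define U where "U = V - S - R - Z"
  have fU: "finite U" using V by (auto simp: U_def)
  have "V \<subseteq> U \<union> S \<union> R \<union> Z" by (auto simp: U_def)
  then have "card V \<le> card (U \<union> S \<union> R \<union> Z)" using fU fin Z by (intro card_mono) auto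
  also have "... \<le> card U + card S + card R + card Z"
    by (meson add_mono_thms_linordered_semiring(3) card_Un_le order_trans)
  finally have mU: "m \<le> card U" using m by linarith
  define D where "D = (\<Union>i\<in>U. star i S)"
  have D: "D \<subseteq> sedges V" "finite D" using V fU fin by (auto simp: D_def U_def star_def mem_sedges)
  have row: "pr p (star i S) (\<lambda>X. (\<Sum>s\<in>S. wmat W X i s * w s) = 0) \<le> q"
    if i: "i \<in> U" and w: "\<And>s. s \<in> S \<Longrightarrow> w s \<noteq> 0" for i w
  proof -
    have "pr p (star i S) (\<lambda>X. (\<Sum>s\<in>S. wmat W X i s * w s) = 0) =
        pr p S (\<lambda>Y. (\<Sum>s\<in>S. wmat W (star i Y) i s * w s) = 0)"
      unfolding star_def using fin inj_star by (intro bern_image) auto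
    also have "... = pr p S (\<lambda>Y. sum (\<lambda>s. W i s * w s) Y = 0)"
    proof (intro bern_cong)
      fix Y assume "Y \<subseteq> S"
      then have "(\<Sum>s\<in>S. wmat W (star i Y) i s * w s) = (\<Sum>s\<in>Y. W i s * w s)"
        using fin by (intro sum.mono_neutral_cong_right) (auto simp: wmat_def mem_star)
      then show "of_bool ((\<Sum>s\<in>S. wmat W (star i Y) i s * w s) = 0) =
        (of_bool (sum (\<lambda>s. W i s * w s) Y = 0) :: real)" by simp
    qed
    also have "... \<le> q" using i w W by (intro lo) (force simp: U_def)
    finally show ?thesis .
  qed
  have cond: "pr p D (\<lambda>Y. rigid_event W V S R Z (X \<union> Y)) \<le> q ^ m" if X: "X \<subseteq> sedges V - D" for X
  proof (cases "\<exists>Y\<subseteq>D. rigid_event W V S R Z (X \<union> Y)")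
    case False
    then have "pr p D (\<lambda>Y. rigid_event W V S R Z (X \<union> Y)) = pr p D (\<lambda>Y. False)"
      by (intro bern_cong) auto
    then show ?thesis using D q0 by simp
  next
    case True
    have same: "wmat W (X \<union> Y) r s = wmat W X r s" if "Y \<subseteq> D" "r \<in> R" "s \<in> S" for Y r s
    proof -
      have "{r, s} \<notin> D" using that by (auto simp: D_def U_def star_def doubleton_eq_iff)
      then show ?thesis using that by (auto simp: wmat_def)
    qed
    then have sameR: "nullvec (wmat W (X \<union> Y)) R S v \<longleftrightarrow> nullvec (wmat W X) R S v" if "Y \<subseteq> D" for Y v
      using that unfolding nullvec_def by simp
    \<comment> \<open>The rows \<open>R\<close> do not depend on the part of the edge set inside
      \<open>D\<close>, so a vector found for one completion \<open>Y0\<close> spans the admissible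
      null vectors of every other completion.\<close>
    obtain Y0 w where w: "Y0 \<subseteq> D" "\<And>s. s \<in> S \<Longrightarrow> w s \<noteq> 0"
      and uniq: "\<And>v. nullvec (wmat W X) R S v \<Longrightarrow> \<exists>c. \<forall>s\<in>S. v s = c * w s"
      using True sameR unfolding rigid_event_def by metis
    have step: "(\<Sum>s\<in>S. wmat W (Y \<inter> star i S) i s * w s) = 0"
      if Y: "Y \<subseteq> D" and ev: "rigid_event W V S R Z (X \<union> Y)" and i: "i \<in> U" for Y i
    proof (cases "S = {}")
      case False
      obtain u where u: "\<And>s. s \<in> S \<Longrightarrow> u s \<noteq> 0" "nullvec (wmat W (X \<union> Y)) (V - Z) S u"
        using ev unfolding rigid_event_def by blast
      have "nullvec (wmat W X) R S u"
        using nullvec_mono[OF u(2) V(3)] sameR[OF Y] by simp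
      then obtain c where c: "\<And>s. s \<in> S \<Longrightarrow> u s = c * w s" using uniq by blast
      have c0: "c \<noteq> 0" using c u False by (metis all_not_in_conv mult_zero_left)
      have "wmat W (Y \<inter> star i S) i s = wmat W (X \<union> Y) i s" if "s \<in> S" for s
      proof -
        have "{i, s} \<in> star i S" "{i, s} \<in> D" using that i unfolding D_def by (auto simp: mem_star intro!: bexI[of _ i])
        then show ?thesis using X by (auto simp: wmat_def)
      qed
      then have "c * (\<Sum>s\<in>S. wmat W (Y \<inter> star i S) i s * w s) = (\<Sum>s\<in>S. wmat W (X \<union> Y) i s * u s)"
        using c by (simp add: sum_distrib_left mult_ac)
      also have "... = 0" using u(2) i by (auto simp: nullvec_def U_def)
      finally show ?thesis using c0 by simp
    qed simp
    let ?g = "\<lambda>i X. of_bool ((\<Sum>s\<in>S. wmat W X i s * w s) = 0) :: real"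
    have "pr p D (\<lambda>Y. rigid_event W V S R Z (X \<union> Y)) \<le> bern p D (\<lambda>Y. \<Prod>i\<in>U. ?g i (Y \<inter> star i S))"
    proof (intro bern_mono p)
      fix Y assume "Y \<subseteq> D"
      then have "rigid_event W V S R Z (X \<union> Y) \<Longrightarrow> (\<Prod>i\<in>U. ?g i (Y \<inter> star i S)) = 1"
        using step by (intro prod.neutral) auto
      then show "of_bool (rigid_event W V S R Z (X \<union> Y)) \<le> (\<Prod>i\<in>U. ?g i (Y \<inter> star i S))"
        by (cases "rigid_event W V S R Z (X \<union> Y)") (auto intro: prod_nonneg)
    qed
    also have "... = (\<Prod>i\<in>U. bern p (star i S) (?g i))"
    proof (rule bern_blocks)
      show "star i S \<inter> star j S = {}" if "i \<in> U" "j \<in> U" "i \<noteq> j" for i j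
        using that by (intro star_disjoint) (auto simp: U_def)
    qed (use fU D in \<open>auto simp: D_def\<close>)
    also have "... \<le> (\<Prod>i\<in>U. q)"
      using p row w(2) by (intro prod_mono conjI bern_nonneg) auto
    also have "... \<le> q ^ m" using q q0 mU by (simp add: power_decreasing)
    finally show ?thesis .
  qed
  have "pr p (sedges V) (rigid_event W V S R Z) =
      bern p (sedges V - D) (\<lambda>X. pr p D (\<lambda>Y. rigid_event W V S R Z (X \<union> Y)))"
    using bern_Un[of "sedges V - D" D p "\<lambda>E. of_bool (rigid_event W V S R Z E)"] V D
    by (simp add: Un_absorb2 Diff_disjoint inf_commute)
  also have "... \<le> q ^ m" using V cond by (intro bern_le_const[OF _ p, of "sedges V - D"]) auto
  finally show ?thesis .
qed

subsection \<open>Small linear dependencies\<close>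

text \<open>With 1/100 there are at most \<open>(11 / 10) ^ card V\<close> such sets; even the
  square of this number is negligible against \<open>2 ^ card V\<close>.\<close>

definition small_sets :: "'a set \<Rightarrow> 'a set set" where
  "small_sets V = {S. S \<subseteq> V \<and> 100 * card S \<le> card V}"

definition bad_circuit :: "'a cmatrix \<Rightarrow> 'a set \<Rightarrow> bool" where
  "bad_circuit A V \<longleftrightarrow> (\<exists>S\<in>small_sets V. circuit A V S \<and> card S \<le> card (nb A V S))"

definition bad_row :: "'a cmatrix \<Rightarrow> 'a set \<Rightarrow> 'a \<Rightarrow> bool" where
  "bad_row A V j \<longleftrightarrow>
     (\<exists>S\<in>small_sets V. \<exists>w. \<forall>i\<in>V. (\<Sum>s\<in>S. A i s * w s) = of_bool (i = j))"

text \<open>A common consequence of a bad circuit, with \<open>Z = {}\<close>, and of a bad row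
  \<open>j\<close>, with \<open>Z = {j}\<close>, so that one first moment computation serves
  both.\<close>

definition witness_event :: "'a cmatrix \<Rightarrow> 'a set \<Rightarrow> 'a set \<Rightarrow> 'a set set \<Rightarrow> bool" where
  "witness_event W V Z E \<longleftrightarrow> (\<exists>S\<in>small_sets V - {{}}.
     sparse_event V S (Z - S) (card S - card (Z - S)) E \<and>
     (\<exists>R\<subseteq>V - Z. card R \<le> card S \<and> rigid_event W V S R Z E))"

lemma bad_circuit_witness:
  assumes W: "\<And>i j. i \<noteq> j \<Longrightarrow> W i j \<noteq> 0" and V: "finite V" and bad: "bad_circuit (wmat W E) V"
  shows "witness_event W V {} E"
proof -
  obtain S where S: "S \<in> small_sets V" "circuit (wmat W E) V S" "card S \<le> card (nb (wmat W E) V S)"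
    using bad by (auto simp: bad_circuit_def)
  have SV: "S \<subseteq> V" "finite S" using S V finite_subset by (auto simp: small_sets_def)
  obtain w where w: "nullvec (wmat W E) V S w" "\<forall>s\<in>S. w s \<noteq> 0"
    "\<forall>v. nullvec (wmat W E) V S v \<longrightarrow> (\<exists>c. \<forall>s\<in>S. v s = c * w s)"
    using circuit_nullvec[OF SV(2) S(2)] by (elim exE conjE) simp
  have "S \<noteq> {}" using S(2) by (auto simp: circuit_def indep_cols_def)
  moreover have "sparse_event V S ({} - S) (card S - card ({} - S)) E"
    using w S(3) SV V by (intro sparse_eventI[OF W, where w = w]) auto
  moreover obtain R where R: "R \<subseteq> V" "card R \<le> card S"
    "\<forall>v. nullvec (wmat W E) R S v \<longrightarrow> nullvec (wmat W E) V S v"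
    using row_basis[OF SV(2), of V "wmat W E"] by blast
  moreover have "rigid_event W V S R {} E"
    using w R(3) unfolding rigid_event_def by (intro exI[of _ w]) simp
  ultimately show ?thesis using S(1) unfolding witness_event_def by auto
qed

text \<open>Take a solution on a set \<open>S\<close> of least size. Minimality forces full support
  and independent columns, since otherwise a coordinate could be removed. A vector annihilated by
  all rows except \<open>j\<close> differs from a multiple of \<open>w\<close> by a null vector,
  hence is such a multiple.\<close>

lemma bad_row_witness:
  assumes W: "\<And>i j. i \<noteq> j \<Longrightarrow> W i j \<noteq> 0" and V: "finite V" "j \<in> V" and bad: "bad_row (wmat W E) V j"
  shows "witness_event W V {j} E"
proof -
  let ?A = "wmat W E"
  let ?P = "\<lambda>S. S \<in> small_sets V \<and> (\<exists>w. \<forall>i\<in>V. (\<Sum>s\<in>S. ?A i s * w s) = of_bool (i = j))"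
  have "\<exists>S. ?P S" using bad unfolding bad_row_def by blast
  then have "\<exists>S. ?P S \<and> (\<forall>S'. ?P S' \<longrightarrow> card S \<le> card S')"
    using ex_has_least_nat[of ?P _ card] by blast
  then obtain S w where S: "S \<in> small_sets V"
    and w: "\<And>i. i \<in> V \<Longrightarrow> (\<Sum>s\<in>S. ?A i s * w s) = of_bool (i = j)"
    and min: "\<And>S'. ?P S' \<Longrightarrow> card S \<le> card S'" by auto
  have SV: "S \<subseteq> V" "finite S" using S V finite_subset by (auto simp: small_sets_def)
  have drop: False if s: "s \<in> S" "u s = 0"
    and u: "\<And>i. i \<in> V \<Longrightarrow> (\<Sum>s\<in>S. ?A i s * u s) = of_bool (i = j)" for s u
  proof -
    have lt: "card (S - {s}) < card S" using s SV by (intro card_Diff1_less)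
    have "(\<Sum>t\<in>S - {s}. ?A i t * u t) = of_bool (i = j)" if "i \<in> V" for i
      using u[OF that] s SV by (simp add: sum.remove)
    moreover have "S - {s} \<in> small_sets V" using S lt by (auto simp: small_sets_def)
    ultimately have "?P (S - {s})" by blast
    then have "card S \<le> card (S - {s})" by (rule min)
    with lt show False by simp
  qed
  have wS: "w s \<noteq> 0" if "s \<in> S" for s using drop[OF that _ w] by blast
  have ind: "indep_cols ?A V S"
    unfolding indep_cols_def
  proof (intro allI impI ballI, rule ccontr)
    fix u s assume u: "nullvec ?A V S u" "s \<in> S" "u s \<noteq> 0"
    show False
    proof (rule drop[of s "\<lambda>t. w t - w s / u s * u t"])
      fix i assume i: "i \<in> V"
      have "(\<Sum>t\<in>S. ?A i t * (w t - w s / u s * u t)) =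
          (\<Sum>t\<in>S. ?A i t * w t) - w s / u s * (\<Sum>t\<in>S. ?A i t * u t)"
        by (simp add: sum_subtractf sum_distrib_left algebra_simps)
      then show "(\<Sum>t\<in>S. ?A i t * (w t - w s / u s * u t)) = of_bool (i = j)"
        using u(1) i w by (simp add: nullvec_def)
    qed (use u in auto)
  qed
  have null: "nullvec ?A (V - {j}) S w" using w by (simp add: nullvec_def)
  have uniq: "\<exists>c. \<forall>s\<in>S. v s = c * w s" if v: "nullvec ?A (V - {j}) S v" for v
  proof -
    define c where "c = (\<Sum>s\<in>S. ?A j s * v s)"
    have "nullvec ?A V S (\<lambda>s. v s - c * w s)"
      unfolding nullvec_def
    proof
      fix i assume i: "i \<in> V"
      have "(\<Sum>s\<in>S. ?A i s * (v s - c * w s)) =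
          (\<Sum>s\<in>S. ?A i s * v s) - c * (\<Sum>s\<in>S. ?A i s * w s)"
        by (simp add: sum_subtractf sum_distrib_left algebra_simps)
      then show "(\<Sum>s\<in>S. ?A i s * (v s - c * w s)) = 0"
        using v w[OF i] i by (cases "i = j") (auto simp: nullvec_def c_def)
    qed
    then show ?thesis using ind unfolding indep_cols_def by (intro exI[of _ c]) auto
  qed
  have "card S \<le> card (nb ?A V S)"
    using V SV ind indep_cols_nb[of ?A V S]
    by (intro indep_cols_card_le[of _ _ ?A]) (auto simp: nb_def)
  then have "sparse_event V S ({j} - S) (card S - card ({j} - S)) E"
    using V SV wS null w by (intro sparse_eventI[OF W, where w = w]) auto
  moreover have "S \<noteq> {}" using w[OF V(2)] by auto
  moreover obtain R where R: "R \<subseteq> V - {j}" "card R \<le> card S"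
    "\<forall>v. nullvec ?A R S v \<longrightarrow> nullvec ?A (V - {j}) S v"
    using row_basis[OF SV(2), of "V - {j}" ?A] by blast
  moreover have "rigid_event W V S R {j} E"
    using wS null uniq R(3) unfolding rigid_event_def by (intro exI[of _ w]) simp
  ultimately show ?thesis using S unfolding witness_event_def by auto
qed

section \<open>Counting small sets and summing the first moments\<close>

text \<open>Comparison with a biased random subset of density 1/16: each small set has probability
  at least \<open>(10 / 11) ^ card V\<close>, and the probabilities sum to at most 1.\<close>

lemma card_small_sets_le:
  assumes "finite V"
  shows "real (card (small_sets V)) \<le> (11 / 10) ^ card V"
proof -
  define N where "N = card V"
  have sub: "small_sets V \<subseteq> Pow V" by (auto simp: small_sets_def)
  let ?h = "\<lambda>S. (11 / 10) ^ N * ((1 / 16) ^ card S * (15 / 16) ^ card (V - S))"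
  have key: "(1 :: real) \<le> ?h S"
    if S: "S \<in> small_sets V" for S
  proof -
    define k where "k = card S"
    have k: "k * 100 \<le> N" "card (V - S) = N - k"
      using S assms by (auto simp: small_sets_def N_def k_def intro: finite_subset card_Diff_subset)
    then have kN: "k \<le> N" by simp
    \<comment> \<open>15 is the odds ratio of the density 1/16. The number 103/100 satisfies
      \<open>15 \<le> (103 / 100) ^ 100\<close>, and its product with 16/15 is still below
      11/10.\<close>
    have "(15 :: real) ^ k \<le> ((103 / 100) ^ 100) ^ k"
    proof (intro power_mono)
      have "(134 / 100 :: real) ^ 10 \<le> ((103 / 100) ^ 10) ^ 10"
        by (intro power_mono) (simp_all add: power_numeral_reduce)
      moreover have "(15 :: real) \<le> (134 / 100) ^ 10" by (simp add: power_numeral_reduce)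
      ultimately show "(15 :: real) \<le> (103 / 100) ^ 100" by (simp add: power_mult[symmetric])
    qed simp
    also have "... = (103 / 100) ^ (100 * k)" by (simp add: power_mult)
    also have "... \<le> (103 / 100) ^ N" using k by (intro power_increasing) auto
    finally have 1: "(15 :: real) ^ k \<le> (103 / 100) ^ N" .
    have "(15 :: real) ^ k * (16 / 15) ^ N \<le> (103 / 100) ^ N * (16 / 15) ^ N"
      using 1 by (intro mult_right_mono) auto
    also have "... = (103 / 100 * (16 / 15)) ^ N" by (simp only: power_mult_distrib)
    also have "... \<le> (11 / 10) ^ N" by (intro power_mono) auto
    finally have 2: "(15 :: real) ^ k * (16 / 15) ^ N \<le> (11 / 10) ^ N" .
    have "(15 :: real) ^ k * (16 / 15) ^ N * ((1 / 16) ^ k * (15 / 16) ^ (N - k)) =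
        (15 * (16 / 15) * (1 / 16)) ^ k * (16 / 15 * (15 / 16)) ^ (N - k)"
      unfolding power_mult_distrib using kN
      by (simp add: power_add[symmetric] mult_ac flip: power_add[of _ k "N - k"])
    also have "... = 1" by simp
    finally have "1 = (15 :: real) ^ k * (16 / 15) ^ N * ((1 / 16) ^ k * (15 / 16) ^ (N - k))" ..
    also have "... \<le> (11 / 10) ^ N * ((1 / 16) ^ k * (15 / 16) ^ (N - k))"
      using 2 by (intro mult_right_mono) auto
    finally show ?thesis using k by (simp add: k_def)
  qed
  have "real (card (small_sets V)) = (\<Sum>S\<in>small_sets V. 1)" by simp
  also have "... \<le> (\<Sum>S\<in>small_sets V. ?h S)"
    by (intro sum_mono key)
  also have "... \<le> (\<Sum>S\<in>Pow V. ?h S)"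
    using sub assms by (intro sum_mono2) auto
  also have "... = (11 / 10) ^ N * bern (1 / 16) V (\<lambda>_. 1)"
    by (simp add: bern_def sum_distrib_left)
  finally show ?thesis using assms by (simp add: N_def)
qed

lemma power_le_fact_exp: "real k ^ k \<le> fact k * exp (real k)"
proof -
  have "(\<Sum>n\<in>{k}. real k ^ n /\<^sub>R fact n) \<le> exp (real k)"
    using sum_le_suminf[OF sums_summable[OF exp_converges[of "real k"]], of "{k}"]
      sums_unique[OF exp_converges[of "real k"]] by simp
  then show ?thesis by (simp add: field_simps)
qed

lemma one_minus_ge_exp: "0 \<le> p \<Longrightarrow> p \<le> 1 / 2 \<Longrightarrow> exp (- 2 * p) \<le> 1 - (p :: real)"
proof -
  assume p: "0 \<le> p" "p \<le> 1 / 2"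
  have "- p - 2 * p\<^sup>2 \<le> ln (1 - p)" using p by (intro ln_one_minus_pos_lower_bound) auto
  moreover have "p\<^sup>2 \<le> p / 2" using p mult_left_mono[of p "1 / 2" p] by (simp add: power2_eq_square)
  ultimately have "- 2 * p \<le> ln (1 - p)" by simp
  then have "exp (- 2 * p) \<le> exp (ln (1 - p))" by (simp only: exp_le_cancel_iff)
  then show ?thesis using p by simp
qed

text \<open>The cost per column, with \<open>d\<close> the mean degree; it tends to 0 as
  \<open>d\<close> grows with \<open>K\<close> fixed. The factor \<open>exp 2\<close> comes from
  using \<open>k ^ k \<le> fact k * exp k\<close> twice, \<open>exp (- 2 * K)\<close> bounds
  \<open>(1 - p) ^ (k - 1)\<close> from below, and the 1/2 stands for the half of all rows that is
  exploited.\<close>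

definition sparse_rate :: "real \<Rightarrow> real \<Rightarrow> real" where
  "sparse_rate K d = exp 2 * d\<^sup>2 * exp (- (d * (exp (- 2 * K) / 2)))"

lemma pr_sparse_event_le':
  assumes p: "0 < p" "p \<le> 1 / 2" and V: "finite V" "S \<in> small_sets V" "Z \<subseteq> V - S" "card Z \<le> 1"
    and ne: "S \<noteq> {}" and pK: "p * real (card S) \<le> K" and d: "d = real (card V) * p" "2 \<le> d"
  shows "pr p (sedges V) (sparse_event V S Z (card S - card Z)) \<le>
    sparse_rate K d ^ card S * (fact (card S) / real (card V) ^ card S)"
proof -
  define k N where "k = card S" and "N = card V"
  have SV: "S \<subseteq> V" "finite S" "100 * k \<le> N"
    using V finite_subset by (auto simp: small_sets_def k_def N_def)
  have k: "1 \<le> k" using ne SV by (simp add: k_def Suc_le_eq card_gt_0_iff)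
  have N: "100 \<le> N" using k SV by simp
  have zk: "card Z \<le> k" using V k by linarith
  let ?q = "real k * p * (1 - p) ^ (k - 1)"
  define \<rho> where "\<rho> = 1 - ?q"
  define m where "m = N - 2 * k - 1"
  have m: "real m \<ge> real N / 2" using SV(3) N by (simp add: m_def of_nat_diff)
  define y where "y = real k ^ 2 * d ^ 2 / real N"
  define c where "c = exp (- 2 * K) / 2"
  have pd: "p = d / real N" using d N by (simp add: N_def)
  let ?y = "real k ^ 2 * p + real N * (real k ^ 2 * p ^ 2 / 2)"
  have y: "?y \<le> y"
  proof -
    have "d + d ^ 2 / 2 \<le> d ^ 2" using d(2) mult_right_mono[of 2 d d] unfolding power2_eq_square by linarith
    then have "real k ^ 2 * (d + d ^ 2 / 2) \<le> real k ^ 2 * d ^ 2" by (intro mult_left_mono) auto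
    then have "real k ^ 2 * (d + d ^ 2 / 2) / real N \<le> y"
      unfolding y_def by (intro divide_right_mono) auto
    moreover have "?y = real k ^ 2 * (d + d ^ 2 / 2) / real N"
      using N unfolding pd by (simp add: field_simps power2_eq_square)
    ultimately show ?thesis by simp
  qed
  have y1: "real k ^ 2 * p \<le> y"
    using y p by (smt (verit) divide_nonneg_nonneg mult_nonneg_nonneg of_nat_0_le_iff zero_le_power2)
  have \<rho>0: "0 \<le> \<rho>"
  proof -
    have "0 \<le> pr p S (\<lambda>X. card X \<noteq> 1)" using p by (intro bern_nonneg) auto
    then show ?thesis using pr_card_neq_1[OF SV(2), of p] by (simp add: \<rho>_def k_def)
  qed
  have "pr p (sedges V) (sparse_event V S Z (k - card Z)) \<le>
      (real k * p) ^ card Z * ((real k ^ 2 * p + real (card V) * (real k ^ 2 * p ^ 2 / 2)) ^ (k - card Z) / fact (k - card Z)) * \<rho> ^ m"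
  proof (rule pr_sparse_event_le)
    show "m + k + card Z + (k - card Z) \<le> card V" using SV(3) N zk by (simp add: m_def N_def)
  qed (use p V SV in \<open>auto simp: k_def \<rho>_def\<close>)
  also have "... \<le> (y ^ k / fact k) * \<rho> ^ m"
  proof (intro mult_right_mono)
    let ?x = "real k ^ 2 * p + real (card V) * (real k ^ 2 * p ^ 2 / 2)"
    have x: "0 \<le> ?x" "?x \<le> y" using y p by (auto simp: N_def)
    \<comment> \<open>A row in \<open>Z\<close> lowers the exponent by one and contributes
      \<open>real k * p\<close>. Replacing \<open>fact (k - 1)\<close> by \<open>fact k / k\<close>
      turns this into \<open>real k ^ 2 * p\<close>, which is at most the missing factor
      \<open>y\<close>.\<close>
    show "(real k * p) ^ card Z * (?x ^ (k - card Z) / fact (k - card Z)) \<le> y ^ k / fact k"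
    proof (cases "card Z = 0")
      case True
      then show ?thesis using x by (simp add: divide_right_mono power_mono)
    next
      case False
      with V have z: "card Z = 1" by simp
      have k1: "k = Suc (k - 1)" using k by simp
      have "real k * p * (?x ^ (k - 1) / fact (k - 1)) \<le> real k * p * (y ^ (k - 1) / fact (k - 1))"
        using x p by (intro mult_left_mono divide_right_mono power_mono) auto
      also have "... = real k ^ 2 * p * y ^ (k - 1) / fact k"
        using k by (subst (3) k1) (simp add: power2_eq_square fact_reduce field_simps)
      also have "... \<le> y * y ^ (k - 1) / fact k"
        using y1 x by (intro divide_right_mono mult_right_mono) auto
      also have "... = y ^ k / fact k" using k1 by (metis power_Suc)
      finally show ?thesis using z by simp
    qed
  qed (use \<rho>0 in auto)
  also have "... \<le> (fact k / real N ^ k * (exp 2 * d\<^sup>2) ^ k) * exp (- (d * c)) ^ k"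
  proof (intro mult_mono)
    \<comment> \<open>One of the two factorials cancels the denominator; the other is kept to cancel
      the number of sets of size \<open>k\<close> in the union bound.\<close>
    have "real k ^ k * real k ^ k \<le> (fact k * exp (real k)) * (fact k * exp (real k))"
      by (intro mult_mono power_le_fact_exp) auto
    then have "(real k ^ 2) ^ k / fact k \<le> fact k * (exp (real k) * exp (real k))"
      by (simp add: field_simps power2_eq_square power_mult_distrib)
    also have "exp (real k) * exp (real k) = exp 2 ^ k"
      by (simp add: exp_of_nat_mult[symmetric] exp_add[symmetric])
    finally have "(real k ^ 2) ^ k / fact k * (d\<^sup>2 ^ k / real N ^ k) \<le> fact k * exp 2 ^ k * (d\<^sup>2 ^ k / real N ^ k)"
      by (intro mult_right_mono) auto
    then show "y ^ k / fact k \<le> fact k / real N ^ k * (exp 2 * d\<^sup>2) ^ k"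
      by (simp add: y_def power_mult_distrib power_divide mult_ac)
    have "\<rho> ^ m \<le> exp (- (?q)) ^ m"
      using \<rho>0 exp_ge_add_one_self[of "- (?q)"]
      by (intro power_mono) (auto simp: \<rho>_def)
    also have "... = exp (- (real m * (?q)))"
      by (simp add: exp_of_nat_mult[symmetric])
    also have "... \<le> exp (- (real k * (d * c)))"
    proof -
      have "exp (- 2 * K) \<le> exp (- 2 * p) ^ k"
        using pK by (simp add: exp_of_nat_mult[symmetric] k_def mult_ac)
      also have "... \<le> exp (- 2 * p) ^ (k - 1)"
        using p by (intro power_decreasing) auto
      also have "... \<le> (1 - p) ^ (k - 1)"
        using p one_minus_ge_exp[of p] by (intro power_mono) auto
      finally have e: "exp (- 2 * K) \<le> (1 - p) ^ (k - 1)" .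
      have "real k * (d * c) = real N / 2 * (real k * p * exp (- 2 * K))"
        using d by (simp add: c_def N_def)
      also have "... \<le> real m * (?q)"
        using m p e by (intro mult_mono) auto
      finally show ?thesis by simp
    qed
    also have "... = exp (- (d * c)) ^ k" by (simp add: exp_of_nat_mult[symmetric])
    finally show "\<rho> ^ m \<le> exp (- (d * c)) ^ k" .
  qed (use \<rho>0 in auto)
  also have "... = sparse_rate K d ^ k * (fact k / real N ^ k)"
    by (simp add: sparse_rate_def c_def power_mult_distrib mult_ac)
  finally show ?thesis by (simp add: k_def N_def)
qed

text \<open>Split at \<open>p * card S = K\<close>. Below, sparse events are summed over
  \<open>S\<close> by size: the number of \<open>k\<close>-sets, at most
  \<open>N ^ k / fact k\<close>, cancels the second factor and leaves a geometric series in the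
  rate. Above, rigid events are summed over the pairs of small sets \<open>(S, R)\<close>.\<close>

lemma pr_witness_event_small:
  assumes "0 < \<epsilon>"
  obtains D where "D > 0"
    "\<And>p V Z (W :: 'a cmatrix). \<lbrakk>0 < p; p \<le> 1 / 2; finite V; Z \<subseteq> V; card Z \<le> 1;
      \<And>i j. i \<noteq> j \<Longrightarrow> W i j \<noteq> 0; D \<le> p * real (card V)\<rbrakk>
      \<Longrightarrow> pr p (sedges V) (witness_event W V Z) \<le> \<epsilon>"
proof -
  \<comment> \<open>The value 1/4 makes \<open>m \<ge> N / 2\<close> orthogonal rows cost at most
    \<open>(1 / 2) ^ N\<close>, which beats the \<open>(121 / 100) ^ N\<close> pairs of
    sets.\<close>
  obtain K where K: "K > 0"
    "\<And>p I J (v :: 'a \<Rightarrow> complex) a. \<lbrakk>0 < p; p \<le> 1 / 2; finite I; J \<subseteq> I;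
      \<And>e. e \<in> J \<Longrightarrow> v e \<noteq> 0; K \<le> p * real (card J)\<rbrakk>
      \<Longrightarrow> pr p I (\<lambda>E. sum v E = a) \<le> 1 / 4"
    by (rule pr_sum_eq_small[of "1 / 4"]) auto
  define c where "c = exp (- 2 * K) / 2"
  have c: "c > 0" by (simp add: c_def)
  have "((\<lambda>d. exp 2 * d\<^sup>2 * exp (- (d * c))) \<longlongrightarrow> 0) at_top"
    using c by real_asymp
  then have "(sparse_rate K \<longlongrightarrow> 0) at_top" by (simp add: sparse_rate_def[abs_def] c_def)
  then have "eventually (\<lambda>d. sparse_rate K d < min (1 / 2) (\<epsilon> / 4)) at_top"
    using assms by (intro order_tendstoD) auto
  then obtain D1 where D1: "\<And>d. d \<ge> D1 \<Longrightarrow> sparse_rate K d < min (1 / 2) (\<epsilon> / 4)"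
    by (auto simp: eventually_at_top_linorder)
  have "(\<lambda>N. (7 / 10 :: real) ^ N) \<longlonglongrightarrow> 0" by (intro LIMSEQ_power_zero) auto
  then have "eventually (\<lambda>N. (7 / 10 :: real) ^ N < \<epsilon> / 2) sequentially"
    using assms by (intro order_tendstoD) auto
  then obtain N0 where N0: "\<And>N. N \<ge> N0 \<Longrightarrow> (7 / 10 :: real) ^ N < \<epsilon> / 2"
    by (auto simp: eventually_at_top_linorder)
  \<comment> \<open>The mean degree never exceeds the number of vertices, so a bound by
    \<open>N0\<close> on the former also makes the latter large.\<close>
  define D where "D = max 2 (max D1 (real N0))"
  have "pr p (sedges V) (witness_event W V Z) \<le> \<epsilon>"
    if p: "0 < p" "p \<le> 1 / 2" and V: "finite V" "Z \<subseteq> V" "card Z \<le> 1"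
      and W: "\<And>i j. i \<noteq> j \<Longrightarrow> W i j \<noteq> 0" and pD: "D \<le> p * real (card V)"
    for p V Z and W :: "'a cmatrix"
  proof -
    define N d where "N = card V" and "d = real N * p"
    have p': "0 \<le> p" "p \<le> 1" using p by auto
    have d: "d \<ge> 2" "d \<ge> D1" "d \<ge> real N0" using pD by (auto simp: D_def d_def N_def mult.commute)
    have "d \<le> real N" using p by (simp add: d_def mult_left_le)
    with d have N: "N \<ge> N0" "N \<ge> 2" by linarith+
    define \<theta> where "\<theta> = sparse_rate K d"
    have \<theta>: "0 \<le> \<theta>" "\<theta> \<le> 1 / 2" "\<theta> \<le> \<epsilon> / 4"
      using D1[OF d(2)] by (auto simp: \<theta>_def sparse_rate_def)
    define X where "X = {S \<in> small_sets V - {{}}. p * real (card S) \<le> K}"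
    define Y where "Y = {(S, R). S \<in> small_sets V - {{}} \<and> R \<in> small_sets V \<and>
        K \<le> p * real (card S) \<and> R \<subseteq> V - Z \<and> card R \<le> card S}"
    have fs: "finite (small_sets V)" using V by (auto simp: small_sets_def)
    have fX: "finite X" and fY: "finite Y"
    proof -
      show "finite X" using fs by (simp add: X_def)
      have "Y \<subseteq> small_sets V \<times> small_sets V" by (auto simp: Y_def)
      then show "finite Y" by (rule finite_subset) (use fs in auto)
    qed
    let ?F = "\<lambda>S. sparse_event V S (Z - S) (card S - card (Z - S))"
    let ?G = "\<lambda>q. rigid_event W V (fst q) (snd q) Z"
    let ?h = "\<lambda>S. \<theta> ^ card S * (fact (card S) / real N ^ card S)"
    let ?EX = "\<lambda>E. \<exists>S\<in>X. ?F S E"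
    let ?EY = "\<lambda>E. \<exists>q\<in>Y. ?G q E"
    have "pr p (sedges V) (witness_event W V Z) \<le>
        pr p (sedges V) (\<lambda>E. (\<exists>S\<in>X. ?F S E) \<or> (\<exists>q\<in>Y. ?G q E))"
    proof (rule pr_mono[OF p'])
      fix E assume "witness_event W V Z E"
      then obtain S R where S: "S \<in> small_sets V - {{}}" "?F S E" "R \<subseteq> V - Z" "card R \<le> card S"
        "rigid_event W V S R Z E" unfolding witness_event_def by blast
      show "(\<exists>S\<in>X. ?F S E) \<or> (\<exists>q\<in>Y. ?G q E)"
      proof (cases "p * real (card S) \<le> K")
        case True
        with S show ?thesis by (auto simp: X_def)
      next
        case False
        have "(S, R) \<in> Y" using False S by (auto simp: Y_def small_sets_def)
        with S(5) show ?thesis by force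
      qed
    qed
    also have "... \<le> pr p (sedges V) ?EX + pr p (sedges V) ?EY"
      by (rule pr_disj_le[OF p'])
    also have "pr p (sedges V) ?EX \<le> \<epsilon> / 2"
    proof -
      have "pr p (sedges V) ?EX \<le> (\<Sum>S\<in>X. pr p (sedges V) (?F S))"
        by (rule pr_Bex_le[OF p' fX])
      also have "... \<le> (\<Sum>S\<in>X. ?h S)"
      proof (intro sum_mono)
        fix S assume S: "S \<in> X"
        have "finite Z" using V finite_subset by auto
        then have "card (Z - S) \<le> 1" using V(3) card_mono[of Z "Z - S"] by simp
        then show "pr p (sedges V) (?F S) \<le> ?h S"
          unfolding \<theta>_def N_def using S p V d
          by (intro pr_sparse_event_le') (auto simp: X_def d_def N_def)
      qed
      also have "... \<le> (\<Sum>S\<in>Pow V - {{}}. ?h S)"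
        using V \<theta> by (intro sum_mono2) (auto simp: X_def small_sets_def)
      also have "... = (\<Sum>k\<in>{1..N}. \<Sum>S | S \<in> Pow V - {{}} \<and> card S = k. ?h S)"
      proof (rule sum.group[symmetric])
        show "card ` (Pow V - {{}}) \<subseteq> {1..N}"
        proof
          fix x assume "x \<in> card ` (Pow V - {{}})"
          then obtain S where S: "S \<subseteq> V" "S \<noteq> {}" "x = card S" by auto
          moreover have "finite S" using S V finite_subset by auto
          ultimately show "x \<in> {1..N}" using V
            by (auto simp: N_def Suc_le_eq card_gt_0_iff intro: card_mono)
        qed
      qed (use V in auto)
      also have "... \<le> (\<Sum>k\<in>{1..N}. \<theta> ^ k)"
      proof (intro sum_mono)
        fix k assume k: "k \<in> {1..N}"
        then have eq: "{S. S \<in> Pow V - {{}} \<and> card S = k} = {S. S \<subseteq> V \<and> card S = k}" by auto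
        have "(\<Sum>S | S \<in> Pow V - {{}} \<and> card S = k. ?h S) =
            real (N choose k) * (\<theta> ^ k * (fact k / real N ^ k))"
          unfolding eq using V by (simp add: n_subsets N_def)
        also have "... \<le> real N ^ k / fact k * (\<theta> ^ k * (fact k / real N ^ k))"
          using \<theta> by (intro mult_right_mono choose_le_pow_fact) auto
        also have "... = \<theta> ^ k" using N by simp
        finally show "(\<Sum>S | S \<in> Pow V - {{}} \<and> card S = k. ?h S) \<le> \<theta> ^ k" .
      qed
      also have "... = \<theta> * (\<Sum>k<N. \<theta> ^ k)"
        unfolding sum_distrib_left
        by (rule sum.reindex_bij_witness[of _ Suc "\<lambda>k. k - 1"]) (auto simp: power_eq_if)
      also have "... \<le> \<theta> * 2"
      proof (intro mult_left_mono \<theta>)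
        have "(\<Sum>k<N. \<theta> ^ k) \<le> (\<Sum>k<N. (1 / 2) ^ k)" using \<theta> by (intro sum_mono power_mono) auto
        also have "... = 2 - 2 * (1 / 2) ^ N" by (subst sum_gp_strict) (simp add: field_simps)
        also have "... \<le> 2" by simp
        finally show "(\<Sum>k<N. \<theta> ^ k) \<le> 2" .
      qed
      also have "... \<le> \<epsilon> / 2" using \<theta> by simp
      finally show ?thesis .
    qed
    also have "pr p (sedges V) ?EY \<le> \<epsilon> / 2"
    proof -
      have "pr p (sedges V) ?EY \<le> (\<Sum>q\<in>Y. pr p (sedges V) (?G q))"
        by (rule pr_Bex_le[OF p' fY])
      also have "... \<le> (\<Sum>q\<in>Y. (1 / 2) ^ N)"
      proof (intro sum_mono)
        fix q assume "q \<in> Y"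
        then obtain S R where q: "q = (S, R)" "S \<subseteq> V" "S \<noteq> {}" "100 * card S \<le> N"
          "K \<le> p * real (card S)" "R \<subseteq> V - Z" "card R \<le> card S"
          by (auto simp: Y_def small_sets_def N_def)
        have fin: "finite S" "finite Z" using q V by (blast intro: finite_subset)+
        then have S1: "card S \<ge> 1" using q by (simp add: Suc_le_eq card_gt_0_iff)
        define m where "m = N - 2 * card S - 1"
        have m: "2 * m \<ge> N" "m + card S + card R + card Z \<le> N"
          using q S1 V by (auto simp: m_def)
        have "pr p (sedges V) (?G q) \<le> (1 / 4) ^ m"
          unfolding q(1) fst_conv snd_conv
        proof (rule pr_rigid_event_le[OF p' W V(1) q(2) q(6)])
          show "pr p S (\<lambda>X. sum v X = 0) \<le> 1 / 4" if "\<And>s. s \<in> S \<Longrightarrow> v s \<noteq> 0" for v :: "'a \<Rightarrow> complex"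
            by (rule K(2)[OF p fin(1) subset_refl _ q(5)]) (rule that)
        qed (use m fin in \<open>auto simp: N_def\<close>)
        also have "(1 / 4 :: real) ^ m = (1 / 2) ^ (2 * m)" by (simp add: power_mult power2_eq_square)
        also have "... \<le> (1 / 2) ^ N" using m by (intro power_decreasing) auto
        finally show "pr p (sedges V) (?G q) \<le> (1 / 2) ^ N" .
      qed
      also have "... = real (card Y) * (1 / 2) ^ N" by simp
      also have "... \<le> ((11 / 10) ^ N * (11 / 10) ^ N) * (1 / 2) ^ N"
      proof (intro mult_right_mono)
        have "card Y \<le> card (small_sets V \<times> small_sets V)"
          using fs by (intro card_mono) (auto simp: Y_def)
        then have "real (card Y) \<le> real (card (small_sets V)) * real (card (small_sets V))"
          by (simp add: card_cartesian_product flip: of_nat_mult)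
        also have "... \<le> (11 / 10) ^ N * (11 / 10) ^ N"
          unfolding N_def by (intro mult_mono card_small_sets_le V) auto
        finally show "real (card Y) \<le> (11 / 10) ^ N * (11 / 10) ^ N" .
      qed auto
      also have "... = (121 / 200) ^ N" by (simp add: power_mult_distrib[symmetric])
      also have "... \<le> (7 / 10) ^ N" by (intro power_mono) auto
      also have "... \<le> \<epsilon> / 2" using N0[OF N(1)] by simp
      finally show ?thesis .
    qed
    finally show ?thesis by simp
  qed
  moreover have "D > 0" by (simp add: D_def)
  ultimately show ?thesis using that by blast
qed

subsection \<open>Exposing one vertex\<close>

text \<open>Null vectors are added one at a time with a coefficient that avoids the finitely many
  values cancelling some coordinate; the field is infinite.\<close>

lemma full_support_nullvec:
  fixes A :: "'r \<Rightarrow> 's \<Rightarrow> 'c::field_char_0"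
  assumes "finite V"
  shows "\<exists>w. nullvec A R V w \<and> (\<forall>j\<in>ksupp A R V. w j \<noteq> 0)"
proof -
  have "\<exists>w. nullvec A R V w \<and> (\<forall>j\<in>X. w j \<noteq> 0)" if "finite X" "X \<subseteq> ksupp A R V" for X
    using that
  proof (induction X rule: finite_induct)
    case empty
    show ?case by (intro exI[of _ "\<lambda>_. 0"]) (simp add: nullvec_def)
  next
    case (insert j X)
    then obtain w where w: "nullvec A R V w" "\<forall>x\<in>X. w x \<noteq> 0" by auto
    obtain u where u: "nullvec A R V u" "u j \<noteq> 0" using insert.prems by (auto simp: ksupp_def)
    obtain c where c: "c \<notin> (\<lambda>x. - w x / u x) ` insert j X"
      using ex_new_if_finite[OF infinite_UNIV_char_0, of "(\<lambda>x. - w x / u x) ` insert j X"] insert.hyps by auto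
    have "1 * w x + c * u x \<noteq> 0" if x: "x \<in> insert j X" for x
    proof
      assume eq: "1 * w x + c * u x = 0"
      show False
      proof (cases "u x = 0")
        case True
        with eq x u w show False by auto
      next
        case False
        with eq have "c = - w x / u x" by (simp add: field_simps add_eq_0_iff)
        with c x show False by blast
      qed
    qed
    moreover have "nullvec A R V (\<lambda>x. 1 * w x + c * u x)" by (rule nullvec_combine[OF w(1) u(1)])
    ultimately show ?case by blast
  qed
  moreover have "finite (ksupp A R V)" using assms by (simp add: ksupp_def)
  ultimately show ?thesis by blast
qed

text \<open>By symmetry the obstruction in the Fredholm alternative is itself a null vector, here
  one that is nonzero at \<open>j\<close>.\<close>

lemma solvable_outside_ksupp:
  fixes A :: "'a \<Rightarrow> 'a \<Rightarrow> 'c::field"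
  assumes "finite V" "\<And>i j. A i j = A j i" "j \<in> V - ksupp A V V"
  shows "\<exists>w. \<forall>i\<in>V. (\<Sum>s\<in>V. A i s * w s) = of_bool (i = j)"
proof (rule ccontr)
  assume "\<not> ?thesis"
  then obtain y where y: "\<forall>s\<in>V. (\<Sum>i\<in>V. y i * A i s) = 0" "(\<Sum>i\<in>V. y i * of_bool (i = j)) \<noteq> 0"
    using fredholm_alternative[OF assms(1,1), of A "\<lambda>i. of_bool (i = j)"] by blast
  have "nullvec A V V y"
    unfolding nullvec_def
  proof
    fix s assume "s \<in> V"
    then have "(\<Sum>i\<in>V. y i * A i s) = 0" using y by blast
    then show "(\<Sum>i\<in>V. A s i * y i) = 0" by (simp add: assms(2)[of s] mult.commute)
  qed
  moreover have "(\<Sum>i\<in>V. y i * of_bool (i = j)) = y j"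
    using assms by (simp add: of_bool_def if_distrib cong: if_cong)
  ultimately show False using y(2) assms(3) by (auto simp: ksupp_def)
qed

lemma sum_symmetric_swap:
  fixes A :: "'a \<Rightarrow> 'a \<Rightarrow> 'c::comm_ring"
  assumes "\<And>i j. A i j = A j i"
  shows "(\<Sum>l\<in>V. y l * (\<Sum>j\<in>V. A l j * u j)) = (\<Sum>l\<in>V. u l * (\<Sum>j\<in>V. A l j * y j))"
  unfolding sum_distrib_left
proof (subst sum.swap, intro sum.cong refl)
  fix i j
  show "y j * (A j i * u i) = u i * (A i j * y j)" using assms[of i j] by (simp add: mult_ac)
qed

text \<open>The condition under which a bordered matrix has a null vector that is nonzero at the new
  coordinate: \<open>X\<close> is the set of neighbours of the new vertex, \<open>c\<close> holds
  the weights of its edges and \<open>a\<close> is its diagonal entry.\<close>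

definition star_event :: "'a cmatrix \<Rightarrow> 'a set \<Rightarrow> ('a \<Rightarrow> complex) \<Rightarrow> complex \<Rightarrow> 'a set \<Rightarrow> bool" where
  "star_event A V c a X \<longleftrightarrow> (\<exists>u. (\<forall>l\<in>V. (\<Sum>j\<in>V. A l j * u j) = (if l \<in> X then c l else 0)) \<and>
     (\<Sum>l\<in>V. (if l \<in> X then c l else 0) * u l) = a)"

lemma sum_indicator_subset:
  fixes f g :: "'a \<Rightarrow> complex"
  assumes "finite V" "X \<subseteq> V"
  shows "(\<Sum>l\<in>V. f l * (if l \<in> X then g l else 0)) = (\<Sum>l\<in>X. f l * g l)"
  using assms by (intro sum.mono_neutral_cong_right) auto

text \<open>The new column lies in the column space of a symmetric matrix and is therefore
  orthogonal to its kernel.\<close>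

lemma star_event_orthogonal:
  assumes "finite V" "\<And>i j. A i j = A j i" "nullvec A V V y" "star_event A V c a X" "X \<subseteq> V"
  shows "(\<Sum>l\<in>X. y l * c l) = 0"
proof -
  obtain u where u: "\<And>l. l \<in> V \<Longrightarrow> (\<Sum>j\<in>V. A l j * u j) = (if l \<in> X then c l else 0)"
    using assms(4) unfolding star_event_def by blast
  have "(\<Sum>l\<in>X. y l * c l) = (\<Sum>l\<in>V. y l * (if l \<in> X then c l else 0))"
    using assms by (simp add: sum_indicator_subset)
  also have "... = (\<Sum>l\<in>V. y l * (\<Sum>j\<in>V. A l j * u j))" using u by (intro sum.cong) auto
  also have "... = (\<Sum>l\<in>V. u l * (\<Sum>j\<in>V. A l j * y j))" by (rule sum_symmetric_swap[OF assms(2)])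
  also have "... = 0" using assms(3) by (simp add: nullvec_def)
  finally show ?thesis .
qed

text \<open>
  Two solutions with right-hand sides \<open>x\<close>, \<open>x'\<close> agreeing outside \<open>U\<close> satisfy
  \<open>(x - x') \<bullet> (u + u') = x \<bullet> u - x' \<bullet> u' + x \<bullet> u' - x' \<bullet> u = 0\<close> since \<open>A\<close> is symmetric; rewriting
  \<open>x - x'\<close> as \<open>A \<omega>\<close> turns the quadratic condition into the linear condition \<open>\<omega> \<bullet> (x + x') = 0\<close>.
\<close>

lemma star_event_decouple:
  assumes V: "finite V" "U \<subseteq> V" and sym: "\<And>i j. A i j = A j i"
    and w: "\<And>j i. j \<in> U \<Longrightarrow> i \<in> V \<Longrightarrow> (\<Sum>s\<in>V. A i s * w j s) = of_bool (i = j)"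
    and sub: "X \<subseteq> V - U" "Y \<subseteq> U" "Y' \<subseteq> U"
    and ev: "star_event A V c a (X \<union> Y)" "star_event A V c a (X \<union> Y')"
    and \<omega>: "\<omega> = (\<lambda>i. (\<Sum>j\<in>Y. c j * w j i) - (\<Sum>j\<in>Y'. c j * w j i))"
  shows "(\<Sum>i\<in>X. 2 * (\<omega> i * c i)) = - ((\<Sum>i\<in>Y. \<omega> i * c i) + (\<Sum>i\<in>Y'. \<omega> i * c i))"
proof -
  have fin: "finite X" "finite Y" "finite Y'" using V sub by (meson finite_Diff finite_subset)+
  define x where "x = (\<lambda>l. if l \<in> X \<union> Y then c l else 0)"
  define x' where "x' = (\<lambda>l. if l \<in> X \<union> Y' then c l else 0)"
  obtain u where u: "\<And>l. l \<in> V \<Longrightarrow> (\<Sum>j\<in>V. A l j * u j) = x l" "(\<Sum>l\<in>V. x l * u l) = a"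
    using ev(1) unfolding star_event_def x_def by blast
  obtain u' where u': "\<And>l. l \<in> V \<Longrightarrow> (\<Sum>j\<in>V. A l j * u' j) = x' l" "(\<Sum>l\<in>V. x' l * u' l) = a"
    using ev(2) unfolding star_event_def x'_def by blast
  have cross: "(\<Sum>l\<in>V. u' l * x l) = (\<Sum>l\<in>V. u l * x' l)"
  proof -
    have "(\<Sum>l\<in>V. u' l * x l) = (\<Sum>l\<in>V. u' l * (\<Sum>j\<in>V. A l j * u j))" using u by simp
    also have "... = (\<Sum>l\<in>V. u l * (\<Sum>j\<in>V. A l j * u' j))" by (rule sum_symmetric_swap[OF sym])
    finally show ?thesis using u' by simp
  qed
  have A\<omega>: "(\<Sum>s\<in>V. A i s * \<omega> s) = x i - x' i" if i: "i \<in> V" for i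
  proof -
    have part: "(\<Sum>s\<in>V. A i s * (\<Sum>j\<in>B. c j * w j s)) = (if i \<in> B then c i else 0)" if B: "B \<subseteq> U" "finite B" for B
    proof -
      have "(\<Sum>s\<in>V. A i s * (\<Sum>j\<in>B. c j * w j s)) = (\<Sum>j\<in>B. c j * (\<Sum>s\<in>V. A i s * w j s))"
        unfolding sum_distrib_left by (subst sum.swap) (simp add: mult_ac)
      also have "... = (\<Sum>j\<in>B. if j = i then c i else 0)"
        using w i B by (intro sum.cong) auto
      finally show ?thesis using B by simp
    qed
    have "(\<Sum>s\<in>V. A i s * \<omega> s) = (\<Sum>s\<in>V. A i s * (\<Sum>j\<in>Y. c j * w j s)) - (\<Sum>s\<in>V. A i s * (\<Sum>j\<in>Y'. c j * w j s))"
      unfolding \<omega> by (simp add: sum_subtractf algebra_simps)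
    then show ?thesis using sub fin unfolding part[OF sub(2) fin(2)] part[OF sub(3) fin(3)]
      by (auto simp: x_def x'_def)
  qed
  have "0 = (\<Sum>l\<in>V. x l * u l) - (\<Sum>l\<in>V. x' l * u' l) + (\<Sum>l\<in>V. u' l * x l) - (\<Sum>l\<in>V. u l * x' l)"
    using cross u u' by simp
  also have "... = (\<Sum>l\<in>V. (u l + u' l) * (x l - x' l))"
    by (simp add: sum.distrib sum_subtractf algebra_simps)
  also have "... = (\<Sum>l\<in>V. (u l + u' l) * (\<Sum>s\<in>V. A l s * \<omega> s))" using A\<omega> by simp
  also have "... = (\<Sum>l\<in>V. \<omega> l * (\<Sum>s\<in>V. A l s * (u s + u' s)))" by (rule sum_symmetric_swap[OF sym])
  also have "... = (\<Sum>l\<in>V. \<omega> l * (x l + x' l))"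
    using u u' by (intro sum.cong refl) (simp add: algebra_simps sum.distrib)
  also have "... = (\<Sum>l\<in>V. \<omega> l * x l) + (\<Sum>l\<in>V. \<omega> l * x' l)"
    by (simp add: algebra_simps sum.distrib)
  also have "(\<Sum>l\<in>V. \<omega> l * x l) = (\<Sum>l\<in>X \<union> Y. \<omega> l * c l)"
    unfolding x_def using V sub by (intro sum_indicator_subset) auto
  also have "(\<Sum>l\<in>V. \<omega> l * x' l) = (\<Sum>l\<in>X \<union> Y'. \<omega> l * c l)"
    unfolding x'_def using V sub by (intro sum_indicator_subset) auto
  also have "(\<Sum>l\<in>X \<union> Y. \<omega> l * c l) = (\<Sum>l\<in>X. \<omega> l * c l) + (\<Sum>l\<in>Y. \<omega> l * c l)"
    using fin sub by (intro sum.union_disjoint) auto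
  also have "(\<Sum>l\<in>X \<union> Y'. \<omega> l * c l) = (\<Sum>l\<in>X. \<omega> l * c l) + (\<Sum>l\<in>Y'. \<omega> l * c l)"
    using fin sub by (intro sum.union_disjoint) auto
  finally have eq: "2 * (\<Sum>i\<in>X. \<omega> i * c i) + ((\<Sum>i\<in>Y. \<omega> i * c i) + (\<Sum>i\<in>Y'. \<omega> i * c i)) = 0"
    by (simp add: algebra_simps)
  show ?thesis using eq unfolding sum_distrib_left[symmetric] eq_neg_iff_add_eq_0 .
qed

text \<open>Cauchy-Schwarz decoupling: squaring the conditional probability given \<open>X\<close>
  yields two independent copies \<open>Y\<close>, \<open>Y'\<close> of the other coordinates with
  the same \<open>X\<close>.\<close>

lemma pr_square_le:
  assumes p: "0 \<le> p" "p \<le> 1" and fin: "finite V" "U \<subseteq> V"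
  shows "(pr p V P)\<^sup>2 \<le> bern p U (\<lambda>Y. bern p U (\<lambda>Y'. pr p (V - U) (\<lambda>X. P (X \<union> Y) \<and> P (X \<union> Y'))))"
proof -
  have f: "finite (V - U)" "finite U" using fin by (auto intro: finite_subset)
  have "pr p V P = pr p ((V - U) \<union> U) P" using fin by (simp add: Un_absorb2)
  also have "... = bern p (V - U) (\<lambda>X. pr p U (\<lambda>Y. P (X \<union> Y)))"
    using f by (intro bern_Un) auto
  finally have "(pr p V P)\<^sup>2 = (bern p (V - U) (\<lambda>X. pr p U (\<lambda>Y. P (X \<union> Y))))\<^sup>2" by simp
  also have "... \<le> bern p (V - U) (\<lambda>X. (pr p U (\<lambda>Y. P (X \<union> Y)))\<^sup>2)"
    using f p by (intro bern_square) auto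
  also have "... = bern p (V - U) (\<lambda>X. bern p U (\<lambda>Y. bern p U (\<lambda>Y'. of_bool (P (X \<union> Y) \<and> P (X \<union> Y')))))"
    by (simp only: power2_eq_square bern_cmult[symmetric] of_bool_conj mult.commute[of "pr p U _"])
  also have "... = bern p U (\<lambda>Y. bern p (V - U) (\<lambda>X. bern p U (\<lambda>Y'. of_bool (P (X \<union> Y) \<and> P (X \<union> Y')))))"
    by (rule bern_swap)
  also have "... = bern p U (\<lambda>Y. bern p U (\<lambda>Y'. pr p (V - U) (\<lambda>X. P (X \<union> Y) \<and> P (X \<union> Y'))))"
    by (subst bern_swap) simp
  finally show ?thesis .
qed

text \<open>Each coordinate of \<open>\<omega>\<close> in \<open>I\<close> vanishes with probability
  at most \<open>\<epsilon>\<close>, by anti-concentration in \<open>Y'\<close>. If at least half of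
  them vanish, the trivial bound 1 is paid for by \<open>2 / card I\<close> times their number, of
  expectation at most \<open>2 * \<epsilon>\<close>. Otherwise anti-concentration in
  \<open>X\<close> on the remaining half gives another \<open>\<epsilon>\<close>.\<close>

lemma pr_star_event_decoupled:
  fixes A :: "'a cmatrix"
  assumes p: "0 < p" "p \<le> 1 / 2"
    and V: "finite V" "U \<subseteq> V" and sym: "\<And>i j. A i j = A j i"
    and c: "\<And>j. j \<in> V \<Longrightarrow> c j \<noteq> 0"
    and w: "\<And>j i. j \<in> U \<Longrightarrow> i \<in> V \<Longrightarrow> (\<Sum>s\<in>V. A i s * w j s) = of_bool (i = j)"
    and lo: "\<And>I J (v :: 'a \<Rightarrow> complex) a. \<lbrakk>finite I; J \<subseteq> I;
      \<And>e. e \<in> J \<Longrightarrow> v e \<noteq> 0; K \<le> p * real (card J)\<rbrakk>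
      \<Longrightarrow> pr p I (\<lambda>E. sum v E = a) \<le> \<epsilon>"
    and I: "I \<subseteq> V - U" "0 < K" "2 * K \<le> p * real (card I)"
    and r: "\<And>i. i \<in> I \<Longrightarrow> K \<le> p * real (card {j \<in> U. w j i \<noteq> 0})"
  shows "(pr p V (star_event A V c a))\<^sup>2 \<le> 3 * \<epsilon>"
proof -
  have p': "0 \<le> p" "p \<le> 1" using p by auto
  have fin: "finite U" "finite (V - U)" "finite I" using V I by (auto intro: finite_subset)
  have I0: "0 < real (card I)"
  proof -
    have "card I \<noteq> 0" using I by (intro notI) auto
    then show ?thesis by simp
  qed
  define \<omega> where "\<omega> = (\<lambda>Y Y' i. (\<Sum>j\<in>Y. c j * w j i) - (\<Sum>j\<in>Y'. c j * w j i))"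
  define zs where "zs = (\<lambda>Y Y'. {i \<in> I. \<omega> Y Y' i = 0})"
  have fz: "finite (zs Y Y')" for Y Y' using fin by (simp add: zs_def)
  have \<epsilon>0: "0 \<le> \<epsilon>"
  proof -
    have "0 \<le> pr p I (\<lambda>E. sum (\<lambda>_. 1 :: complex) E = 0)" using p' by (intro bern_nonneg) auto
    also have "... \<le> \<epsilon>" using fin I by (intro lo[of I I]) auto
    finally show ?thesis .
  qed
  let ?pr = "\<lambda>Y Y'. pr p (V - U) (\<lambda>X. star_event A V c a (X \<union> Y) \<and> star_event A V c a (X \<union> Y'))"
  have inner: "?pr Y Y'
      \<le> \<epsilon> + 2 / real (card I) * real (card (zs Y Y'))" if Y: "Y \<subseteq> U" "Y' \<subseteq> U" for Y Y'
  proof (cases "2 * card (zs Y Y') \<ge> card I")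
    case True
    then have "1 \<le> 2 / real (card I) * real (card (zs Y Y'))" using I0 by (simp add: field_simps)
    moreover have "?pr Y Y' \<le> 1"
      using fin p' by (intro pr_le_1) auto
    ultimately show ?thesis using \<epsilon>0 by linarith
  next
    case False
    let ?J = "I - zs Y Y'"
    let ?b = "- ((\<Sum>i\<in>Y. \<omega> Y Y' i * c i) + (\<Sum>i\<in>Y'. \<omega> Y Y' i * c i))"
    have "card ?J = card I - card (zs Y Y')"
      using fz by (intro card_Diff_subset) (auto simp: zs_def)
    then have "real (card I) \<le> 2 * real (card ?J)" using False by linarith
    then have "p * real (card I) \<le> p * (2 * real (card ?J))" using p by (intro mult_left_mono) auto
    then have KJ: "K \<le> p * real (card ?J)" using I by linarith
    have "?pr Y Y' \<le>
        pr p (V - U) (\<lambda>X. sum (\<lambda>i. 2 * (\<omega> Y Y' i * c i)) X = ?b)"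
    proof (rule pr_mono[OF p'])
      fix X assume "X \<subseteq> V - U" "star_event A V c a (X \<union> Y) \<and> star_event A V c a (X \<union> Y')"
      then show "sum (\<lambda>i. 2 * (\<omega> Y Y' i * c i)) X = ?b"
        by (intro star_event_decouple[where w = w, OF V sym w _ Y]) (auto simp: \<omega>_def)
    qed
    also have "... \<le> \<epsilon>"
    proof (rule lo[OF fin(2) _ _ KJ])
      show "2 * (\<omega> Y Y' i * c i) \<noteq> 0" if "i \<in> ?J" for i
        using that I c[of i] by (auto simp: zs_def)
    qed (use I in auto)
    finally show ?thesis by (simp add: add_increasing2)
  qed
  have zero: "pr p U (\<lambda>Y'. \<omega> Y Y' i = 0) \<le> \<epsilon>" if i: "i \<in> I" for Y i
  proof -
    have "pr p U (\<lambda>Y'. \<omega> Y Y' i = 0) = pr p U (\<lambda>Y'. sum (\<lambda>j. c j * w j i) Y' = (\<Sum>j\<in>Y. c j * w j i))"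
      by (intro bern_cong) (auto simp: \<omega>_def)
    also have "... \<le> \<epsilon>"
      using r[OF i] c V by (intro lo[OF fin(1), of "{j \<in> U. w j i \<noteq> 0}"]) auto
    finally show ?thesis .
  qed
  have zsum: "real (card (zs Y Y')) = (\<Sum>i\<in>I. of_bool (\<omega> Y Y' i = 0))" for Y Y'
    using fin by (simp add: zs_def of_bool_def sum.If_cases Int_def)
  have "(pr p V (star_event A V c a))\<^sup>2 \<le> bern p U (\<lambda>Y. bern p U (\<lambda>Y'.
      ?pr Y Y'))"
    by (rule pr_square_le[OF p' V])
  also have "... \<le> bern p U (\<lambda>Y. 3 * \<epsilon>)"
  proof (rule bern_mono[OF p'])
    fix Y assume Y: "Y \<subseteq> U"
    have "bern p U (\<lambda>Y'. ?pr Y Y') \<le>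
       bern p U (\<lambda>Y'. \<epsilon> + 2 / real (card I) * (\<Sum>i\<in>I. of_bool (\<omega> Y Y' i = 0)))"
      using inner[OF Y] unfolding zsum by (intro bern_mono[OF p']) auto
    also have "... = \<epsilon> + 2 / real (card I) * (\<Sum>i\<in>I. pr p U (\<lambda>Y'. \<omega> Y Y' i = 0))"
      using fin by (simp only: bern_add bern_cmult bern_sum bern_const)
    also have "... \<le> \<epsilon> + 2 / real (card I) * (\<Sum>i\<in>I. \<epsilon>)"
      using zero by (intro add_left_mono mult_left_mono sum_mono) auto
    also have "... = 3 * \<epsilon>" using I0 by simp
    finally show "bern p U (\<lambda>Y'. ?pr Y Y') \<le> 3 * \<epsilon>" .
  qed
  finally show ?thesis using fin by simp
qed

lemma pr_star_event_small:
  assumes "0 < \<epsilon>"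
  obtains D where "D > 0"
    "\<And>p V (A :: 'a cmatrix) c a. \<lbrakk>0 < p; p \<le> 1 / 2; finite V; \<And>i j. A i j = A j i;
      \<And>j. j \<in> V \<Longrightarrow> c j \<noteq> 0; 2 * card {j \<in> V. bad_row A V j} \<le> card V;
      D \<le> p * real (card V)\<rbrakk> \<Longrightarrow> pr p V (star_event A V c a) \<le> \<epsilon>"
proof -
  \<comment> \<open>The kernel case needs \<open>\<delta> \<le> \<epsilon>\<close>; the decoupled
    case bounds the square of the probability by \<open>3 * \<delta>\<close>.\<close>
  define \<delta> where "\<delta> = min \<epsilon> (\<epsilon>\<^sup>2 / 3)"
  have \<delta>: "\<delta> > 0" "\<delta> \<le> \<epsilon>" "3 * \<delta> \<le> \<epsilon>\<^sup>2" using assms by (auto simp: \<delta>_def)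
  obtain K where K: "K > 0"
    "\<And>p I J (v :: 'a \<Rightarrow> complex) a. \<lbrakk>0 < p; p \<le> 1 / 2; finite I; J \<subseteq> I;
      \<And>e. e \<in> J \<Longrightarrow> v e \<noteq> 0; K \<le> p * real (card J)\<rbrakk>
      \<Longrightarrow> pr p I (\<lambda>E. sum v E = a) \<le> \<delta>"
    by (rule pr_sum_eq_small[OF \<delta>(1)]) auto
  \<comment> \<open>400 ensures \<open>1 \<le> m\<close> below. The number 320000 is
    \<open>400 * 800\<close>: a row in \<open>I\<close> has at least \<open>m / 400\<close> nonzero
    entries, and \<open>N \<le> 800 * m\<close>.\<close>
  define D where "D = max 400 (320000 * K)"
  have "pr p V (star_event A V c a) \<le> \<epsilon>"
    if p: "0 < p" "p \<le> 1 / 2" and V: "finite V" and sym: "\<And>i j. A i j = A j i"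
      and c: "\<And>j. j \<in> V \<Longrightarrow> c j \<noteq> 0" and bad: "2 * card {j \<in> V. bad_row A V j} \<le> card V"
      and pD: "D \<le> p * real (card V)"
    for p V and A :: "'a cmatrix" and c a
  proof -
    define N where "N = card V"
    have pN: "400 \<le> p * real N" "320000 * K \<le> p * real N" using pD by (auto simp: D_def N_def)
    have scale: "p * real N \<le> real a * (p * real b)" if "N \<le> a * b" for a b
    proof -
      have "real N \<le> real a * real b" using that by (metis of_nat_le_iff of_nat_mult)
      then have "p * real N \<le> p * (real a * real b)" using p by (intro mult_left_mono) auto
      then show ?thesis by (simp add: mult_ac)
    qed
    have "p * real N \<le> real N" using p by (simp add: mult_left_le_one_le)
    then have N: "400 \<le> N" using pN by linarith
    define T where "T = ksupp A V V"
    have T: "T \<subseteq> V" "finite T" using V by (auto simp: T_def ksupp_def)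
    show ?thesis
    proof (cases "400 * card T \<ge> N")
      case True
      obtain y where y: "nullvec A V V y" "\<forall>j\<in>T. y j \<noteq> 0"
        using full_support_nullvec[OF V, of A V] unfolding T_def by blast
      have KT: "K \<le> p * real (card T)" using scale[OF True] pN K(1) by simp
      have "pr p V (star_event A V c a) \<le> pr p V (\<lambda>X. sum (\<lambda>l. y l * c l) X = 0)"
        using p by (intro pr_mono star_event_orthogonal[OF V sym y(1)]) auto
      also have "... \<le> \<delta>"
        by (rule K(2)[OF p V T(1) _ KT]) (use y c T in auto)
      finally show ?thesis using \<delta> by linarith
    next
      case False
      define m where "m = N div 400"
      have "N = 400 * m + N mod 400" "N mod 400 < 400" by (simp_all add: m_def)
      moreover have "1 \<le> m" using N by (simp add: m_def Suc_le_eq div_greater_zero_iff)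
      ultimately have m: "400 * m \<le> N" "N \<le> 800 * m" by linarith+
      \<comment> \<open>Unit vectors at these vertices are images, and all their preimages have
        large support. About half of the vertices survive; a subset \<open>U\<close> of size
        \<open>m\<close> is small enough that removing it from a support costs little.\<close>
      define G where "G = V - T - {j \<in> V. bad_row A V j}"
      have "V \<subseteq> G \<union> T \<union> {j \<in> V. bad_row A V j}" by (auto simp: G_def)
      then have "N \<le> card (G \<union> T \<union> {j \<in> V. bad_row A V j})"
        unfolding N_def using V T by (intro card_mono) (auto simp: G_def)
      also have "... \<le> card G + card T + card {j \<in> V. bad_row A V j}"
        by (meson add_mono_thms_linordered_semiring(3) card_Un_le order_trans)
      finally have "m \<le> card G" using m False bad N_def by linarith
      then obtain U where U: "U \<subseteq> G" "card U = m" by (meson obtain_subset_with_card_n)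
      have UV: "U \<subseteq> V" "finite U" using U V by (auto simp: G_def intro: finite_subset)
      have "\<exists>w. \<forall>i\<in>V. (\<Sum>s\<in>V. A i s * w s) = of_bool (i = j)" if "j \<in> U" for j
        using that U by (intro solvable_outside_ksupp V sym) (auto simp: G_def T_def)
      then obtain w where w: "\<And>j i. j \<in> U \<Longrightarrow> i \<in> V \<Longrightarrow> (\<Sum>s\<in>V. A i s * w j s) = of_bool (i = j)"
        by metis
      let ?c = "\<lambda>j. card {i \<in> V - U. w j i \<noteq> 0}"
      let ?r = "\<lambda>i. card {j \<in> U. w j i \<noteq> 0}"
      have large: "N \<le> 200 * ?c j" if j: "j \<in> U" for j
      proof -
        let ?S = "{i \<in> V. w j i \<noteq> 0}"
        have "?S \<notin> small_sets V"
        proof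
          assume S: "?S \<in> small_sets V"
          have "(\<Sum>s\<in>?S. A i s * w j s) = (\<Sum>s\<in>V. A i s * w j s)" for i
            using V by (intro sum.mono_neutral_left) auto
          then have "\<forall>i\<in>V. (\<Sum>s\<in>?S. A i s * w j s) = of_bool (i = j)" using w[OF j] by simp
          then have "bad_row A V j" using S unfolding bad_row_def by blast
          then show False using j U by (auto simp: G_def)
        qed
        then have "N < 100 * card ?S" by (auto simp: small_sets_def N_def)
        moreover have "card ?S \<le> ?c j + card U"
        proof -
          have "card ?S \<le> card ({i \<in> V - U. w j i \<noteq> 0} \<union> U)" using V UV by (intro card_mono) auto
          then show ?thesis using card_Un_le order_trans by blast
        qed
        ultimately show ?thesis using U m by linarith
      qed
      \<comment> \<open>Double counting: the vectors \<open>w j\<close> have at least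
        \<open>m * N / 200\<close> nonzero entries outside \<open>U\<close>. Rows with fewer than
        \<open>m / 400\<close> of them account for at most half, so at least \<open>N / 400\<close>
        rows have many.\<close>
      define I where "I = {i \<in> V - U. m \<le> 400 * ?r i}"
      have fI: "finite I" "finite (V - U)" using V by (auto simp: I_def)
      have "m * N = (\<Sum>j\<in>U. N)" using U by simp
      also have "... \<le> (\<Sum>j\<in>U. 200 * ?c j)" by (intro sum_mono large)
      also have "... = 200 * (\<Sum>j\<in>U. \<Sum>i\<in>V - U. of_bool (w j i \<noteq> 0))"
        using fI by (simp add: sum_distrib_left of_bool_def sum.If_cases Int_def)
      also have "... = 200 * (\<Sum>i\<in>V - U. \<Sum>j\<in>U. of_bool (w j i \<noteq> 0))" by (subst sum.swap) simp
      also have "... = 200 * (\<Sum>i\<in>V - U. ?r i)"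
        using UV by (simp add: of_bool_def sum.If_cases Int_def)
      finally have 1: "2 * m * N \<le> 400 * (\<Sum>i\<in>V - U. ?r i)" by (simp add: mult.commute[of N m])
      have "400 * (\<Sum>i\<in>V - U. ?r i) \<le> (\<Sum>i\<in>V - U. (if i \<in> I then 400 * m else m))"
        unfolding sum_distrib_left
      proof (intro sum_mono)
        fix i assume i: "i \<in> V - U"
        have "?r i \<le> m" using U(2) UV by (auto intro: card_mono)
        then show "400 * ?r i \<le> (if i \<in> I then 400 * m else m)"
          using i by (auto simp: I_def)
      qed
      also have "... \<le> 400 * m * card I + m * N"
      proof -
        have "(\<Sum>i\<in>V - U. (if i \<in> I then 400 * m else m)) \<le> (\<Sum>i\<in>V - U. (if i \<in> I then 400 * m else 0) + m)"
          by (intro sum_mono) auto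
        also have "... = 400 * m * card I + m * card (V - U)"
        proof -
          have "(V - U) \<inter> I = I" by (auto simp: I_def)
          then show ?thesis using fI by (simp add: sum.distrib sum.If_cases Int_def[symmetric])
        qed
        also have "card (V - U) \<le> N" unfolding N_def using V by (intro card_mono) auto
        finally show ?thesis by simp
      qed
      finally have "2 * m * N \<le> 400 * m * card I + m * N" using 1 by linarith
      then have "m * N \<le> m * (400 * card I)" by simp
      moreover have "0 < m" using m N by linarith
      ultimately have IN: "N \<le> 400 * card I" by simp
      have KI: "2 * K \<le> p * real (card I)" using scale[OF IN] pN K(1) by simp
      have "(pr p V (star_event A V c a))\<^sup>2 \<le> 3 * \<delta>"
      proof (rule pr_star_event_decoupled[where w = w and U = U and I = I and K = K, OF p V UV(1) sym c w K(2)[OF p]])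
        show "K \<le> p * real (?r i)" if "i \<in> I" for i
        proof -
          have "N \<le> 320000 * ?r i" using that m by (auto simp: I_def)
          from scale[OF this] show ?thesis using pN by simp
        qed
      qed (use K(1) KI in \<open>auto simp: I_def\<close>)
      then have "(pr p V (star_event A V c a))\<^sup>2 \<le> \<epsilon>\<^sup>2" using \<delta> by linarith
      then show ?thesis by (rule power2_le_imp_le) (use assms in simp)
    qed
  qed
  moreover have "D > 0" by (simp add: D_def)
  ultimately show ?thesis by (rule that[rotated])
qed

lemma sedges_insert_star:
  assumes "i \<in> V"
  shows "sedges V = sedges (V - {i}) \<union> star i V"
proof
  show "sedges V \<subseteq> sedges (V - {i}) \<union> star i V"
    by (auto simp: sedges_def star_def image_iff)
  show "sedges (V - {i}) \<union> star i V \<subseteq> sedges V"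
    using assms by (auto simp: sedges_def star_def)
qed

text \<open>Rescale the null vector so that its coordinate at \<open>i\<close> is -1; the other
  coordinates form \<open>u\<close>. The set \<open>L\<close> records whether the loop at
  \<open>i\<close> is present.\<close>

lemma ksupp_star_event:
  assumes V: "finite V" "i \<in> V" and sym: "\<And>i j. W i j = W j i"
    and E: "E \<subseteq> sedges (V - {i})" and X: "X \<subseteq> V - {i}" and L: "L \<subseteq> {i}"
    and ks: "i \<in> ksupp (wmat W (E \<union> star i (L \<union> X))) V V"
  shows "star_event (wmat W E) (V - {i}) (W i) (if i \<in> L then W i i else 0) X"
proof -
  let ?A = "wmat W (E \<union> star i (L \<union> X))"
  let ?V = "V - {i}"
  obtain v where v: "nullvec ?A V V v" "v i \<noteq> 0" using ks by (auto simp: ksupp_def)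
  define u where "u = (\<lambda>j. - v j / v i)"
  have entry: "?A l j = wmat W E l j" if "l \<in> ?V" "j \<in> ?V" for l j
  proof -
    have "{l, j} \<notin> star i (L \<union> X)" using that by (auto simp: star_def doubleton_eq_iff)
    then show ?thesis by (simp add: wmat_def)
  qed
  have rowi: "?A i j = (if j \<in> L \<union> X then W i j else 0)" for j
  proof -
    have "{i, j} \<notin> E" using E by (auto simp: mem_sedges dest!: subsetD)
    then show ?thesis by (simp add: wmat_def mem_star)
  qed
  have coli: "?A l i = (if l \<in> X then W i l else 0)" if "l \<in> ?V" for l
    using wmat_sym[of W "E \<union> star i (L \<union> X)" l i, OF sym] rowi[of l] that L by auto
  have row: "(\<Sum>j\<in>?V. ?A l j * u j) = ?A l i" if l: "l \<in> V" for l
  proof -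
    have "0 = (\<Sum>j\<in>V. ?A l j * v j)" using v l by (simp add: nullvec_def)
    also have "... = ?A l i * v i + (\<Sum>j\<in>?V. ?A l j * v j)"
      using V by (simp add: sum.remove)
    finally have "(\<Sum>j\<in>?V. ?A l j * v j) = - (?A l i * v i)"
      by (simp add: eq_neg_iff_add_eq_0 add.commute)
    moreover have "(\<Sum>j\<in>?V. ?A l j * u j) = - (\<Sum>j\<in>?V. ?A l j * v j) / v i"
      by (simp add: u_def sum_divide_distrib sum_negf)
    ultimately show ?thesis using v by simp
  qed
  have "(\<Sum>j\<in>?V. wmat W E l j * u j) = (if l \<in> X then W i l else 0)" if "l \<in> ?V" for l
  proof -
    have "(\<Sum>j\<in>?V. wmat W E l j * u j) = (\<Sum>j\<in>?V. ?A l j * u j)"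
      using entry that by (intro sum.cong) auto
    then show ?thesis using row coli that by simp
  qed
  moreover have "(\<Sum>l\<in>?V. (if l \<in> X then W i l else 0) * u l) = (if i \<in> L then W i i else 0)"
  proof -
    have "(\<Sum>l\<in>?V. (if l \<in> X then W i l else 0) * u l) = (\<Sum>l\<in>?V. ?A i l * u l)"
      using rowi L by (intro sum.cong refl) auto
    also have "... = ?A i i" by (rule row[OF V(2)])
    also have "... = (if i \<in> L then W i i else 0)" using X by (subst rowi) auto
    finally show ?thesis .
  qed
  ultimately show ?thesis unfolding star_event_def by (intro exI[of _ u]) auto
qed

section \<open>From single vertices to the whole kernel support\<close>

text \<open>Expose the graph without \<open>i\<close> first. If more than half of its rows are bad,
  the trivial bound is paid for by \<open>2 / card V'\<close> times their number, of expectation at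
  most \<open>\<epsilon> / 2\<close>. Otherwise the star of \<open>i\<close> is still random and the
  star event has probability at most \<open>\<epsilon> / 2\<close>.\<close>

lemma pr_ksupp_small:
  assumes "0 < \<epsilon>"
  obtains D where "D > 0"
    "\<And>p V i (W :: 'a cmatrix). \<lbrakk>0 < p; p \<le> 1 / 2; finite V; i \<in> V; \<And>i j. W i j = W j i;
      \<And>i j. i \<noteq> j \<Longrightarrow> W i j \<noteq> 0; D \<le> p * real (card V)\<rbrakk>
      \<Longrightarrow> pr p (sedges V) (\<lambda>E. i \<in> ksupp (wmat W E) V V) \<le> \<epsilon>"
proof -
  obtain D1 where D1: "D1 > 0"
    "\<And>p V (A :: 'a cmatrix) c a. \<lbrakk>0 < p; p \<le> 1 / 2; finite V; \<And>i j. A i j = A j i;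
      \<And>j. j \<in> V \<Longrightarrow> c j \<noteq> 0; 2 * card {j \<in> V. bad_row A V j} \<le> card V;
      D1 \<le> p * real (card V)\<rbrakk> \<Longrightarrow> pr p V (star_event A V c a) \<le> \<epsilon> / 2"
    by (rule pr_star_event_small[of "\<epsilon> / 2"]) (use assms in auto)
  obtain D2 where D2: "D2 > 0"
    "\<And>p V Z (W :: 'a cmatrix). \<lbrakk>0 < p; p \<le> 1 / 2; finite V; Z \<subseteq> V; card Z \<le> 1;
      \<And>i j. i \<noteq> j \<Longrightarrow> W i j \<noteq> 0; D2 \<le> p * real (card V)\<rbrakk>
      \<Longrightarrow> pr p (sedges V) (witness_event W V Z) \<le> \<epsilon> / 4"
    by (rule pr_witness_event_small[of "\<epsilon> / 4"]) (use assms in auto)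
  \<comment> \<open>The extra 1 absorbs the loss of \<open>p\<close> caused by deleting one
    vertex.\<close>
  define D where "D = D1 + D2 + 1"
  have "pr p (sedges V) (\<lambda>E. i \<in> ksupp (wmat W E) V V) \<le> \<epsilon>"
    if p: "0 < p" "p \<le> 1 / 2" and V: "finite V" "i \<in> V" and sym: "\<And>i j. W i j = W j i"
      and W: "\<And>i j. i \<noteq> j \<Longrightarrow> W i j \<noteq> 0" and pD: "D \<le> p * real (card V)"
    for p V i and W :: "'a cmatrix"
  proof -
    have p': "0 \<le> p" "p \<le> 1" using p by auto
    define V' where "V' = V - {i}"
    have V': "finite V'" "i \<notin> V'" "V = insert i V'" using V by (auto simp: V'_def)
    have "p * real (card V) = p * real (card V') + p" using V' by (simp add: algebra_simps)
    then have pD': "D1 \<le> p * real (card V')" "D2 \<le> p * real (card V')"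
      using pD p D1(1) D2(1) by (auto simp: D_def)
    have "0 < p * real (card V')" using pD' D1(1) by linarith
    then have N0: "0 < real (card V')" using p by (simp add: zero_less_mult_iff)
    have Wi: "W i j \<noteq> 0" if "j \<in> V'" for j using W[of i j] that V'(2) by blast
    let ?ks = "\<lambda>E. i \<in> ksupp (wmat W E) V V"
    let ?bad = "\<lambda>E. {j \<in> V'. bad_row (wmat W E) V' j}"
    let ?st = "\<lambda>E. pr p (star i V) (\<lambda>X. ?ks (E \<union> X))"
    let ?sum = "\<lambda>E. \<Sum>j\<in>V'. of_bool (bad_row (wmat W E) V' j)"
    let ?br = "\<lambda>j. pr p (sedges V') (\<lambda>E. bad_row (wmat W E) V' j)"
    have cond: "?st E \<le> 2 / real (card V') * real (card (?bad E)) + \<epsilon> / 2"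
      if E: "E \<subseteq> sedges V'" for E
    proof (cases "2 * card (?bad E) \<le> card V'")
      case False
      then have "1 \<le> 2 / real (card V') * real (card (?bad E))" using N0 by (simp add: field_simps)
      moreover have "?st E \<le> 1" using V p' by (intro pr_le_1) auto
      ultimately show ?thesis using assms by linarith
    next
      case True
      have part: "pr p V' (\<lambda>X. ?ks (E \<union> star i (L \<union> X))) \<le> \<epsilon> / 2" if L: "L \<subseteq> {i}" for L
      proof -
        have "pr p V' (\<lambda>X. ?ks (E \<union> star i (L \<union> X))) \<le>
            pr p V' (star_event (wmat W E) V' (W i) (if i \<in> L then W i i else 0))"
          using ksupp_star_event[OF V sym _ _ L] E unfolding V'_def by (intro pr_mono p') auto
        also have "... \<le> \<epsilon> / 2"
          by (rule D1(2)[OF p V'(1) wmat_sym[OF sym] Wi True pD'(1)])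
        finally show ?thesis .
      qed
      have "?st E = pr p V (\<lambda>X. ?ks (E \<union> star i X))"
        unfolding star_def using V inj_star by (intro bern_image) auto
      \<comment> \<open>Splitting off the loop leaves two star events, with \<open>a\<close> equal
        to the diagonal weight and to 0.\<close>
      also have "... = p * pr p V' (\<lambda>X. ?ks (E \<union> star i ({i} \<union> X))) +
          (1 - p) * pr p V' (\<lambda>X. ?ks (E \<union> star i ({} \<union> X)))"
        unfolding V'(3) by (subst bern_insert[OF V'(1,2)]) simp
      also have "... \<le> p * (\<epsilon> / 2) + (1 - p) * (\<epsilon> / 2)"
        using part[of "{i}"] part[of "{}"] p by (intro add_mono mult_left_mono) auto
      also have "... = \<epsilon> / 2" by (simp add: field_simps)
      finally show ?thesis by (simp add: add_increasing)
    qed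
    have badj: "?br j \<le> \<epsilon> / 4" if "j \<in> V'" for j
    proof -
      have "?br j \<le> pr p (sedges V') (witness_event W V' {j})"
        by (intro pr_mono p' bad_row_witness W V'(1) that)
      also have "... \<le> \<epsilon> / 4" using that pD' V' W by (intro D2(2) p) auto
      finally show ?thesis .
    qed
    have cardbad: "real (card (?bad E)) = ?sum E" for E
      using V' by (simp add: of_bool_def sum.If_cases Int_def)
    have "pr p (sedges V) ?ks = bern p (sedges V') (\<lambda>E. ?st E)"
      unfolding sedges_insert_star[OF V(2)] V'_def[symmetric] using V V' star_sedges_disjoint[OF V'(2)]
      by (intro bern_Un) auto
    also have "... \<le> bern p (sedges V') (\<lambda>E. 2 / real (card V') * ?sum E + \<epsilon> / 2)"
      using cond unfolding cardbad by (intro bern_mono[OF p']) auto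
    also have "... = 2 / real (card V') * (\<Sum>j\<in>V'. ?br j) + \<epsilon> / 2"
      using V' by (simp only: bern_add bern_cmult bern_sum bern_const finite_sedges)
    also have "... \<le> 2 / real (card V') * (\<Sum>j\<in>V'. \<epsilon> / 4) + \<epsilon> / 2"
      using badj by (intro add_right_mono mult_left_mono sum_mono) auto
    also have "... = \<epsilon>" using N0 by simp
    finally show ?thesis .
  qed
  moreover have "D > 0" using D1(1) D2(1) by (simp add: D_def)
  ultimately show ?thesis by (rule that[rotated])
qed

text \<open>The opposite inequality holds for all \<open>X\<close> and \<open>T\<close>, see \<open>indep_card_bound\<close>.\<close>

definition rank_attained :: "('a \<Rightarrow> 'a \<Rightarrow> 'c::field) \<Rightarrow> 'a set \<Rightarrow> bool" where
  "rank_attained A V \<longleftrightarrow> (\<exists>X\<subseteq>V. \<exists>T\<subseteq>V. indep_cols A V X \<and>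
     card V - card T + card (nb A V T) \<le> card X)"

text \<open>If the kernel support is small, so is every circuit inside it; when none of these is
  bad, the deterministic rank bound applies.\<close>

lemma rank_attained_cases:
  assumes V: "finite V" and nr: "\<not> rank_attained A V"
  shows "bad_circuit A V \<or> card V \<le> 100 * card (ksupp A V V)"
proof (rule ccontr)
  assume "\<not> ?thesis"
  then have nb: "\<not> bad_circuit A V" and ks: "100 * card (ksupp A V V) < card V" by auto
  have kV: "ksupp A V V \<subseteq> V" by (auto simp: ksupp_def)
  have "card (nb A V S) < card S" if S: "S \<subseteq> ksupp A V V" "circuit A V S" for S
  proof -
    have "card S \<le> card (ksupp A V V)" using S(1) kV V by (meson card_mono finite_subset)
    then have "S \<in> small_sets V" using S(1) kV ks by (auto simp: small_sets_def)
    then show ?thesis using nb S(2) unfolding bad_circuit_def by (meson not_le)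
  qed
  then show False using rank_if_small_circuits[OF V V, of A] nr kV
    unfolding rank_attained_def by blast
qed

text \<open>Markov's inequality: with probability at most \<open>\<epsilon> / 200\<close> per
  vertex, the kernel support reaches a hundredth of the vertices with probability at most
  \<open>\<epsilon> / 2\<close>.\<close>

theorem pr_not_rank_attained_small:
  assumes "0 < \<epsilon>"
  obtains D where "D > 0"
    "\<And>p V (W :: 'a cmatrix). \<lbrakk>0 < p; p \<le> 1 / 2; finite V; \<And>i j. W i j = W j i;
      \<And>i j. i \<noteq> j \<Longrightarrow> W i j \<noteq> 0; D \<le> p * real (card V)\<rbrakk>
      \<Longrightarrow> pr p (sedges V) (\<lambda>E. \<not> rank_attained (wmat W E) V) \<le> \<epsilon>"
proof -
  obtain D1 where D1: "D1 > 0"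
    "\<And>p V i (W :: 'a cmatrix). \<lbrakk>0 < p; p \<le> 1 / 2; finite V; i \<in> V; \<And>i j. W i j = W j i;
      \<And>i j. i \<noteq> j \<Longrightarrow> W i j \<noteq> 0; D1 \<le> p * real (card V)\<rbrakk>
      \<Longrightarrow> pr p (sedges V) (\<lambda>E. i \<in> ksupp (wmat W E) V V) \<le> \<epsilon> / 200"
    by (rule pr_ksupp_small[of "\<epsilon> / 200"]) (use assms in auto)
  obtain D2 where D2: "D2 > 0"
    "\<And>p V Z (W :: 'a cmatrix). \<lbrakk>0 < p; p \<le> 1 / 2; finite V; Z \<subseteq> V; card Z \<le> 1;
      \<And>i j. i \<noteq> j \<Longrightarrow> W i j \<noteq> 0; D2 \<le> p * real (card V)\<rbrakk>
      \<Longrightarrow> pr p (sedges V) (witness_event W V Z) \<le> \<epsilon> / 2"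
    by (rule pr_witness_event_small[of "\<epsilon> / 2"]) (use assms in auto)
  have "pr p (sedges V) (\<lambda>E. \<not> rank_attained (wmat W E) V) \<le> \<epsilon>"
    if p: "0 < p" "p \<le> 1 / 2" and V: "finite V" and sym: "\<And>i j. W i j = W j i"
      and W: "\<And>i j. i \<noteq> j \<Longrightarrow> W i j \<noteq> 0" and pD: "max D1 D2 \<le> p * real (card V)"
    for p V and W :: "'a cmatrix"
  proof -
    have p': "0 \<le> p" "p \<le> 1" using p by auto
    have pD': "D1 \<le> p * real (card V)" "D2 \<le> p * real (card V)" using pD by auto
    have "0 < p * real (card V)" using pD' D1(1) by linarith
    then have N0: "0 < real (card V)" using p by (simp add: zero_less_mult_iff)
    let ?ks = "\<lambda>E. ksupp (wmat W E) V V"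
    let ?big = "\<lambda>E. card V \<le> 100 * card (?ks E)"
    let ?bad = "\<lambda>E. bad_circuit (wmat W E) V"
    let ?sum = "\<lambda>E. \<Sum>i\<in>V. of_bool (i \<in> ?ks E) :: real"
    have cardks: "real (card (?ks E)) = ?sum E" for E
    proof -
      have "?ks E = {i \<in> V. i \<in> ?ks E}" by (auto simp: ksupp_def)
      then show ?thesis using V by (simp add: of_bool_def sum.If_cases Int_def)
    qed
    have "pr p (sedges V) (\<lambda>E. \<not> rank_attained (wmat W E) V) \<le>
        pr p (sedges V) (\<lambda>E. bad_circuit (wmat W E) V \<or> card V \<le> 100 * card (?ks E))"
      by (intro pr_mono p' rank_attained_cases V)
    also have "... \<le> pr p (sedges V) ?bad +
        pr p (sedges V) ?big"
      by (rule pr_disj_le[OF p'])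
    also have "pr p (sedges V) ?bad \<le> \<epsilon> / 2"
    proof -
      have "pr p (sedges V) ?bad \<le> pr p (sedges V) (witness_event W V {})"
        by (intro pr_mono p' bad_circuit_witness W V)
      also have "... \<le> \<epsilon> / 2" using pD' V W by (intro D2(2) p) auto
      finally show ?thesis .
    qed
    also have "pr p (sedges V) ?big \<le> \<epsilon> / 2"
    proof -
      have "pr p (sedges V) ?big =
          pr p (sedges V) (\<lambda>E. real (card V) / 100 \<le> ?sum E)"
        unfolding cardks[symmetric] by (intro bern_cong arg_cong[where f = of_bool]) linarith
      also have "... \<le> bern p (sedges V) (\<lambda>E. \<Sum>i\<in>V. of_bool (i \<in> ?ks E)) / (real (card V) / 100)"
        using N0 by (intro pr_markov p') (auto intro: sum_nonneg)
      also have "... \<le> (\<Sum>i\<in>V. \<epsilon> / 200) / (real (card V) / 100)"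
        unfolding bern_sum using pD' V W sym
        by (intro divide_right_mono sum_mono D1(2) p) auto
      also have "... = \<epsilon> / 2" using N0 by simp
      finally show ?thesis .
    qed
    finally show ?thesis by simp
  qed
  moreover have "max D1 D2 > 0" using D1(1) by simp
  ultimately show ?thesis by (rule that[rotated])
qed

subsection \<open>Replacing the entries by two-point variables\<close>

text \<open>\<open>K\<close> is the number with \<open>p * K + (1 - p) * g 0 = C\<close>. The
  hypothesis on two-point laws says that \<open>g\<close> is at most \<open>K\<close> away from 0,
  so the integral is at most an average of \<open>K\<close> and \<open>g 0\<close>. Excess mass at 0
  can only lower this average when \<open>g 0 \<le> C\<close>, for then
  \<open>g 0 \<le> K\<close>.\<close>

lemma integral_le_two_point:
  fixes g :: "complex \<Rightarrow> real"
  assumes \<mu>: "prob_space \<mu>" "sets \<mu> = sets borel" and p: "0 < p" "p \<le> 1"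
    and g: "g \<in> borel_measurable borel" "\<And>y. 0 \<le> g y" "\<And>y. g y \<le> 1"
    and zero: "measure \<mu> {0} \<ge> 1 - p"
    and le: "\<And>y. y \<noteq> 0 \<Longrightarrow> p * g y + (1 - p) * g 0 \<le> C"
    and le0: "measure \<mu> {0} = 1 - p \<or> g 0 \<le> C"
  shows "(\<integral>y. g y \<partial>\<mu>) \<le> C"
proof -
  interpret prob_space \<mu> by fact
  define K where "K = (C - (1 - p) * g 0) / p"
  have g\<mu>: "g \<in> borel_measurable \<mu>" using g(1) measurable_cong_sets[OF \<mu>(2) refl] by blast
  have int_g: "integrable \<mu> g"
    using g by (intro integrable_const_bound[of _ 1] g\<mu>) auto
  have z: "{0} \<in> sets \<mu>" using \<mu>(2) by simp
  have int_R: "integrable \<mu> (\<lambda>y. K + (g 0 - K) * indicator {0} y)"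
    using z by (intro Bochner_Integration.integrable_add integrable_mult_right integrable_real_indicator)
      (auto simp: emeasure_eq_measure)
  have "(\<integral>y. g y \<partial>\<mu>) \<le> (\<integral>y. K + (g 0 - K) * indicator {0} y \<partial>\<mu>)"
  proof (intro integral_mono int_g int_R)
    fix y
    show "g y \<le> K + (g 0 - K) * indicator {0} y"
    proof (cases "y = 0")
      case False
      then have "p * g y \<le> C - (1 - p) * g 0" using le[of y] by simp
      then show ?thesis using False p by (simp add: K_def pos_le_divide_eq mult.commute)
    qed simp
  qed
  also have "... = K + (g 0 - K) * measure \<mu> {0}"
    using z by (subst Bochner_Integration.integral_add) (auto simp: emeasure_eq_measure prob_space)
  also have "... \<le> K + (g 0 - K) * (1 - p)"
  proof (cases "measure \<mu> {0} = 1 - p")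
    case False
    with le0 have "g 0 \<le> C" by simp
    then have "p * g 0 \<le> C - (1 - p) * g 0" by (simp add: algebra_simps)
    then have "g 0 \<le> K" using p by (simp add: K_def pos_le_divide_eq mult.commute)
    then have "(g 0 - K) * measure \<mu> {0} \<le> (g 0 - K) * (1 - p)"
      using zero by (intro mult_left_mono_neg) auto
    then show ?thesis by simp
  qed simp
  also have "... = C" using p by (simp add: K_def field_simps)
  finally show ?thesis .
qed

text \<open>
  A variable that vanishes with probability \<open>1 - p\<close> is a mixture of the two-point variables taking
  a value \<open>w\<close> with probability \<open>p\<close> and \<open>0\<close> otherwise, so a bound for all choices of the
  values \<open>w\<close> transfers to the product measure.
\<close>

lemma product_integral_le_bern:
  fixes \<mu> :: "'i \<Rightarrow> complex measure" and F :: "('i \<Rightarrow> complex) \<Rightarrow> real"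
  assumes \<mu>: "\<And>i. prob_space (\<mu> i)" "\<And>i. sets (\<mu> i) = sets borel"
    and p: "0 < p" "p \<le> 1" and I: "finite I"
    and zero: "\<And>i. i \<in> I \<Longrightarrow> measure (\<mu> i) {0} \<ge> 1 - p"
      "\<And>i. i \<in> I \<Longrightarrow> i \<notin> D \<Longrightarrow> measure (\<mu> i) {0} = 1 - p"
    and F: "F \<in> borel_measurable (Pi\<^sub>M I \<mu>)" "\<And>x. 0 \<le> F x" "\<And>x. F x \<le> 1"
    and le: "\<And>w. (\<And>i. i \<notin> D \<Longrightarrow> w i \<noteq> 0) \<Longrightarrow>
      bern p I (\<lambda>E. F (\<lambda>i\<in>I. if i \<in> E then w i else 0)) \<le> C"
  shows "(\<integral>x. F x \<partial>Pi\<^sub>M I \<mu>) \<le> C"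
  using I zero F le
proof (induction I arbitrary: F rule: finite_induct)
  case empty
  have "(\<integral>x. F x \<partial>Pi\<^sub>M {} \<mu>) = F (\<lambda>_. undefined)"
    by (simp add: PiM_empty lebesgue_integral_count_space_finite)
  moreover have "bern p {} (\<lambda>E. F (\<lambda>i\<in>{}. if i \<in> E then 1 else 0)) \<le> C"
    by (rule empty.prems(6)[of "\<lambda>_. 1"]) simp
  ultimately show ?case by (simp add: restrict_def)
next
  case (insert i I)
  interpret product_prob_space \<mu> UNIV by (simp add: \<mu>(1) product_prob_spaceI)
  interpret PI: prob_space "Pi\<^sub>M I \<mu>" by (rule prob_space_PiM) (rule \<mu>(1))
  interpret PiI: prob_space "Pi\<^sub>M (insert i I) \<mu>" by (rule prob_space_PiM) (rule \<mu>(1))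
  note F = insert.prems(3-5)
  have intF: "integrable (Pi\<^sub>M (insert i I) \<mu>) F"
    using F by (intro PiI.integrable_const_bound[of _ 1]) auto
  define G where "G = (\<lambda>x. \<integral>y. F (x(i := y)) \<partial>\<mu> i)"
  have upd: "(\<lambda>(x, y). x(i := y)) \<in> measurable (Pi\<^sub>M I \<mu> \<Otimes>\<^sub>M \<mu> i) (Pi\<^sub>M (insert i I) \<mu>)"
    by (rule measurable_add_dim)
  have FG: "(\<lambda>(x, y). F (x(i := y))) \<in> borel_measurable (Pi\<^sub>M I \<mu> \<Otimes>\<^sub>M \<mu> i)"
    using measurable_compose[OF upd F(1)] by (simp add: case_prod_unfold fun_upd_def)
  have G: "G \<in> borel_measurable (Pi\<^sub>M I \<mu>)"
    unfolding G_def using FG by (rule sigma_finite_measure.borel_measurable_lebesgue_integral[OF sigma_finite_measures])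
  have Fy: "(\<lambda>y. F (x(i := y))) \<in> borel_measurable (\<mu> i)" if "x \<in> space (Pi\<^sub>M I \<mu>)" for x
    using measurable_compose[OF measurable_Pair1'[OF that] FG] by simp
  have intFy: "integrable (\<mu> i) (\<lambda>y. F (x(i := y)))" if "x \<in> space (Pi\<^sub>M I \<mu>)" for x
    using F Fy[OF that] by (intro M.integrable_const_bound[of _ 1]) auto
  have G0: "0 \<le> G x" for x unfolding G_def using F by (intro integral_nonneg_AE) auto
  have G1: "G x \<le> 1" for x
  proof (cases "integrable (\<mu> i) (\<lambda>y. F (x(i := y)))")
    case True
    then show ?thesis unfolding G_def using F by (intro M.integral_le_const) auto
  next
    case False
    \<comment> \<open>By convention the integral of a non-integrable function is 0; this keeps the
      bound valid at arguments outside the product space.\<close>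
    then show ?thesis by (simp add: G_def not_integrable_integral_eq)
  qed
  have "(\<integral>x. F x \<partial>Pi\<^sub>M (insert i I) \<mu>) = (\<integral>x. G x \<partial>Pi\<^sub>M I \<mu>)"
    unfolding G_def by (rule product_integral_insert[OF insert.hyps intF])
  also have "... \<le> C"
  proof (rule insert.IH)
    fix w :: "'i \<Rightarrow> complex" assume w: "\<And>i. i \<notin> D \<Longrightarrow> w i \<noteq> 0"
    define x where "x = (\<lambda>E. \<lambda>i\<in>I. if i \<in> E then w i else 0)"
    have x: "x E \<in> space (Pi\<^sub>M I \<mu>)" for E
    proof -
      have "space (\<mu> j) = UNIV" for j using sets_eq_imp_space_eq[OF \<mu>(2)[of j]] by simp
      then show ?thesis by (auto simp: x_def space_PiM)
    qed
    define g where "g = (\<lambda>y. bern p I (\<lambda>E. F ((x E)(i := y))))"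
    have "bern p I (\<lambda>E. G (x E)) = (\<integral>y. g y \<partial>\<mu> i)"
      unfolding bern_def g_def G_def using x
      by (subst Bochner_Integration.integral_sum) (auto intro!: integrable_mult_right intFy)
    also have "... \<le> C"
    proof (rule integral_le_two_point[OF \<mu>(1) \<mu>(2) p])
      show "g \<in> borel_measurable borel"
        unfolding g_def bern_def
        using Fy[OF x] by (intro borel_measurable_sum borel_measurable_times)
          (auto simp: measurable_cong_sets[OF \<mu>(2) refl])
      show "0 \<le> g y" "g y \<le> 1" for y
        unfolding g_def using F p insert.hyps by (auto intro!: bern_nonneg bern_le_const)
      have ins: "p * g y + (1 - p) * g 0 =
          bern p (insert i I) (\<lambda>E. F (\<lambda>j\<in>insert i I. if j \<in> E then (w(i := y)) j else 0))" for y
      proof -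
        have "F (\<lambda>j\<in>insert i I. if j \<in> insert i E then (w(i := y)) j else 0) = F ((x E)(i := y))"
          "F (\<lambda>j\<in>insert i I. if j \<in> E then (w(i := y)) j else 0) = F ((x E)(i := 0))" if "E \<subseteq> I" for E
          using that insert.hyps by (auto intro!: arg_cong[of _ _ F] simp: x_def fun_eq_iff)
        then show ?thesis
          unfolding bern_insert[OF insert.hyps] g_def
          by (intro arg_cong2[of _ _ _ _ "(+)"] arg_cong2[of _ _ _ _ "(*)"] bern_cong refl) auto
      qed
      show le: "p * g y + (1 - p) * g 0 \<le> C" if "y \<noteq> 0" for y
        unfolding ins using w that by (intro insert.prems(6)) auto
      show "1 - p \<le> measure (\<mu> i) {0}" using insert.prems(1) by auto
      show "measure (\<mu> i) {0} = 1 - p \<or> g 0 \<le> C"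
      proof (cases "i \<in> D")
        case True
        \<comment> \<open>At an index in \<open>D\<close> the weight 0 is admissible, and with it
          the two-point variable is constantly 0.\<close>
        have "g 0 = p * g 0 + (1 - p) * g 0" by (simp add: algebra_simps)
        also have "... \<le> C" unfolding ins using w True by (intro insert.prems(6)) auto
        finally show ?thesis ..
      next
        case False
        then show ?thesis using insert.prems(2)[of i] by auto
      qed
    qed
    finally show "bern p I (\<lambda>E. G (\<lambda>i\<in>I. if i \<in> E then w i else 0)) \<le> C" by (simp only: x_def)
  qed (use insert.prems G G0 G1 in auto)
  finally show ?case .
qed

subsection \<open>Independent columns and the rank of a matrix\<close>

text \<open>\<open>lin_indpt\<close> speaks of a set of vectors, in which equal columns would
  collapse; injectivity on the indices is therefore proved alongside.\<close>

lemma (in vec_space) lin_indpt_cols: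
  assumes A: "A \<in> carrier_mat n nc" and X: "X \<subseteq> {..<nc}"
    and ind: "indep_cols (\<lambda>i j. A $$ (i, j)) {..<n} X"
  shows "lin_indpt (col A ` X)" "inj_on (col A) X"
proof -
  have fX: "finite X" using X finite_subset by blast
  have null0: "\<forall>s\<in>X. w s = 0" if "\<And>i. i < n \<Longrightarrow> (\<Sum>s\<in>X. A $$ (i, s) * w s) = 0" for w
    using ind that by (simp add: indep_cols_def nullvec_def)
  show inj: "inj_on (col A) X"
  proof
    fix s t assume st: "s \<in> X" "t \<in> X" "col A s = col A t"
    have eq: "A $$ (i, s) = A $$ (i, t)" if "i < n" for i
      using st X A that by (metis carrier_matD index_col lessThan_iff subsetD)
    show "s = t"
    proof (rule ccontr)
      assume ne: "s \<noteq> t"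
      define w where "w = (\<lambda>x. if x = s then 1 else if x = t then - 1 else 0 :: 'a)"
      have "(\<Sum>x\<in>X. A $$ (i, x) * w x) = 0" if "i < n" for i
      proof -
        have "(\<Sum>x\<in>X. A $$ (i, x) * w x) = (\<Sum>x\<in>{s, t}. A $$ (i, x) * w x)"
          using st fX by (intro sum.mono_neutral_right) (auto simp: w_def)
        also have "... = 0" using ne eq[OF that] by (simp add: w_def)
        finally show ?thesis .
      qed
      then have "\<forall>s\<in>X. w s = 0" by (rule null0)
      with st(1) have "w s = 0" by blast
      then show False by (simp add: w_def)
    qed
  qed
  have cX: "col A ` X \<subseteq> carrier_vec n" using A by auto
  show "lin_indpt (col A ` X)"
  proof
    assume "lin_dep (col A ` X)"
    then obtain a v where a: "a \<in> col A ` X \<rightarrow> UNIV" "lincomb a (col A ` X) = 0\<^sub>v n" "v \<in> col A ` X" "a v \<noteq> 0"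
      using finite_lin_dep[of "col A ` X"] fX cX by auto
    then obtain s where s: "s \<in> X" "v = col A s" by auto
    have "(\<Sum>x\<in>X. A $$ (i, x) * a (col A x)) = 0" if i: "i < n" for i
    proof -
      have "0 = lincomb a (col A ` X) $ i" using a(2) i by simp
      also have "... = (\<Sum>v\<in>col A ` X. a v * v $ i)" by (rule lincomb_index[OF i cX])
      also have "... = (\<Sum>x\<in>X. a (col A x) * col A x $ i)" by (simp add: sum.reindex[OF inj])
      also have "... = (\<Sum>x\<in>X. A $$ (i, x) * a (col A x))"
        using X A i by (intro sum.cong) auto
      finally show ?thesis by simp
    qed
    then have "\<forall>s\<in>X. a (col A s) = 0" by (rule null0)
    with s(1) have "a (col A s) = 0" by blast
    then show False using a s by simp
  qed
qed

lemma (in vec_space) card_indep_cols_le_rank: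
  assumes A: "A \<in> carrier_mat n nc" and X: "X \<subseteq> {..<nc}"
    and ind: "indep_cols (\<lambda>i j. A $$ (i, j)) {..<n} X"
  shows "card X \<le> rank A"
proof -
  have "col A ` X \<subseteq> set (cols A)" using A X by (auto simp: cols_def)
  then have "card (col A ` X) \<le> rank A"
    using rank_ge_card_indpt[OF A] lin_indpt_cols(1)[OF assms] by blast
  then show ?thesis using card_image[OF lin_indpt_cols(2)[OF assms]] by simp
qed

lemma (in vec_space) ex_indep_cols_rank:
  assumes A: "A \<in> carrier_mat n nc"
  shows "\<exists>X\<subseteq>{..<nc}. indep_cols (\<lambda>i j. A $$ (i, j)) {..<n} X \<and> card X = rank A"
proof -
  let ?P = "\<lambda>T. T \<subseteq> set (cols A) \<and> lin_indpt T"
  have "lin_indpt {}" by (auto simp: lin_dep_def)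
  then obtain S where S: "maximal S ?P" "finite S"
    using maximal_exists_superset[of "set (cols A)" ?P "{}"] by auto
  then have SP: "S \<subseteq> set (cols A)" "lin_indpt S" by (auto simp: maximal_def)
  have rank: "rank A = card S" by (rule rank_card_indpt[OF A S(1)])
  have "set (cols A) = col A ` {..<nc}" using A by (auto simp: cols_def)
  then obtain X where X: "X \<subseteq> {..<nc}" "inj_on (col A) X" "S = col A ` X"
    using SP(1) by (metis subset_image_inj)
  have fX: "finite X" using X finite_subset by blast
  have cS: "S \<subseteq> carrier_vec n" using SP A by (auto simp: cols_def)
  have "indep_cols (\<lambda>i j. A $$ (i, j)) {..<n} X"
    unfolding indep_cols_def
  proof (intro allI impI ballI)
    fix w s assume w: "nullvec (\<lambda>i j. A $$ (i, j)) {..<n} X w" and s: "s \<in> X"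
    define a where "a = (\<lambda>v. w (the_inv_into X (col A) v))"
    have ax: "a (col A x) = w x" if "x \<in> X" for x
      using that X by (simp add: a_def the_inv_into_f_f)
    have "lincomb a S = 0\<^sub>v n"
    proof (intro eq_vecI)
      show "dim_vec (lincomb a S) = dim_vec (0\<^sub>v n)" using cS S by (simp add: lincomb_dim)
      fix i assume "i < dim_vec (0\<^sub>v n :: 'a Matrix.vec)"
      then have i: "i < n" by simp
      have "lincomb a S $ i = (\<Sum>v\<in>S. a v * v $ i)" by (rule lincomb_index[OF i cS])
      also have "... = (\<Sum>x\<in>X. a (col A x) * col A x $ i)" unfolding X(3) by (simp add: sum.reindex[OF X(2)])
      also have "... = (\<Sum>x\<in>X. A $$ (i, x) * w x)"
        using X A i ax by (intro sum.cong) auto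
      also have "... = 0" using w i by (simp add: nullvec_def)
      finally show "lincomb a S $ i = 0\<^sub>v n $ i" using i by simp
    qed
    then have "a \<in> S \<rightarrow> {0}"
      using not_lindepD[OF SP(2) S(2) subset_refl, of a] by auto
    then have "a (col A s) = 0" using s X(3) by blast
    then show "w s = 0" using ax[OF s] by simp
  qed
  moreover have "card X = rank A" using card_image[OF X(2)] X(3) rank by simp
  ultimately show ?thesis using X(1) by blast
qed

text \<open>
  The Gram matrix of the columns in \<open>X\<close> is padded by an identity block, so that its size does not
  depend on \<open>X\<close>. This expresses independence as a measurable condition on the entries.
\<close>

lemma indep_cols_iff_gram_det:
  fixes A :: "nat cmatrix"
  assumes X: "X \<subseteq> {..<n}"
  shows "indep_cols A {..<m} X \<longleftrightarrow> Determinant.det (Matrix.mat n n (\<lambda>(i, j).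
    if i \<in> X \<and> j \<in> X then (\<Sum>r<m. cnj (A r i) * A r j) else of_bool (i = j))) \<noteq> 0"
proof -
  define G where "G = Matrix.mat n n (\<lambda>(i, j).
    if i \<in> X \<and> j \<in> X then (\<Sum>r<m. cnj (A r i) * A r j) else of_bool (i = j))"
  have G: "G \<in> carrier_mat n n" by (simp add: G_def)
  have fX: "finite X" using X finite_subset by blast
  have Gv: "(G *\<^sub>v v) $ i = (if i \<in> X then (\<Sum>r<m. cnj (A r i) * (\<Sum>j\<in>X. A r j * v $ j)) else v $ i)"
    if i: "i < n" and v: "v \<in> carrier_vec n" for v i
  proof -
    have "(G *\<^sub>v v) $ i = (\<Sum>j<n. G $$ (i, j) * v $ j)"
      using i v G by (simp add: scalar_prod_def atLeast0LessThan)
    also have "... = (if i \<in> X then (\<Sum>r<m. cnj (A r i) * (\<Sum>j\<in>X. A r j * v $ j)) else v $ i)"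
    proof (cases "i \<in> X")
      case True
      have "(\<Sum>j<n. G $$ (i, j) * v $ j) = (\<Sum>j\<in>X. (\<Sum>r<m. cnj (A r i) * A r j) * v $ j)"
        using X i True by (intro sum.mono_neutral_cong_right) (auto simp: G_def)
      also have "... = (\<Sum>r<m. cnj (A r i) * (\<Sum>j\<in>X. A r j * v $ j))"
        unfolding sum_distrib_left sum_distrib_right by (subst sum.swap) (simp add: mult_ac)
      finally show ?thesis using True by simp
    next
      case False
      have "(\<Sum>j<n. G $$ (i, j) * v $ j) = (\<Sum>j<n. if j = i then v $ i else 0)"
        using i False by (intro sum.cong) (auto simp: G_def)
      then show ?thesis using i False by simp
    qed
    finally show ?thesis .
  qed
  have "Determinant.det G = 0 \<longleftrightarrow> \<not> indep_cols A {..<m} X"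
  proof
    assume "Determinant.det G = 0"
    then obtain v where v: "v \<in> carrier_vec n" "v \<noteq> 0\<^sub>v n" "G *\<^sub>v v = 0\<^sub>v n"
      using det_0_iff_vec_prod_zero_field[OF G] by blast
    have z: "(if i \<in> X then (\<Sum>r<m. cnj (A r i) * (\<Sum>j\<in>X. A r j * v $ j)) else v $ i) = 0" if "i < n" for i
      using Gv[OF that v(1)] v(3) that by simp
    define y where "y = (\<lambda>r. \<Sum>j\<in>X. A r j * v $ j)"
    \<comment> \<open>The Hermitian form of the Gram matrix at \<open>v\<close> is the squared norm
      of the image \<open>y\<close>; it vanishes, so \<open>y\<close> does.\<close>
    have "(\<Sum>r<m. cnj (y r) * y r) = (\<Sum>i\<in>X. cnj (v $ i) * (\<Sum>r<m. cnj (A r i) * y r))"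
    proof -
      have "cnj (y r) = (\<Sum>i\<in>X. cnj (v $ i) * cnj (A r i))" for r
        by (simp add: y_def mult.commute)
      then have "cnj (y r) * y r = (\<Sum>i\<in>X. cnj (v $ i) * (cnj (A r i) * y r))" for r
        by (simp add: sum_distrib_right mult.assoc)
      then have "(\<Sum>r<m. cnj (y r) * y r) = (\<Sum>r<m. \<Sum>i\<in>X. cnj (v $ i) * (cnj (A r i) * y r))" by simp
      also have "... = (\<Sum>i\<in>X. \<Sum>r<m. cnj (v $ i) * (cnj (A r i) * y r))" by (rule sum.swap)
      finally show ?thesis by (simp only: sum_distrib_left)
    qed
    also have "... = 0"
    proof (intro sum.neutral ballI)
      fix i assume "i \<in> X"
      then show "cnj (v $ i) * (\<Sum>r<m. cnj (A r i) * y r) = 0" using z[of i] X by (auto simp: y_def)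
    qed
    finally have "(\<Sum>r<m. cnj (y r) * y r) = 0" .
    moreover have "(\<Sum>r<m. cnj (y r) * y r) = of_real (\<Sum>r<m. (cmod (y r))\<^sup>2)"
      by (simp add: complex_norm_square mult.commute del: of_real_power)
    ultimately have "(\<Sum>r<m. (cmod (y r))\<^sup>2) = 0" by (simp only: of_real_eq_0_iff)
    then have "y r = 0" if "r < m" for r
      using that by (subst (asm) sum_nonneg_eq_0_iff) auto
    then have "nullvec A {..<m} X (\<lambda>j. v $ j)" by (simp add: nullvec_def y_def)
    moreover obtain i where i: "i < n" "v $ i \<noteq> 0"
    proof -
      have "\<exists>i<n. v $ i \<noteq> 0"
      proof (rule ccontr)
        assume "\<not> ?thesis"
        then have "v = 0\<^sub>v n" using v(1) by (intro eq_vecI) auto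
        with v(2) show False by simp
      qed
      then show ?thesis using that by blast
    qed
    moreover have "i \<in> X" using z[OF i(1)] i(2) by (auto split: if_splits)
    ultimately show "\<not> indep_cols A {..<m} X" unfolding indep_cols_def by blast
  next
    assume "\<not> indep_cols A {..<m} X"
    then obtain w s where w: "nullvec A {..<m} X w" "s \<in> X" "w s \<noteq> 0"
      unfolding indep_cols_def by blast
    define v where "v = Matrix.vec n (\<lambda>i. if i \<in> X then w i else 0)"
    have v: "v \<in> carrier_vec n" by (simp add: v_def)
    have "(\<Sum>j\<in>X. A r j * v $ j) = 0" if "r < m" for r
    proof -
      have "(\<Sum>j\<in>X. A r j * v $ j) = (\<Sum>j\<in>X. A r j * w j)"
        using X by (intro sum.cong) (auto simp: v_def)
      then show ?thesis using w that by (simp add: nullvec_def)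
    qed
    then have "(G *\<^sub>v v) $ i = 0" if "i < n" for i
      using Gv[OF that v] that by (simp add: v_def)
    then have "G *\<^sub>v v = 0\<^sub>v n"
      using G by (intro eq_vecI) auto
    moreover have "v \<noteq> 0\<^sub>v n"
    proof
      assume "v = 0\<^sub>v n"
      then have "v $ s = 0" using w X by auto
      then show False using w X by (auto simp: v_def)
    qed
    ultimately show "Determinant.det G = 0"
      using det_0_iff_vec_prod_zero_field[OF G] v by blast
  qed
  then show ?thesis unfolding G_def by blast
qed

lemma rank_attained_cong:
  assumes "\<And>i j. i \<in> V \<Longrightarrow> j \<in> V \<Longrightarrow> A i j = B i j"
  shows "rank_attained A V \<longleftrightarrow> rank_attained B V"
proof -
  have "indep_cols A V X \<longleftrightarrow> indep_cols B V X" if "X \<subseteq> V" for X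
  proof -
    have "(\<Sum>s\<in>X. A i s * w s) = (\<Sum>s\<in>X. B i s * w s)" if "i \<in> V" for i w
      using assms that \<open>X \<subseteq> V\<close> by (intro sum.cong) auto
    then show ?thesis by (simp add: indep_cols_def nullvec_def)
  qed
  moreover have "nb A V T = nb B V T" if "T \<subseteq> V" for T
    using assms that by (force simp: nb_def)
  ultimately show ?thesis unfolding rank_attained_def by (metis (no_types, lifting))
qed

text \<open>The rank is the largest size of an independent set of columns and is at most every term
  of the minimum. Equality thus means that some independent set reaches some term.\<close>

lemma mat_rank_formula_iff:
  fixes Q :: "complex mat"
  assumes Q: "Q \<in> carrier_mat n n" "transpose_mat Q = Q"
  shows "mat_rank Q = Min ((\<lambda>S. n - card S + card (neighbourhood (mat_graph Q) S)) ` Pow (pverts (mat_graph Q)))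
    \<longleftrightarrow> rank_attained (\<lambda>i j. Q $$ (i, j)) {..<n}"
proof -
  let ?A = "\<lambda>i j. Q $$ (i, j)" and ?V = "{..<n}"
  have sym: "Q $$ (j, i) = Q $$ (i, j)" if "i < n" "j < n" for i j
    using Q that by (metis carrier_matD index_transpose_mat(1))
  have V: "pverts (mat_graph Q) = ?V" using Q by (simp add: mat_graph_def)
  have nb: "neighbourhood (mat_graph Q) S = nb ?A ?V S" if "S \<subseteq> ?V" for S
  proof -
    have "(\<exists>u\<in>S. (u, v) \<in> parcs (mat_graph Q)) \<longleftrightarrow> (\<exists>u\<in>S. Q $$ (v, u) \<noteq> 0)" if v: "v < n" for v
      using Q(1) v \<open>S \<subseteq> ?V\<close> sym[OF v] by (intro bex_cong refl) (auto simp: mat_graph_def)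
    then show ?thesis unfolding neighbourhood_def V nb_def by auto
  qed
  let ?f = "\<lambda>S. n - card S + card (nb ?A ?V S)"
  have img: "(\<lambda>S. n - card S + card (neighbourhood (mat_graph Q) S)) ` Pow (pverts (mat_graph Q)) = ?f ` Pow ?V"
    unfolding V using nb by (intro image_cong) auto
  have rank: "mat_rank Q = vec_space.rank n Q" using Q by (simp add: mat_rank_def)
  obtain X where X: "X \<subseteq> ?V" "indep_cols ?A ?V X" "card X = mat_rank Q"
    using vec_space.ex_indep_cols_rank[OF Q(1)] unfolding rank by blast
  have ge: "card X' \<le> mat_rank Q" if "X' \<subseteq> ?V" "indep_cols ?A ?V X'" for X'
    using vec_space.card_indep_cols_le_rank[OF Q(1) that] unfolding rank .
  have le: "mat_rank Q \<le> ?f S" if "S \<subseteq> ?V" for S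
    using indep_card_bound[OF _ _ X(2,1) that] X(3) by simp
  show ?thesis unfolding img
  proof
    assume "mat_rank Q = Min (?f ` Pow ?V)"
    moreover have "Min (?f ` Pow ?V) \<in> ?f ` Pow ?V" by (intro Min_in) auto
    ultimately obtain T where T: "T \<subseteq> ?V" "mat_rank Q = ?f T" by auto
    then have "card ?V - card T + card (nb ?A ?V T) \<le> card X" using X by simp
    then show "rank_attained ?A ?V" unfolding rank_attained_def using X T by blast
  next
    assume "rank_attained ?A ?V"
    then obtain X' T where T: "X' \<subseteq> ?V" "T \<subseteq> ?V" "indep_cols ?A ?V X'" "?f T \<le> card X'"
      unfolding rank_attained_def by auto
    have "?f T \<le> mat_rank Q" using ge[OF T(1,3)] T(4) by linarith
    with le[OF T(2)] have eq: "mat_rank Q = ?f T" by linarith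
    show "mat_rank Q = Min (?f ` Pow ?V)"
    proof (rule Min_eqI[symmetric])
      show "mat_rank Q \<le> y" if "y \<in> ?f ` Pow ?V" for y using that le by auto
      show "mat_rank Q \<in> ?f ` Pow ?V" using eq T(2) by blast
    qed auto
  qed
qed

section \<open>Measurability and the law of the upper triangle\<close>

definition upper_idx :: "nat \<Rightarrow> (nat \<times> nat) set" where
  "upper_idx n = {(i, j). i \<le> j \<and> j < n}"

definition symm_of :: "(nat \<times> nat \<Rightarrow> complex) \<Rightarrow> nat cmatrix" where
  "symm_of x i j = x (min i j, max i j)"

lemma finite_upper_idx: "finite (upper_idx n)"
  by (rule finite_subset[of _ "{..<n} \<times> {..<n}"]) (auto simp: upper_idx_def)

lemma upper_idx_min_max: "i < n \<Longrightarrow> j < n \<Longrightarrow> (min i j, max i j) \<in> upper_idx n"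
  by (auto simp: upper_idx_def)

lemma upper_idx_sedges:
  shows "sedges {..<n} = (\<lambda>(i, j). {i, j}) ` upper_idx n" "inj_on (\<lambda>(i, j). {i, j}) (upper_idx n)"
proof -
  show "inj_on (\<lambda>(i, j). {i, j}) (upper_idx n)"
    by (auto simp: inj_on_def upper_idx_def doubleton_eq_iff)
  show "sedges {..<n} = (\<lambda>(i, j). {i, j}) ` upper_idx n"
  proof
    show "sedges {..<n} \<subseteq> (\<lambda>(i, j). {i, j}) ` upper_idx n"
    proof
      fix e assume "e \<in> sedges {..<n}"
      then obtain i j where e: "e = {i, j}" "i < n" "j < n" by (auto simp: sedges_def)
      then have "e = (\<lambda>(i, j). {i, j}) (min i j, max i j)" by (auto simp: min_def max_def)
      then show "e \<in> (\<lambda>(i, j). {i, j}) ` upper_idx n" using e upper_idx_min_max by blast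
    qed
  qed (auto simp: sedges_def upper_idx_def)
qed

text \<open>Only finitely many column sets and neighbourhoods are possible. Independence is the
  nonvanishing of a determinant that depends continuously on the entries, and fixing a neighbourhood
  is a finite combination of conditions that entries vanish or not.\<close>

lemma sets_rank_attained:
  "{x \<in> space (Pi\<^sub>M (upper_idx n) (\<lambda>_. borel)). rank_attained (symm_of x) {..<n}}
     \<in> sets (Pi\<^sub>M (upper_idx n) (\<lambda>_. borel))"
proof -
  let ?M = "Pi\<^sub>M (upper_idx n) (\<lambda>_. borel :: complex measure)" and ?V = "{..<n}"
  have entry [measurable]: "(\<lambda>x. symm_of x i j) \<in> borel_measurable ?M" if "i < n" "j < n" for i j
    unfolding symm_of_def using upper_idx_min_max[OF that] by measurable
  have ind: "Measurable.pred ?M (\<lambda>x. indep_cols (symm_of x) ?V X)" if X: "X \<subseteq> ?V" for X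
  proof -
    let ?G = "\<lambda>x. Matrix.mat n n (\<lambda>(i, j). if i \<in> X \<and> j \<in> X
        then (\<Sum>r<n. cnj (symm_of x r i) * symm_of x r j) else of_bool (i = j))"
    have "(\<lambda>x. Determinant.det (?G x)) \<in> borel_measurable ?M"
    proof -
      have det: "Determinant.det (?G x) = (\<Sum>\<pi> | \<pi> permutes {0..<n}. signof \<pi> * (\<Prod>i = 0..<n. ?G x $$ (i, \<pi> i)))" for x
        by (rule det_def') simp
      have "(\<lambda>x. ?G x $$ (i, \<pi> i)) \<in> borel_measurable ?M"
        if "\<pi> permutes {0..<n}" "i \<in> {0..<n}" for \<pi> i
      proof -
        have \<pi>: "\<pi> i < n" "i < n" using that permutes_in_image by fastforce+
        show ?thesis
        proof (cases "i \<in> X \<and> \<pi> i \<in> X")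
          case True
          have "(\<lambda>x. \<Sum>r<n. cnj (symm_of x r i) * symm_of x r (\<pi> i)) \<in> borel_measurable ?M"
          proof (intro borel_measurable_sum borel_measurable_times)
            fix r assume "r \<in> {..<n}"
            then have r: "r < n" by simp
            show "(\<lambda>x. symm_of x r (\<pi> i)) \<in> borel_measurable ?M" using r \<pi> by (intro entry)
            show "(\<lambda>x. cnj (symm_of x r i)) \<in> borel_measurable ?M"
              using r \<pi> entry[of r i] by (intro borel_measurable_continuous_on[of cnj]) (auto intro: continuous_intros)
          qed
          with True \<pi> show ?thesis by simp
        qed (use \<pi> in auto)
      qed
      then show ?thesis unfolding det by (intro borel_measurable_sum borel_measurable_times borel_measurable_prod) auto
    qed
    then have "Measurable.pred ?M (\<lambda>x. Determinant.det (?G x) \<noteq> 0)" by measurable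
    then show ?thesis by (simp only: indep_cols_iff_gram_det[OF X])
  qed
  have nbr: "Measurable.pred ?M (\<lambda>x. nb (symm_of x) ?V T = B)" if "T \<subseteq> ?V" "B \<subseteq> ?V" for T B
  proof -
    have bex: "Measurable.pred ?M (\<lambda>x. \<exists>s\<in>T. symm_of x i s \<noteq> 0)" if i: "i < n" for i
    proof (rule pred_intros_finite(4))
      show "finite T" using \<open>T \<subseteq> ?V\<close> finite_subset by blast
      fix s assume "s \<in> T"
      then have s: "s < n" using \<open>T \<subseteq> ?V\<close> by auto
      note entry[OF i s, measurable]
      show "Measurable.pred ?M (\<lambda>x. symm_of x i s \<noteq> 0)" by measurable
    qed
    have "Measurable.pred ?M (\<lambda>x. \<forall>i\<in>?V. (i \<in> B) = (\<exists>s\<in>T. symm_of x i s \<noteq> 0))"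
    proof (rule pred_intros_finite(3))
      fix i assume "i \<in> ?V"
      then show "Measurable.pred ?M (\<lambda>x. (i \<in> B) = (\<exists>s\<in>T. symm_of x i s \<noteq> 0))"
        using bex[of i] by (intro pred_intros_logic(6)) auto
    qed simp
    moreover have "nb (symm_of x) ?V T = B \<longleftrightarrow> (\<forall>i\<in>?V. (i \<in> B) = (\<exists>s\<in>T. symm_of x i s \<noteq> 0))" for x
      using that by (auto simp: nb_def)
    ultimately show ?thesis by simp
  qed
  have eq: "rank_attained (symm_of x) ?V \<longleftrightarrow> (\<exists>X\<in>Pow ?V. \<exists>T\<in>Pow ?V. \<exists>B\<in>Pow ?V.
      (indep_cols (symm_of x) ?V X \<and> nb (symm_of x) ?V T = B) \<and> n - card T + card B \<le> card X)" for x
    unfolding rank_attained_def by (auto simp: nb_def) 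
  have "Measurable.pred ?M (\<lambda>x. rank_attained (symm_of x) ?V)"
    unfolding eq
    by (rule pred_intros_finite(4)[OF _ pred_intros_finite(4)[OF _ pred_intros_finite(4)[OF _
        pred_intros_conj2'[OF pred_intros_logic(3)[OF ind nbr]]]]]) auto
  then show ?thesis by (simp add: pred_def)
qed

text \<open>By independence the upper triangle has a product law, and the probability of failure is
  the integral of an indicator against it. Replacing the entries by two-point variables turns this
  into the edge-set bound \<open>bound\<close>, with the diagonal as the exceptional index
  set.\<close>

lemma prob_rank_attained_ge:
  fixes M :: "'a measure" and Q :: "'a \<Rightarrow> complex mat"
  assumes M: "prob_space M" and n: "1 \<le> n" and p: "0 < p" "p \<le> 1"
    and Q: "random_symmetric_mat M n Q"
    and off: "\<And>i j. i < j \<Longrightarrow> j < n \<Longrightarrow> measure M {\<omega> \<in> space M. Q \<omega> $$ (i, j) = 0} = 1 - p"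
    and diag: "\<And>i. i < n \<Longrightarrow> measure M {\<omega> \<in> space M. Q \<omega> $$ (i, i) = 0} \<ge> 1 - p"
    and bound: "\<And>W. (\<And>i j. W i j = W j i) \<Longrightarrow> (\<And>i j. i \<noteq> j \<Longrightarrow> W i j \<noteq> 0) \<Longrightarrow>
      pr p (sedges {..<n}) (\<lambda>E. \<not> rank_attained (wmat W E) {..<n}) \<le> \<epsilon>"
  shows "1 - \<epsilon> \<le> measure M {\<omega> \<in> space M. rank_attained (\<lambda>i j. Q \<omega> $$ (i, j)) {..<n}}"
proof -
  interpret M: prob_space M by fact
  let ?V = "{..<n}" and ?I = "upper_idx n"
  let ?P = "Pi\<^sub>M ?I (\<lambda>_. borel :: complex measure)"
  let ?R = "\<lambda>\<omega>. rank_attained (\<lambda>i j. Q \<omega> $$ (i, j)) ?V"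
  define X where "X = (\<lambda>e \<omega>. Q \<omega> $$ e)"
  have X_eq: "(\<lambda>(i, j) \<omega>. Q \<omega> $$ (i, j)) = X" by (auto simp: X_def fun_eq_iff)
  have indep: "M.indep_vars (\<lambda>_. borel) X ?I"
    using Q unfolding random_symmetric_mat_def X_eq upper_idx_def by simp
  have sym: "Q \<omega> \<in> carrier_mat n n" "transpose_mat (Q \<omega>) = Q \<omega>" if "\<omega> \<in> space M" for \<omega>
    using Q that unfolding random_symmetric_mat_def by auto
  have rv: "X e \<in> borel_measurable M" if "e \<in> ?I" for e
    using indep that unfolding M.indep_vars_def by auto
  have ne: "?I \<noteq> {}" using n by (auto simp: upper_idx_def intro!: exI[of _ 0])
  \<comment> \<open>The point mass at 0 is a filler outside the triangle, which makes
    \<open>\<mu> e\<close> a probability measure for every index.\<close>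
  define \<mu> where "\<mu> = (\<lambda>e. if e \<in> ?I then distr M borel (X e) else return borel 0)"
  have \<mu>: "prob_space (\<mu> e)" "sets (\<mu> e) = sets borel" for e
    using M.prob_space_distr[OF rv[of e]] by (auto simp: \<mu>_def intro: prob_space_return)
  have \<mu>0: "measure (\<mu> (i, j)) {0} = measure M {\<omega> \<in> space M. Q \<omega> $$ (i, j) = 0}" if "(i, j) \<in> ?I" for i j
    using rv[OF that] that by (auto simp: \<mu>_def measure_distr X_def intro!: arg_cong[where f = "measure M"])
  define Y where "Y = (\<lambda>\<omega>. \<lambda>e\<in>?I. X e \<omega>)"
  have Y: "Y \<in> measurable M ?P" unfolding Y_def by (intro measurable_restrict rv)
  have distr: "distr M ?P Y = Pi\<^sub>M ?I \<mu>"
  proof -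
    have "distr M ?P Y = Pi\<^sub>M ?I (\<lambda>e. distr M borel (X e))"
      using M.indep_vars_iff_distr_eq_PiM'[OF ne, where M' = "\<lambda>_. borel" and X = X] rv indep unfolding Y_def by simp
    also have "... = Pi\<^sub>M ?I \<mu>" by (intro PiM_cong) (auto simp: \<mu>_def)
    finally show ?thesis .
  qed
  have agree: "rank_attained (symm_of (Y \<omega>)) ?V \<longleftrightarrow> ?R \<omega>"
    if "\<omega> \<in> space M" for \<omega>
  proof (rule rank_attained_cong)
    fix i j assume ij: "i \<in> ?V" "j \<in> ?V"
    then have "symm_of (Y \<omega>) i j = Q \<omega> $$ (min i j, max i j)"
      using upper_idx_min_max[of i n j] by (simp add: symm_of_def Y_def X_def)
    also have "... = Q \<omega> $$ (i, j)"
      using sym[OF that] ij by (metis carrier_matD index_transpose_mat(1) lessThan_iff max_def min_def)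
    finally show "symm_of (Y \<omega>) i j = Q \<omega> $$ (i, j)" .
  qed
  define G where "G = {x \<in> space ?P. rank_attained (symm_of x) ?V}"
  have G: "G \<in> sets ?P" unfolding G_def by (rule sets_rank_attained)
  define B where "B = space ?P - G"
  have B: "B \<in> sets ?P" unfolding B_def using G by auto
  have YG: "Y -` G \<inter> space M = {\<omega> \<in> space M. ?R \<omega>}"
    using agree measurable_space[OF Y] by (auto simp: G_def)
  interpret PiP: prob_space "distr M ?P Y" by (rule M.prob_space_distr[OF Y])
  have sets_eq: "sets (Pi\<^sub>M ?I \<mu>) = sets ?P" unfolding distr[symmetric] by simp
  have "(\<integral>x. indicator B x \<partial>Pi\<^sub>M ?I \<mu>) \<le> \<epsilon>"
  proof (rule product_integral_le_bern[where D = "{(i, j). i = j}", OF \<mu> p finite_upper_idx])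
    have "B \<in> sets (Pi\<^sub>M ?I \<mu>)" using B sets_eq by simp
    then show "indicator B \<in> borel_measurable (Pi\<^sub>M ?I \<mu>)" by (rule borel_measurable_indicator)
    show "1 - p \<le> measure (\<mu> e) {0}" if "e \<in> ?I" for e
    proof -
      obtain i j where e: "e = (i, j)" "i \<le> j" "j < n" using \<open>e \<in> ?I\<close> by (auto simp: upper_idx_def)
      show ?thesis using \<mu>0[of i j] that off[of i j] diag[of i] e by (cases "i = j") auto
    qed
    show "measure (\<mu> e) {0} = 1 - p" if "e \<in> ?I" "e \<notin> {(i, j). i = j}" for e
    proof -
      obtain i j where e: "e = (i, j)" "i \<le> j" "j < n" using \<open>e \<in> ?I\<close> by (auto simp: upper_idx_def)
      show ?thesis using \<mu>0[of i j] that off[of i j] e by auto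
    qed
    fix w :: "nat \<times> nat \<Rightarrow> complex" assume w: "\<And>e. e \<notin> {(i, j). i = j} \<Longrightarrow> w e \<noteq> 0"
    let ?\<phi> = "\<lambda>(i, j). {i, j}"
    have "bern p ?I (\<lambda>E. indicator B (\<lambda>e\<in>?I. if e \<in> E then w e else 0)) \<le>
        bern p ?I (\<lambda>E. of_bool (\<not> rank_attained (wmat (symm_of w) (?\<phi> ` E)) ?V))"
    proof (intro bern_mono)
      fix E assume E: "E \<subseteq> ?I"
      let ?x = "\<lambda>e\<in>?I. if e \<in> E then w e else 0"
      have "rank_attained (symm_of ?x) ?V \<longleftrightarrow> rank_attained (wmat (symm_of w) (?\<phi> ` E)) ?V"
      proof (rule rank_attained_cong)
        fix i j assume ij: "i \<in> ?V" "j \<in> ?V"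
        have e: "(min i j, max i j) \<in> ?I" using ij by (intro upper_idx_min_max) auto
        have eq: "{i, j} = ?\<phi> (min i j, max i j)" by (auto simp: min_def max_def)
        have "{i, j} \<in> ?\<phi> ` E \<longleftrightarrow> (min i j, max i j) \<in> E"
          unfolding eq using inj_on_image_mem_iff[OF upper_idx_sedges(2) e E] .
        then show "symm_of ?x i j = wmat (symm_of w) (?\<phi> ` E) i j"
          using e by (simp add: symm_of_def wmat_def)
      qed
      moreover have "?x \<in> space ?P" by (auto simp: space_PiM)
      ultimately show "indicator B ?x \<le> (of_bool (\<not> rank_attained (wmat (symm_of w) (?\<phi> ` E)) ?V) :: real)"
        by (auto simp: B_def G_def indicator_def)
    qed (use p in auto)
    also have "... = pr p (sedges ?V) (\<lambda>E. \<not> rank_attained (wmat (symm_of w) E) ?V)"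
      unfolding upper_idx_sedges(1) by (rule bern_image[OF finite_upper_idx upper_idx_sedges(2), symmetric])
    also have "... \<le> \<epsilon>"
    proof (rule bound)
      show "symm_of w i j = symm_of w j i" for i j by (simp add: symm_of_def min.commute max.commute)
      show "symm_of w i j \<noteq> 0" if "i \<noteq> j" for i j
        unfolding symm_of_def using that by (intro w) (auto simp: min_def max_def)
    qed
    finally show "bern p ?I (\<lambda>E. indicator B (\<lambda>e\<in>?I. if e \<in> E then w e else 0)) \<le> \<epsilon>" .
  qed (auto simp: indicator_def)
  also have "(\<integral>x. indicator B x \<partial>Pi\<^sub>M ?I \<mu>) = measure (distr M ?P Y) B"
    unfolding distr[symmetric] using B by (simp add: PiP.emeasure_eq_measure)
  also have "... = 1 - measure (distr M ?P Y) G"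
    unfolding B_def using PiP.prob_compl[of G] G by simp
  also have "measure (distr M ?P Y) G = measure M {\<omega> \<in> space M. ?R \<omega>}"
    using measure_distr[OF Y G] YG by simp
  finally show ?thesis by simp
qed

theorem corollary1p3:
  fixes p :: "nat \<Rightarrow> real"
    and M :: "nat \<Rightarrow> 'a measure"
    and Q :: "nat \<Rightarrow> 'a \<Rightarrow> complex mat"
  assumes p_less: "\<And>n. n \<ge> 1 \<Longrightarrow> p n < 1 / 2"
    and p_Omega: "\<exists>c>0. \<forall>\<^sub>F n in sequentially. p n \<ge> c * ln (real n) / real n"
    and prob_space: "\<And>n. n \<ge> 1 \<Longrightarrow> prob_space (M n)"
    and random_mat: "\<And>n. n \<ge> 1 \<Longrightarrow> random_symmetric_mat (M n) n (Q n)"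
    and off_diagonal: "\<And>n i j. i < j \<Longrightarrow> j < n \<Longrightarrow>
          measure (M n) {\<omega> \<in> space (M n). Q n \<omega> $$ (i, j) = 0} = 1 - p n"
    and diagonal: "\<And>n i. i < n \<Longrightarrow>
          measure (M n) {\<omega> \<in> space (M n). Q n \<omega> $$ (i, i) = 0} \<ge> 1 - p n"
  shows "(\<lambda>n. measure (M n) {\<omega> \<in> space (M n).
            mat_rank (Q n \<omega>) =
              Min ((\<lambda>S. n - card S + card (neighbourhood (mat_graph (Q n \<omega>)) S))
                     ` Pow (pverts (mat_graph (Q n \<omega>))))})
         \<longlonglongrightarrow> 1"
proof -
  let ?G = "\<lambda>n. {\<omega> \<in> space (M n). rank_attained (\<lambda>i j. Q n \<omega> $$ (i, j)) {..<n}}"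
  let ?F = "\<lambda>n. {\<omega> \<in> space (M n). mat_rank (Q n \<omega>) =
      Min ((\<lambda>S. n - card S + card (neighbourhood (mat_graph (Q n \<omega>)) S))
        ` Pow (pverts (mat_graph (Q n \<omega>))))}"
  have formula: "?F n = ?G n" if "1 \<le> n" for n
    using mat_rank_formula_iff random_mat[OF that] unfolding random_symmetric_mat_def by blast
  have "(\<lambda>n. measure (M n) (?G n)) \<longlonglongrightarrow> 1"
  proof (rule tendstoI)
    fix \<epsilon> :: real assume \<epsilon>: "0 < \<epsilon>"
    obtain D where D: "D > 0"
      "\<And>p V (W :: nat cmatrix). \<lbrakk>0 < p; p \<le> 1 / 2; finite V; \<And>i j. W i j = W j i;
        \<And>i j. i \<noteq> j \<Longrightarrow> W i j \<noteq> 0; D \<le> p * real (card V)\<rbrakk>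
        \<Longrightarrow> pr p (sedges V) (\<lambda>E. \<not> rank_attained (wmat W E) V) \<le> \<epsilon> / 2"
      by (rule pr_not_rank_attained_small[of "\<epsilon> / 2"]) (use \<epsilon> in auto)
    obtain c where c: "c > 0" "\<forall>\<^sub>F n in sequentially. p n \<ge> c * ln (real n) / real n"
      using p_Omega by blast
    have "filterlim (\<lambda>n. c * ln (real n)) at_top sequentially" using c(1) by real_asymp
    then have "\<forall>\<^sub>F n in sequentially. D \<le> c * ln (real n)" by (simp add: filterlim_at_top)
    moreover have "\<forall>\<^sub>F n in sequentially. 1 \<le> n" by (rule eventually_ge_at_top)
    ultimately show "\<forall>\<^sub>F n in sequentially. dist (measure (M n) (?G n)) 1 < \<epsilon>"
      using c(2)
    proof eventually_elim
      case (elim n)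
      then have n: "0 < real n" by simp
      have "c * ln (real n) \<le> p n * real n" using elim n by (simp add: pos_divide_le_eq)
      with elim have pn: "D \<le> p n * real n" by linarith
      with D(1) have "0 < p n * real n" by linarith
      then have p0: "0 < p n" using n by (simp add: zero_less_mult_iff)
      have p1: "p n \<le> 1 / 2" using p_less[OF elim(2)] by simp
      interpret prob_space "M n" by (rule prob_space[OF elim(2)])
      have "1 - \<epsilon> / 2 \<le> measure (M n) (?G n)"
      proof (rule prob_rank_attained_ge[where p = "p n"])
        show "pr (p n) (sedges {..<n}) (\<lambda>E. \<not> rank_attained (wmat W E) {..<n}) \<le> \<epsilon> / 2"
          if "\<And>i j. W i j = W j i" "\<And>i j. i \<noteq> j \<Longrightarrow> W i j \<noteq> 0" for W
          by (rule D(2)[OF p0 p1 finite_lessThan that]) (use pn in simp_all)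
        show "prob_space (M n)" by (rule prob_space_axioms)
      qed (use p0 p1 elim random_mat off_diagonal diagonal in auto)
      moreover have "measure (M n) (?G n) \<le> 1" by (rule prob_le_1)
      ultimately show ?case using \<epsilon> by (simp add: dist_real_def)
    qed
  qed
  moreover have "\<forall>\<^sub>F n in sequentially. measure (M n) (?G n) = measure (M n) (?F n)"
    using eventually_ge_at_top[of 1] by eventually_elim (simp only: formula)
  ultimately show ?thesis by (rule Lim_transform_eventually)
qed

end
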